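(* Assume that $\sup_{u\in[0,T]}\sum_{k\in\mathbb Z} f(u-k\Delta)<\infty$ and let $c>0$ be a constant service rate. Define $$B^{(n)}(t):=\bar A^{(n)}(t)-ct,\qquad Q^{(n)}(t):=\sup_{0\le s\le t}\bigl(B^{(n)}(t)-B^{(n)}(s)\bigr),\qquad t\in[0,T].$$ Then, on $D([0,T])$ equipped with the Skorokhod $J_1$ topology: (1) the sequence of net-input processes $\{B^{(n)}\}_{n\ge1}$ satisfies a large deviations principle with speed $n$ and good rate function $J_T(x)=I_T(\phi_x)$, where $\phi_x(t):=x(t)+ct$ for $t\in[0,T]$; (2) the sequence of workload processes $\{Q^{(n)}\}_{n\ge1}$ satisfies a large deviations principle with speed $n$ and rate function $$K_T(q)=\inf\bigl\{J_T(x): x\in D([0,T]),\ q=\Psi(x)\bigr\},\qquad q\in D([0,T]),$$ where $\Psi(x)(t):=\sup_{0\le s\le t}(x(t)-x(s))$ for $x\in D([0,T])$, $t\in[0,T]$.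
   Context: Fix $\Delta>0$ and $T>0$. Let $(T_k)_{k\in\mathbb Z}$ be i.i.d. real random variables with distribution function $F$ and probability density $f$. Put $A_k:=k\Delta+T_k$ for $k\in\mathbb Z$, and define the arrival counting process $A(t):=\sum_{k\in\mathbb Z}\mathbf 1_{\{0<A_k\le t\}}$, $t\in[0,T]$, which is nondecreasing with càdlàg paths (almost surely finite). Let $A^{(1)},A^{(2)},\dots$ be i.i.d. copies of the process $A$ and set $\bar A^{(n)}(t):=\frac1n\sum_{i=1}^nA^{(i)}(t)$, $t\in[0,T]$. $D([0,T])$ is the space of càdlàg functions $[0,T]\to\mathbb R$. For $\phi\in D([0,T])$ define $$I_T(\phi)=\sup_{m\ge1}\ \sup_{0<t_1<\cdots<t_m\le T}\ \sup_{\alpha\in\mathbb R^m}\Bigl\{\sum_{\ell=1}^m\alpha_\ell\phi(t_\ell)-\log\mathbb E\exp\Bigl(\sum_{\ell=1}^m\alpha_\ell A(t_\ell)\Bigr)\Bigr\}.$$ Large deviations principle: random elements $X^{(n)}$ of a topological space $E$ satisfy an LDP with speed $n$ and rate function $I:E\to[0,\infty]$ if $\limsup_{n}\frac1n\log\mathbb P(X^{(n)}\in C)\le-\inf_{x\in C}I(x)$ for every closed $C\subset E$ and $\liminf_n\frac1n\log\mathbb P(X^{(n)}\in G)\ge-\inf_{x\in G}I(x)$ for every open $G\subset E$. The rate function is good if the level sets $\{x:I(x)\le M\}$ are compact for all $M<\infty$. The infimum over the empty set is $+\infty$. *)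

theory Defs
  imports "HOL-Probability.Probability"
begin

section \<open>The Skorokhod space\<close>

text \<open>
  A function \<open>[0,T] \<rightarrow> \<real>\<close> is represented by a function on \<open>\<real>\<close> that is extensional on \<open>{0..T}\<close>, so
  that equality in \<open>D_space T\<close> is equality on \<open>[0,T]\<close>.
\<close>

definition D_space :: "real \<Rightarrow> (real \<Rightarrow> real) set" where
  "D_space T = {x \<in> extensional {0..T}.
     (\<forall>t\<in>{0..<T}. (x \<longlongrightarrow> x t) (at_right t)) \<and>
     (\<forall>t\<in>{0<..T}. \<exists>l. (x \<longlongrightarrow> l) (at_left t))}"

definition time_changes :: "real \<Rightarrow> (real \<Rightarrow> real) set" where
  "time_changes T = {\<mu>. continuous_on {0..T} \<mu> \<and> strict_mono_on {0..T} \<mu> \<and> \<mu> 0 = 0 \<and> \<mu> T = T}"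

definition J1_close :: "real \<Rightarrow> real \<Rightarrow> (real \<Rightarrow> real) \<Rightarrow> (real \<Rightarrow> real) \<Rightarrow> bool" where
  "J1_close T e x y \<longleftrightarrow>
     (\<exists>\<mu>\<in>time_changes T. \<forall>t\<in>{0..T}. \<bar>\<mu> t - t\<bar> \<le> e \<and> \<bar>x t - y (\<mu> t)\<bar> \<le> e)"

text \<open>
  The value \<open>0\<close> outside \<open>D_space T\<close> is a convention that makes the function nonnegative on the
  whole type, as the locale \<^locale>\<open>Metric_space\<close> requires; it does not affect the topology.
\<close>

definition J1_dist :: "real \<Rightarrow> (real \<Rightarrow> real) \<Rightarrow> (real \<Rightarrow> real) \<Rightarrow> real" where
  "J1_dist T x y =
     (if x \<in> D_space T \<and> y \<in> D_space T then Inf {e. 0 < e \<and> J1_close T e x y} else 0)"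

definition J1_topology :: "real \<Rightarrow> (real \<Rightarrow> real) topology" where
  "J1_topology T = Metric_space.mtopology (D_space T) (J1_dist T)"


subsection \<open>The Skorokhod distance is a metric\<close>

lemma time_change_in:
  assumes "l \<in> time_changes T" "t \<in> {0..T}"
  shows "l t \<in> {0..T}"
proof -
  have "mono_on {0..T} l"
    using assms(1) by (simp add: time_changes_def strict_mono_on_imp_mono_on)
  then have "l 0 \<le> l t" "l t \<le> l T"
    using assms(2) by (auto simp: mono_on_def)
  then show ?thesis
    using assms(1) by (simp add: time_changes_def)
qed

lemma time_change_image:
  assumes "l \<in> time_changes T" "0 \<le> T"
  shows "l ` {0..T} = {0..T}"
proof
  show "l ` {0..T} \<subseteq> {0..T}"
    using time_change_in[OF assms(1)] by blast
  show "{0..T} \<subseteq> l ` {0..T}"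
  proof
    fix y assume "y \<in> {0..T}"
    then have "\<exists>x\<ge>0. x \<le> T \<and> l x = y"
      using assms by (intro IVT') (auto simp: time_changes_def)
    then show "y \<in> l ` {0..T}" by auto
  qed
qed

lemma J1_close_sym:
  assumes "0 \<le> T" "J1_close T e x y"
  shows "J1_close T e y x"
proof -
  obtain l where l: "l \<in> time_changes T"
    and le: "\<And>t. t \<in> {0..T} \<Longrightarrow> \<bar>l t - t\<bar> \<le> e \<and> \<bar>x t - y (l t)\<bar> \<le> e"
    using assms(2) unfolding J1_close_def by blast
  define k where "k = the_inv_into {0..T} l"
  have inj: "inj_on l {0..T}"
    using l by (simp add: time_changes_def strict_mono_on_imp_inj_on)
  have im: "l ` {0..T} = {0..T}"
    using time_change_image[OF l assms(1)] .
  have kl: "k (l t) = t" if "t \<in> {0..T}" for t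
    using the_inv_into_f_f[OF inj that] by (simp add: k_def)
  have lk: "l (k t) = t" if "t \<in> {0..T}" for t
    using f_the_inv_into_f[OF inj] that im by (simp add: k_def)
  have kin: "k t \<in> {0..T}" if "t \<in> {0..T}" for t
    using the_inv_into_into[OF inj _ subset_refl] that im by (simp add: k_def)
  have "continuous_on (l ` {0..T}) k"
    using l by (intro continuous_on_inv) (auto simp: time_changes_def kl)
  moreover have "strict_mono_on {0..T} k"
  proof (rule strict_mono_onI)
    fix r s assume rs: "r \<in> {0..T}" "s \<in> {0..T}" "r < s"
    show "k r < k s"
    proof (rule ccontr)
      assume "\<not> k r < k s"
      then have "l (k s) \<le> l (k r)"
        using l kin[OF rs(1)] kin[OF rs(2)] strict_mono_on_imp_mono_on[of "{0..T}" l]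
        by (auto simp: time_changes_def mono_on_def)
      then show False using lk rs by simp
    qed
  qed
  moreover have "k 0 = 0" "k T = T"
    using kl[of 0] kl[of T] l assms(1) by (auto simp: time_changes_def)
  ultimately have "k \<in> time_changes T"
    by (simp add: time_changes_def im)
  moreover have "\<bar>k t - t\<bar> \<le> e \<and> \<bar>y t - x (k t)\<bar> \<le> e" if "t \<in> {0..T}" for t
    using le[OF kin[OF that]] lk[OF that] by auto
  ultimately show ?thesis
    unfolding J1_close_def by blast
qed

lemma J1_close_trans:
  assumes "J1_close T e x y" "J1_close T e' y z"
  shows "J1_close T (e + e') x z"
proof -
  obtain l where l: "l \<in> time_changes T"
    and le: "\<And>t. t \<in> {0..T} \<Longrightarrow> \<bar>l t - t\<bar> \<le> e \<and> \<bar>x t - y (l t)\<bar> \<le> e"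
    using assms(1) unfolding J1_close_def by blast
  obtain k where k: "k \<in> time_changes T"
    and ke: "\<And>t. t \<in> {0..T} \<Longrightarrow> \<bar>k t - t\<bar> \<le> e' \<and> \<bar>y t - z (k t)\<bar> \<le> e'"
    using assms(2) unfolding J1_close_def by blast
  have lin: "l ` {0..T} \<subseteq> {0..T}"
    using time_change_in[OF l] by blast
  have "continuous_on {0..T} (k \<circ> l)"
    using l k lin by (intro continuous_on_compose)
      (auto simp: time_changes_def intro: continuous_on_subset)
  moreover have "strict_mono_on {0..T} (k \<circ> l)"
    using l k lin by (auto simp: time_changes_def strict_mono_on_def image_subset_iff)
  ultimately have "k \<circ> l \<in> time_changes T"
    using l k by (simp add: time_changes_def)
  moreover have "\<bar>(k \<circ> l) t - t\<bar> \<le> e + e' \<and> \<bar>x t - z ((k \<circ> l) t)\<bar> \<le> e + e'"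
    if "t \<in> {0..T}" for t
    using le[OF that] ke[OF time_change_in[OF l that]] unfolding o_def by linarith
  ultimately show ?thesis
    unfolding J1_close_def by blast
qed

lemma D_space_bounded:
  assumes "x \<in> D_space T"
  obtains K where "\<And>t. t \<in> {0..T} \<Longrightarrow> \<bar>x t\<bar> \<le> K"
proof -
  have loc: "\<exists>U b. open U \<and> t \<in> U \<and> (\<forall>s\<in>U \<inter> {0..T}. \<bar>x s\<bar> \<le> b)" if t: "t \<in> {0..T}" for t
  proof -
    obtain u b1 where u: "u > t" "\<And>s. t < s \<Longrightarrow> s < u \<Longrightarrow> s \<le> T \<Longrightarrow> \<bar>x s\<bar> \<le> b1"
    proof (cases "t < T")
      case True
      then have "(x \<longlongrightarrow> x t) (at_right t)"
        using assms t by (simp add: D_space_def)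
      then have "eventually (\<lambda>s. dist (x s) (x t) < 1) (at_right t)"
        by (rule tendstoD) simp
      then obtain u where u: "u > t" "\<And>s. t < s \<Longrightarrow> s < u \<Longrightarrow> dist (x s) (x t) < 1"
        by (auto simp: eventually_at_right_field)
      have "\<bar>x s\<bar> \<le> \<bar>x t\<bar> + 1" if "t < s" "s < u" for s
        using u(2)[OF that] unfolding dist_real_def by linarith
      then show ?thesis
        by (rule that[OF u(1)])
    next
      case False
      with t show ?thesis by (intro that[of "t + 1" 0]) auto
    qed
    obtain v b2 where v: "v < t" "\<And>s. v < s \<Longrightarrow> s < t \<Longrightarrow> 0 \<le> s \<Longrightarrow> \<bar>x s\<bar> \<le> b2"
    proof (cases "0 < t")
      case True
      then have "t \<in> {0<..T}"
        using t by simp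
      then obtain a where "(x \<longlongrightarrow> a) (at_left t)"
        using assms unfolding D_space_def by blast
      then have "eventually (\<lambda>s. dist (x s) a < 1) (at_left t)"
        by (rule tendstoD) simp
      then obtain v where v: "v < t" "\<And>s. v < s \<Longrightarrow> s < t \<Longrightarrow> dist (x s) a < 1"
        by (auto simp: eventually_at_left_field)
      have "\<bar>x s\<bar> \<le> \<bar>a\<bar> + 1" if "v < s" "s < t" for s
        using v(2)[OF that] unfolding dist_real_def by linarith
      then show ?thesis
        by (rule that[OF v(1)])
    next
      case False
      with t show ?thesis by (intro that[of "t - 1" 0]) auto
    qed
    have "\<bar>x s\<bar> \<le> max \<bar>x t\<bar> (max b1 b2)" if "s \<in> {v<..<u} \<inter> {0..T}" for s
      using that u(2)[of s] v(2)[of s] by (cases s t rule: linorder_cases) auto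
    then show ?thesis
      using u(1) v(1) by (intro exI[of _ "{v<..<u}"] exI[of _ "max \<bar>x t\<bar> (max b1 b2)"]) auto
  qed
  then obtain U b where Ub: "\<And>t. t \<in> {0..T} \<Longrightarrow> open (U t) \<and> t \<in> U t \<and>
      (\<forall>s\<in>U t \<inter> {0..T}. \<bar>x s\<bar> \<le> b t)"
    by metis
  have "compact {0..T}" by simp
  moreover have "\<And>t. t \<in> {0..T} \<Longrightarrow> open (U t)" "{0..T} \<subseteq> (\<Union>t\<in>{0..T}. U t)"
    using Ub by blast+
  ultimately obtain C where C: "C \<subseteq> {0..T}" "finite C" "{0..T} \<subseteq> (\<Union>t\<in>C. U t)"
    by (rule compactE_image)
  show ?thesis
  proof (rule that[of "\<Sum>t\<in>C. \<bar>b t\<bar>"])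
    fix s assume s: "s \<in> {0..T}"
    then obtain t where t: "t \<in> C" "s \<in> U t" using C by auto
    then have "\<bar>x s\<bar> \<le> \<bar>b t\<bar>"
      using Ub[of t] C(1) s by (blast intro: order_trans[OF _ abs_ge_self])
    also have "\<dots> \<le> (\<Sum>t\<in>C. \<bar>b t\<bar>)"
      using t C(2) by (intro member_le_sum) auto
    finally show "\<bar>x s\<bar> \<le> (\<Sum>t\<in>C. \<bar>b t\<bar>)" .
  qed
qed

lemma id_time_change: "(\<lambda>t. t) \<in> time_changes T"
  by (simp add: time_changes_def strict_mono_on_def)

lemma J1_close_ex:
  assumes "x \<in> D_space T" "y \<in> D_space T"
  shows "\<exists>e>0. J1_close T e x y"
proof -
  obtain K where K: "\<And>t. t \<in> {0..T} \<Longrightarrow> \<bar>x t\<bar> \<le> K"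
    using D_space_bounded[OF assms(1)] by blast
  obtain L where L: "\<And>t. t \<in> {0..T} \<Longrightarrow> \<bar>y t\<bar> \<le> L"
    using D_space_bounded[OF assms(2)] by blast
  have "\<bar>x t - y t\<bar> \<le> \<bar>K\<bar> + \<bar>L\<bar> + 1" if "t \<in> {0..T}" for t
    using K[OF that] L[OF that] by linarith
  then have "J1_close T (\<bar>K\<bar> + \<bar>L\<bar> + 1) x y"
    unfolding J1_close_def by (intro bexI[OF _ id_time_change]) auto
  then show ?thesis
    by (intro exI[of _ "\<bar>K\<bar> + \<bar>L\<bar> + 1"]) auto
qed

lemma J1_dist_nonneg: "0 \<le> J1_dist T x y"
proof (cases "x \<in> D_space T \<and> y \<in> D_space T")
  case True
  then have "{e. 0 < e \<and> J1_close T e x y} \<noteq> {}"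
    using J1_close_ex by blast
  then show ?thesis
    using True by (auto simp: J1_dist_def intro!: cInf_greatest)
qed (auto simp: J1_dist_def)

lemma J1_dist_lessD:
  assumes "x \<in> D_space T" "y \<in> D_space T" "J1_dist T x y < r"
  obtains e where "0 < e" "e < r" "J1_close T e x y"
proof -
  have ne: "{e. 0 < e \<and> J1_close T e x y} \<noteq> {}"
    using J1_close_ex[OF assms(1,2)] by blast
  have "Inf {e. 0 < e \<and> J1_close T e x y} < r"
    using assms by (simp add: J1_dist_def)
  from cInf_lessD[OF ne this] show ?thesis
    using that by blast
qed

lemma J1_dist_le:
  assumes "x \<in> D_space T" "y \<in> D_space T" "0 < e" "J1_close T e x y"
  shows "J1_dist T x y \<le> e"
  using assms by (auto simp: J1_dist_def intro!: cInf_lower bdd_belowI[of _ 0])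

lemma J1_close_imp_eq:
  assumes T: "0 \<le> T" and x: "x \<in> D_space T" and y: "y \<in> D_space T"
    and close: "\<And>r. 0 < r \<Longrightarrow> \<exists>e<r. J1_close T e x y"
  shows "x = y"
proof -
  have approx: "\<exists>v\<in>{0..T}. \<bar>v - t\<bar> < r \<and> \<bar>x t - y v\<bar> < r" if "t \<in> {0..T}" "0 < r" for t r
  proof -
    obtain e where e: "e < r" "J1_close T e x y"
      using close[OF \<open>0 < r\<close>] by blast
    from e(2) obtain l where l: "l \<in> time_changes T"
      and le: "\<forall>t\<in>{0..T}. \<bar>l t - t\<bar> \<le> e \<and> \<bar>x t - y (l t)\<bar> \<le> e"
      unfolding J1_close_def by (elim bexE)
    have "\<bar>l t - t\<bar> < r \<and> \<bar>x t - y (l t)\<bar> < r"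
      using bspec[OF le that(1)] e(1) by linarith
    then show ?thesis
      using time_change_in[OF l that(1)] by (rule bexI)
  qed
  have "x t = y t" if t: "t \<in> {0..T}" for t
  proof (cases "t = T")
    case True
    have "\<bar>x T - y T\<bar> \<le> 0 + r" if r: "0 < r" for r
    proof -
      obtain e where e: "e < r" "J1_close T e x y"
        using close[OF r] by blast
      from e(2) obtain l where l: "l \<in> time_changes T"
        and le: "\<forall>t\<in>{0..T}. \<bar>l t - t\<bar> \<le> e \<and> \<bar>x t - y (l t)\<bar> \<le> e"
        unfolding J1_close_def by (elim bexE)
      have "l T = T" using l by (simp add: time_changes_def)
      moreover have "T \<in> {0..T}" using T by simp
      ultimately have "\<bar>x T - y T\<bar> \<le> e" using le by metis
      then show ?thesis using e(1) by linarith
    qed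
    then have "\<bar>x T - y T\<bar> \<le> 0"
      by (rule field_le_epsilon)
    then show ?thesis using True by simp
  next
    case False
    with t have tT: "0 \<le> t" "t < T" by auto
    have "\<bar>x t - y t\<bar> \<le> 0 + r" if r: "0 < r" for r
    proof -
      have "eventually (\<lambda>s. dist (x s) (x t) < r/3) (at_right t)"
        using x tT r by (intro tendstoD) (auto simp: D_space_def)
      then obtain u where u: "u > t" "\<And>s. t < s \<Longrightarrow> s < u \<Longrightarrow> dist (x s) (x t) < r/3"
        by (auto simp: eventually_at_right_field)
      have "eventually (\<lambda>s. dist (y s) (y t) < r/3) (at_right t)"
        using y tT r by (intro tendstoD) (auto simp: D_space_def)
      then obtain w where w: "w > t" "\<And>s. t < s \<Longrightarrow> s < w \<Longrightarrow> dist (y s) (y t) < r/3"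
        by (auto simp: eventually_at_right_field)
      define m where "m = min (min u w) T"
      have m: "t < m" "m \<le> u" "m \<le> w" "m \<le> T"
        using u w tT by (auto simp: m_def)
      define s where "s = (t + m) / 2"
      have s: "t < s" "s < m" using m by (auto simp: s_def field_simps)
      have pos: "0 < Min {r/3, s - t, m - s}" using r s by simp
      have sin: "s \<in> {0..T}" using s m tT by auto
      obtain v where v: "\<bar>v - s\<bar> < Min {r/3, s - t, m - s}"
          "\<bar>x s - y v\<bar> < Min {r/3, s - t, m - s}"
        using approx[OF sin pos] by blast
      have "t < v" "v < w" using v(1) m by auto
      then have "dist (y v) (y t) < r/3" by (rule w(2))
      moreover have "dist (x s) (x t) < r/3"
        using s m by (intro u(2)) auto
      moreover have "\<bar>x s - y v\<bar> < r/3" using v(2) by simp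
      ultimately show ?thesis unfolding dist_real_def by linarith
    qed
    then have "\<bar>x t - y t\<bar> \<le> 0"
      by (rule field_le_epsilon)
    then show ?thesis by simp
  qed
  then show ?thesis
    using x y by (intro extensionalityI[of x "{0..T}" y]) (auto simp: D_space_def)
qed

theorem Metric_space_J1:
  assumes T: "0 \<le> T"
  shows "Metric_space (D_space T) (J1_dist T)"
proof
  fix x y :: "real \<Rightarrow> real"
  show "0 \<le> J1_dist T x y" by (rule J1_dist_nonneg)
  have "J1_close T e x y \<longleftrightarrow> J1_close T e y x" for e
    using J1_close_sym[OF T] by blast
  then show "J1_dist T x y = J1_dist T y x"
    by (simp add: J1_dist_def conj_commute)
next
  fix x y assume xy: "x \<in> D_space T" "y \<in> D_space T"
  show "J1_dist T x y = 0 \<longleftrightarrow> x = y"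
  proof
    assume "J1_dist T x y = 0"
    then have "\<exists>e<r. J1_close T e x y" if "0 < r" for r
      using J1_dist_lessD[OF xy, of r] that by auto
    then show "x = y" using J1_close_imp_eq[OF T xy] by blast
  next
    assume "x = y"
    have "J1_dist T x y \<le> 0 + e" if "0 < e" for e
    proof -
      have "J1_close T e x y"
        using that \<open>x = y\<close> unfolding J1_close_def by (intro bexI[OF _ id_time_change]) auto
      then show ?thesis using J1_dist_le[OF xy that] by simp
    qed
    then have "J1_dist T x y \<le> 0" by (rule field_le_epsilon)
    then show "J1_dist T x y = 0" using J1_dist_nonneg[of T x y] by simp
  qed
next
  fix x y z assume xyz: "x \<in> D_space T" "y \<in> D_space T" "z \<in> D_space T"
  show "J1_dist T x z \<le> J1_dist T x y + J1_dist T y z"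
  proof (rule field_le_epsilon)
    fix r :: real assume r: "0 < r"
    obtain e where e: "0 < e" "e < J1_dist T x y + r/2" "J1_close T e x y"
      using J1_dist_lessD[OF xyz(1,2), of "J1_dist T x y + r/2"] r by auto
    obtain e' where e': "0 < e'" "e' < J1_dist T y z + r/2" "J1_close T e' y z"
      using J1_dist_lessD[OF xyz(2,3), of "J1_dist T y z + r/2"] r by auto
    have "J1_dist T x z \<le> e + e'"
      using J1_dist_le[OF xyz(1,3)] J1_close_trans[OF e(3) e'(3)] e(1) e'(1) by simp
    then show "J1_dist T x z \<le> J1_dist T x y + J1_dist T y z + r"
      using e(2) e'(2) by simp
  qed
qed

lemma topspace_J1_topology: "0 \<le> T \<Longrightarrow> topspace (J1_topology T) = D_space T"
  unfolding J1_topology_def by (rule Metric_space.topspace_mtopology[OF Metric_space_J1])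


section \<open>Large deviations principle with speed \<open>n\<close>\<close>

definition log_prob :: "real \<Rightarrow> ereal" where
  "log_prob p = (if p = 0 then - \<infinity> else ereal (ln p))"

definition borel_sigma :: "'e topology \<Rightarrow> 'e measure" where
  "borel_sigma E = sigma (topspace E) {U. openin E U}"

definition LDP_speed_n ::
    "'b measure \<Rightarrow> 'e topology \<Rightarrow> (nat \<Rightarrow> 'b \<Rightarrow> 'e) \<Rightarrow> ('e \<Rightarrow> ereal) \<Rightarrow> bool" where
  "LDP_speed_n N E X I \<longleftrightarrow>
     (\<forall>n\<ge>1. X n \<in> N \<rightarrow>\<^sub>M borel_sigma E) \<and>
     (\<forall>x\<in>topspace E. 0 \<le> I x) \<and>
     (\<forall>C. closedin E C \<longrightarrow>
        limsup (\<lambda>n. ereal (1 / real n) * log_prob (measure N {\<omega> \<in> space N. X n \<omega> \<in> C}))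
          \<le> - (INF x\<in>C. I x)) \<and>
     (\<forall>G. openin E G \<longrightarrow>
        - (INF x\<in>G. I x)
          \<le> liminf (\<lambda>n. ereal (1 / real n) * log_prob (measure N {\<omega> \<in> space N. X n \<omega> \<in> G})))"

definition good_rate :: "'e topology \<Rightarrow> ('e \<Rightarrow> ereal) \<Rightarrow> bool" where
  "good_rate E I \<longleftrightarrow> (\<forall>M::real. compactin E {x \<in> topspace E. I x \<le> ereal M})"


section \<open>The arrival process and the queue\<close>

text \<open>
  \<open>\<xi> k\<close> is the random perturbation of the \<open>k\<close>-th scheduled arrival time \<open>k\<Delta>\<close>. On the null event where
  infinitely many arrivals fall in \<open>(0,t]\<close> the real-valued sum takes the value \<open>0\<close>.
\<close>

definition arrival_count :: "real \<Rightarrow> (int \<Rightarrow> 'a \<Rightarrow> real) \<Rightarrow> 'a \<Rightarrow> real \<Rightarrow> real" where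
  "arrival_count \<Delta> \<xi> \<omega> t =
     (\<Sum>\<^sub>\<infinity>k\<in>UNIV. indicator {0<..t} (of_int k * \<Delta> + \<xi> k \<omega>))"

text \<open>
  \<open>X 1, X 2, \<dots>\<close> (on \<open>N\<close>) are independent random elements of \<open>D_space T\<close>, each with the law of the
  process \<open>A\<close> (on \<open>M\<close>). Laws of processes live on the product \<open>\<sigma>\<close>-algebra of \<open>\<real>\<^bsup>[0,T]\<^esup>\<close>.
\<close>

definition iid_copies ::
    "'b measure \<Rightarrow> real \<Rightarrow> (nat \<Rightarrow> 'b \<Rightarrow> real \<Rightarrow> real) \<Rightarrow> 'a measure \<Rightarrow> ('a \<Rightarrow> real \<Rightarrow> real) \<Rightarrow> bool"
  where
  "iid_copies N T X M A \<longleftrightarrow>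
     (\<forall>i\<ge>1. \<forall>\<omega>\<in>space N. X i \<omega> \<in> D_space T) \<and>
     prob_space.indep_vars N (\<lambda>_. PiM {0..T} (\<lambda>_. borel)) X {1..} \<and>
     (\<forall>i\<ge>1. distr N (PiM {0..T} (\<lambda>_. borel)) (X i) =
              distr M (PiM {0..T} (\<lambda>_. borel)) (\<lambda>\<omega>. \<lambda>t\<in>{0..T}. A \<omega> t))"

definition rate_I :: "'a measure \<Rightarrow> ('a \<Rightarrow> real \<Rightarrow> real) \<Rightarrow> real \<Rightarrow> (real \<Rightarrow> real) \<Rightarrow> ereal" where
  "rate_I M A T \<phi> =
     (SUP m\<in>{1::nat..}.
      SUP t\<in>{t :: nat \<Rightarrow> real. 0 < t 1 \<and> strict_mono_on {1..m} t \<and> t m \<le> T}.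
      SUP \<alpha>\<in>(UNIV :: (nat \<Rightarrow> real) set).
        ereal ((\<Sum>l=1..m. \<alpha> l * \<phi> (t l))
               - ln (\<integral>\<omega>. exp (\<Sum>l=1..m. \<alpha> l * A \<omega> (t l)) \<partial>M)))"

definition net_input ::
    "real \<Rightarrow> real \<Rightarrow> (nat \<Rightarrow> 'b \<Rightarrow> real \<Rightarrow> real) \<Rightarrow> nat \<Rightarrow> 'b \<Rightarrow> real \<Rightarrow> real" where
  "net_input T c X n \<omega> = (\<lambda>t\<in>{0..T}. (1 / real n) * (\<Sum>i=1..n. X i \<omega> t) - c * t)"

definition reflection :: "real \<Rightarrow> (real \<Rightarrow> real) \<Rightarrow> real \<Rightarrow> real" where
  "reflection T x = (\<lambda>t\<in>{0..T}. SUP s\<in>{0..t}. x t - x s)"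

definition workload ::
    "real \<Rightarrow> real \<Rightarrow> (nat \<Rightarrow> 'b \<Rightarrow> real \<Rightarrow> real) \<Rightarrow> nat \<Rightarrow> 'b \<Rightarrow> real \<Rightarrow> real" where
  "workload T c X n \<omega> =
     (\<lambda>t\<in>{0..T}. SUP s\<in>{0..t}. net_input T c X n \<omega> t - net_input T c X n \<omega> s)"

definition rate_J ::
    "'a measure \<Rightarrow> ('a \<Rightarrow> real \<Rightarrow> real) \<Rightarrow> real \<Rightarrow> real \<Rightarrow> (real \<Rightarrow> real) \<Rightarrow> ereal" where
  "rate_J M A T c x = rate_I M A T (\<lambda>t\<in>{0..T}. x t + c * t)"

definition rate_K ::
    "'a measure \<Rightarrow> ('a \<Rightarrow> real \<Rightarrow> real) \<Rightarrow> real \<Rightarrow> real \<Rightarrow> (real \<Rightarrow> real) \<Rightarrow> ereal" where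
  "rate_K M A T c q = (INF x\<in>{x \<in> D_space T. q = reflection T x}. rate_J M A T c x)"

end

(*
The number of arrivals in (s,t] is a sum of independent indicators with mean at most L (t - s), so
E exp(theta (A t - A s)) <= exp((exp theta - 1) L (t - s)): the empirical means are nondecreasing with a
superexponentially small modulus of continuity. Hence sequences of relevant paths have uniformly
convergent subsequences, the J1 and uniform topologies agree near the paths of finite rate, and no
Arzela-Ascoli theorem for the Skorokhod space is needed.
Upper bound: a closed set that avoids {rate <= a} is covered, up to finitely many modulus conditions,
by finitely many half-spaces {a < cost}, each of which satisfies a Chernoff bound.
Lower bound: multivariate Cramer on a fine grid. Minimising log mgf(alpha) - alpha . v + eps |alpha|^2
produces an exponential tilt whose mean is close to v also when the log mgf is not steep, and the
law of large numbers under the tilt is Chebyshev's inequality.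
Borel measurability in D([0,T]) follows by approximating paths by countably valued discretisations,
and the workload by contraction, the reflection map being Lipschitz for J1.
*)
theory Submission
  imports Defs "HOL-Complex_Analysis.Great_Picard"
begin

section \<open>Borel sets of the Skorokhod space\<close>

text \<open>The copies are known only through their law on the product
  \<open>\<sigma>\<close>-algebra, whose events depend on countably many coordinates, whereas
  monotonicity, the modulus of continuity and J1 balls involve all times at once. Three devices
  bridge this gap: right-continuity upgrades almost sure inequalities at rational times to whole
  paths; modulus conditions are only claimed outside small events built from finitely many
  coordinates; and paths are approximated by functions of finitely many samples. A path of finite
  rate may be constant on an interval. Its sampled values can then lie on the boundary of the convex
  hull of the support, where no exponential tilt has exactly that mean; this is why the tilt only
  aims near the target. In the bound for a closed set, the part satisfying all modulus conditions is
  compact, yet for each level only finitely many of these conditions may be imposed, since each adds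
  an exceptional event to a union bound. Compactness is therefore exploited along sequences that
  satisfy more and more of the conditions.\<close>

lemma continuous_in_D_space:
  assumes "continuous_on {0..T} x" "x \<in> extensional {0..T}"
  shows "x \<in> D_space T"
proof -
  have "(x \<longlongrightarrow> x t) (at_right t)" if "t \<in> {0..<T}" for t
  proof -
    have "(x \<longlongrightarrow> x t) (at t within {t..T})"
    proof (rule tendsto_within_subset)
      show "(x \<longlongrightarrow> x t) (at t within {0..T})"
        using assms(1) that by (auto simp: continuous_on_def)
    qed (use that in auto)
    then show ?thesis
      using that by (simp add: at_within_Icc_at_right)
  qed
  moreover have "(x \<longlongrightarrow> x t) (at_left t)" if "t \<in> {0<..T}" for t
  proof -
    have "(x \<longlongrightarrow> x t) (at t within {0..t})"
    proof (rule tendsto_within_subset)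
      show "(x \<longlongrightarrow> x t) (at t within {0..T})"
        using assms(1) that by (auto simp: continuous_on_def)
    qed (use that in auto)
    then show ?thesis
      using that by (simp add: at_within_Icc_at_left)
  qed
  ultimately show ?thesis
    using assms(2) unfolding D_space_def by blast
qed

lemma J1_dist_le_uniform:
  assumes "x \<in> D_space T" "y \<in> D_space T" "0 < e" "\<And>t. t \<in> {0..T} \<Longrightarrow> \<bar>x t - y t\<bar> \<le> e"
  shows "J1_dist T x y \<le> e"
  using assms by (intro J1_dist_le) (auto simp: J1_close_def intro!: bexI[OF _ id_time_change])

text \<open>Against a continuous path a time change costs no more than the modulus of continuity, so
  small J1 balls lie in uniform balls. Hence evaluation at a fixed time, discontinuous on the whole
  space, is continuous at such an \<open>x\<close>.\<close>

lemma J1_near_continuous: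
  assumes T: "0 \<le> T" and x: "continuous_on {0..T} x" "x \<in> extensional {0..T}" and "0 < e"
  obtains r where "0 < r"
    "\<And>y t. y \<in> D_space T \<Longrightarrow> J1_dist T x y < r \<Longrightarrow> t \<in> {0..T} \<Longrightarrow> \<bar>y t - x t\<bar> < e"
proof -
  have "uniformly_continuous_on {0..T} x"
    using x(1) by (rule compact_uniformly_continuous) simp
  then obtain d where d: "0 < d"
    "\<And>s t. s \<in> {0..T} \<Longrightarrow> t \<in> {0..T} \<Longrightarrow> \<bar>s - t\<bar> < d \<Longrightarrow> \<bar>x s - x t\<bar> < e / 2"
    using \<open>0 < e\<close> unfolding uniformly_continuous_on_def dist_real_def
    by (metis half_gt_zero_iff)
  show ?thesis
  proof (rule that[of "min d (e / 2)"])
    show "0 < min d (e / 2)" using d(1) \<open>0 < e\<close> by simp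
    fix y t assume y: "y \<in> D_space T" "J1_dist T x y < min d (e / 2)" and t: "t \<in> {0..T}"
    obtain e' where e': "0 < e'" "e' < min d (e / 2)" "J1_close T e' x y"
      using J1_dist_lessD[OF continuous_in_D_space[OF x] y] .
    then obtain l where l: "l \<in> time_changes T"
      and le: "\<And>t. t \<in> {0..T} \<Longrightarrow> \<bar>l t - t\<bar> \<le> e' \<and> \<bar>x t - y (l t)\<bar> \<le> e'"
      unfolding J1_close_def by blast
    obtain s where s: "s \<in> {0..T}" "t = l s"
      using t time_change_image[OF l T] by blast
    then have "\<bar>s - t\<bar> < d" "\<bar>x s - y t\<bar> < e / 2"
      using le[OF s(1)] e'(2) by auto
    with d(2)[OF s(1) t] show "\<bar>y t - x t\<bar> < e"
      by linarith
  qed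
qed

section \<open>Discretising cadlag paths along a time grid\<close>

definition grid_floor :: "real \<Rightarrow> real \<Rightarrow> real" where
  "grid_floor h t = h * \<lfloor>t / h\<rfloor>"

definition grid_ceiling :: "real \<Rightarrow> real \<Rightarrow> real" where
  "grid_ceiling h t = h * \<lceil>t / h\<rceil>"

lemma grid_ceiling_bounds:
  assumes "0 < h" shows "t \<le> grid_ceiling h t" "grid_ceiling h t < t + h"
proof -
  have "t / h \<le> \<lceil>t / h\<rceil>" "\<lceil>t / h\<rceil> < t / h + 1"
    by linarith+
  then show "t \<le> grid_ceiling h t" "grid_ceiling h t < t + h"
    using assms by (simp_all only: grid_ceiling_def pos_divide_le_eq mult.commute)
      (simp add: field_simps)
qed

text \<open>This is why end points are rounded up while sampling times are rounded down: a time
  between the shifted end points is sampled inside the original interval \<open>[a,b)\<close>, so no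
  sample crosses a jump at \<open>a\<close> or \<open>b\<close>.\<close>

lemma grid_floor_between:
  assumes "0 < h" "grid_ceiling h a \<le> s" "s < grid_ceiling h b"
  shows "a \<le> grid_floor h s" "grid_floor h s < b"
proof -
  have "\<lceil>a / h\<rceil> \<le> s / h" "s / h < \<lceil>b / h\<rceil>"
    using assms by (auto simp: grid_ceiling_def field_simps)
  then have "\<lceil>a / h\<rceil> \<le> \<lfloor>s / h\<rfloor>" "\<lfloor>s / h\<rfloor> < \<lceil>b / h\<rceil>"
    by (simp_all add: le_floor_iff floor_less_iff)
  then have "a / h \<le> \<lfloor>s / h\<rfloor>" "\<lfloor>s / h\<rfloor> < b / h"
    by (simp_all add: ceiling_le_iff less_ceiling_iff)
  then show "a \<le> grid_floor h s" "grid_floor h s < b"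
    using assms(1) by (auto simp: grid_floor_def field_simps)
qed

text \<open>A partial time change on \<open>[a,b]\<close> that moves the end points to the next points of the grid of
  mesh \<open>h\<close> and matches \<open>x\<close> with its discretisation.\<close>

definition grid_alignment :: "(real \<Rightarrow> real) \<Rightarrow> real \<Rightarrow> real \<Rightarrow> real \<Rightarrow> real \<Rightarrow> (real \<Rightarrow> real) \<Rightarrow> bool"
  where
  "grid_alignment x e h a b \<mu> \<longleftrightarrow> continuous_on {a..b} \<mu> \<and> strict_mono_on {a..b} \<mu> \<and>
     \<mu> a = grid_ceiling h a \<and> \<mu> b = grid_ceiling h b \<and> (\<forall>t\<in>{a..b}. \<bar>\<mu> t - t\<bar> \<le> h) \<and>
     (\<forall>t\<in>{a..<b}. \<bar>x t - x (grid_floor h (\<mu> t))\<bar> \<le> e)"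

text \<open>Since all samples stay in \<open>[a,b)\<close>, where \<open>x\<close> hardly varies,
  the linear map between the shifted end points is good enough. The condition
  \<open>h < b - a\<close> keeps these end points distinct.\<close>

lemma grid_alignment_small_oscillation:
  assumes ab: "a < b" and h: "0 < h" "h < b - a"
    and osc: "\<And>s t. s \<in> {a..<b} \<Longrightarrow> t \<in> {a..<b} \<Longrightarrow> \<bar>x s - x t\<bar> \<le> e"
  shows "\<exists>\<mu>. grid_alignment x e h a b \<mu>"
proof -
  define A where "A = grid_ceiling h a"
  define B where "B = grid_ceiling h b"
  have A: "a \<le> A" "A < a + h" and B: "b \<le> B" "B < b + h"
    using grid_ceiling_bounds[OF h(1)] by (auto simp: A_def B_def)
  have AB: "A < B" using A B h by linarith
  define \<mu> where "\<mu> t = A + (t - a) * ((B - A) / (b - a))" for t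
  have mono: "\<mu> s < \<mu> t" if "s < t" for s t
    using that AB ab by (simp add: \<mu>_def divide_strict_right_mono mult_strict_right_mono)
  have ends: "\<mu> a = A" "\<mu> b = B"
    using ab by (auto simp: \<mu>_def)
  have near: "\<bar>\<mu> t - t\<bar> \<le> h" if "t \<in> {a..b}" for t
  proof -
    define w where "w = (t - a) / (b - a)"
    have w: "0 \<le> w" "w \<le> 1" using that ab by (auto simp: w_def)
    have t: "t = a + w * (b - a)" using ab by (simp add: w_def)
    have "\<mu> t = A + w * (B - A)"
      by (simp add: \<mu>_def w_def)
    \<comment> \<open>The displacement at \<open>t\<close> is a convex combination of the
      displacements of the two end points, and both of these lie in \<open>[0,h)\<close>.\<close>
    then have eq: "\<mu> t - t = (1 - w) * (A - a) + w * (B - b)"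
      by (subst t) (simp add: algebra_simps)
    have "(1 - w) * (A - a) + w * (B - b) \<le> (1 - w) * h + w * h"
      using w A B by (intro add_mono mult_left_mono) auto
    moreover have "0 \<le> (1 - w) * (A - a) + w * (B - b)"
      using w A B by (intro add_nonneg_nonneg mult_nonneg_nonneg) auto
    ultimately show ?thesis using eq by (simp add: algebra_simps)
  qed
  have "\<bar>x t - x (grid_floor h (\<mu> t))\<bar> \<le> e" if "t \<in> {a..<b}" for t
  proof -
    have "A \<le> \<mu> t" "\<mu> t < B"
      using mono[of a t] mono[of t b] ends that by (cases "a = t"; force)+
    then have "grid_floor h (\<mu> t) \<in> {a..<b}"
      using grid_floor_between[OF h(1)] by (auto simp: A_def B_def)
    with osc that show ?thesis by blast
  qed
  moreover have "continuous_on {a..b} \<mu>"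
    unfolding \<mu>_def by (intro continuous_intros)
  ultimately have "grid_alignment x e h a b \<mu>"
    using mono near ends by (auto simp: grid_alignment_def strict_mono_on_def A_def B_def)
  then show ?thesis by blast
qed

text \<open>The prescribed value at the joint depends on \<open>b\<close> and \<open>h\<close> only,
  so the two pieces meet there without adjustment. A jump at \<open>b\<close> does no harm because
  the sampling clause of the left piece omits its right end.\<close>

lemma grid_alignment_concat:
  assumes abc: "a < b" "b < c" and al: "grid_alignment x e h a b \<mu>" "grid_alignment x e h b c \<nu>"
  shows "grid_alignment x e h a c (\<lambda>t. if t \<le> b then \<mu> t else \<nu> t)"
proof -
  let ?k = "\<lambda>t. if t \<le> b then \<mu> t else \<nu> t"
  have \<mu>: "continuous_on {a..b} \<mu>" "strict_mono_on {a..b} \<mu>" "\<mu> a = grid_ceiling h a"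
      "\<mu> b = grid_ceiling h b" "\<And>t. t \<in> {a..b} \<Longrightarrow> \<bar>\<mu> t - t\<bar> \<le> h"
      "\<And>t. t \<in> {a..<b} \<Longrightarrow> \<bar>x t - x (grid_floor h (\<mu> t))\<bar> \<le> e"
    using al(1) unfolding grid_alignment_def by blast+
  have \<nu>: "continuous_on {b..c} \<nu>" "strict_mono_on {b..c} \<nu>" "\<nu> b = grid_ceiling h b"
      "\<nu> c = grid_ceiling h c" "\<And>t. t \<in> {b..c} \<Longrightarrow> \<bar>\<nu> t - t\<bar> \<le> h"
      "\<And>t. t \<in> {b..<c} \<Longrightarrow> \<bar>x t - x (grid_floor h (\<nu> t))\<bar> \<le> e"
    using al(2) unfolding grid_alignment_def by blast+
  have eq: "\<mu> b = \<nu> b" by (simp only: \<mu>(4) \<nu>(3))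
  have right: "?k t = \<nu> t" if "b \<le> t" for t
    using that eq by (cases "t = b") simp_all
  have "continuous_on ({a..b} \<union> {b..c}) ?k"
    using \<mu>(1) \<nu>(1) eq by (intro continuous_on_If) (simp_all add: order.antisym)
  moreover have "{a..b} \<union> {b..c} = {a..c}" using abc by auto
  moreover have "strict_mono_on {a..c} ?k"
  proof (rule strict_mono_onI)
    fix s t assume st: "s \<in> {a..c}" "t \<in> {a..c}" "s < t"
    consider "t \<le> b" | "b \<le> s" | "s < b" "b < t" by linarith
    then show "?k s < ?k t"
    proof cases
      case 1
      then have "\<mu> s < \<mu> t" using st by (intro strict_mono_onD[OF \<mu>(2)]) simp_all
      then show ?thesis using 1 st by simp
    next
      case 2
      then have "\<nu> s < \<nu> t" using st by (intro strict_mono_onD[OF \<nu>(2)]) simp_all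
      then show ?thesis using 2 st right[of s] by simp
    next
      case 3
      have "\<mu> s < \<mu> b" using 3 st by (intro strict_mono_onD[OF \<mu>(2)]) simp_all
      also have "\<mu> b = \<nu> b" by (rule eq)
      also have "\<nu> b < \<nu> t" using 3 st by (intro strict_mono_onD[OF \<nu>(2)]) simp_all
      finally show ?thesis using 3 by simp
    qed
  qed
  moreover have "?k a = grid_ceiling h a" "?k c = grid_ceiling h c"
    using abc \<mu>(3) \<nu>(4) by simp_all
  moreover have "\<bar>?k t - t\<bar> \<le> h" if "t \<in> {a..c}" for t
    using that \<mu>(5)[of t] \<nu>(5)[of t] by (cases "t \<le> b") simp_all
  moreover have "\<bar>x t - x (grid_floor h (?k t))\<bar> \<le> e" if "t \<in> {a..<c}" for t
    using that \<mu>(6)[of t] \<nu>(6)[of t] right[of t] by (cases "t < b") simp_all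
  ultimately show ?thesis
    unfolding grid_alignment_def by simp
qed

text \<open>Bisection: one-sided limits give small oscillation on short half-open intervals on
  either side of each point, and adjacent alignments can be concatenated. The admissible mesh sizes
  shrink with each concatenation, hence the threshold \<open>h0\<close> inside
  \<open>Q\<close>.\<close>

lemma D_space_grid_alignment:
  assumes x: "x \<in> D_space T" and T: "0 < T" and e: "0 < e"
  shows "\<exists>h0>0. \<forall>h. 0 < h \<and> h < h0 \<longrightarrow> (\<exists>\<mu>. grid_alignment x e h 0 T \<mu>)"
proof -
  define Q where "Q a b \<longleftrightarrow> (\<exists>h0>0. \<forall>h. 0 < h \<and> h < h0 \<longrightarrow> (\<exists>\<mu>. grid_alignment x e h a b \<mu>))"
    for a b
  \<comment> \<open>Vacuous truth covers degenerate intervals and intervals that leave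
    \<open>[0,T]\<close>; the bisection principle quantifies over both.\<close>
  define P where "P a b \<longleftrightarrow> (0 \<le> a \<and> a < b \<and> b \<le> T \<longrightarrow> Q a b)" for a b
  have Q_trans: "Q a c" if ab: "Q a b" and bc: "Q b c" and "a < b" "b < c" for a b c
  proof -
    obtain h0 where h0: "h0 > 0" "\<And>h. 0 < h \<Longrightarrow> h < h0 \<Longrightarrow> \<exists>\<mu>. grid_alignment x e h a b \<mu>"
      using ab unfolding Q_def by blast
    obtain h1 where h1: "h1 > 0" "\<And>h. 0 < h \<Longrightarrow> h < h1 \<Longrightarrow> \<exists>\<mu>. grid_alignment x e h b c \<mu>"
      using bc unfolding Q_def by blast
    have "\<exists>\<mu>. grid_alignment x e h a c \<mu>" if "0 < h" "h < min h0 h1" for h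
    proof -
      have "h < h0" "h < h1" using that by simp_all
      then show ?thesis
        using h0(2)[OF \<open>0 < h\<close>] h1(2)[OF \<open>0 < h\<close>] grid_alignment_concat[OF \<open>a < b\<close> \<open>b < c\<close>]
        by blast
    qed
    then show ?thesis
      unfolding Q_def using h0(1) h1(1) by (intro exI[of _ "min h0 h1"]) simp
  qed
  have trans: "P a c" if P: "P a b" "P b c" and abc: "a \<le> b" "b \<le> c" for a b c
  proof (cases "a = b \<or> b = c")
    case True
    then show ?thesis using P by blast
  next
    case False
    then have "a < b" "b < c" using abc by auto
    then show ?thesis using P Q_trans[of a b c] unfolding P_def by linarith
  qed
  have base: "P a b" if "\<And>s t. s \<in> {a..<b} \<Longrightarrow> t \<in> {a..<b} \<Longrightarrow> \<bar>x s - x t\<bar> \<le> e" for a b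
    unfolding P_def
  proof
    assume "0 \<le> a \<and> a < b \<and> b \<le> T"
    then have "\<exists>\<mu>. grid_alignment x e h a b \<mu>" if "0 < h" "h < b - a" for h
      using grid_alignment_small_oscillation[OF _ that, of x e] \<open>\<And>s t. s \<in> {a..<b} \<Longrightarrow> t \<in> {a..<b} \<Longrightarrow> \<bar>x s - x t\<bar> \<le> e\<close>
      by blast
    with \<open>0 \<le> a \<and> a < b \<and> b \<le> T\<close> show "Q a b"
      unfolding Q_def by (intro exI[of _ "b - a"]) simp
  qed
  have right: "\<exists>d>0. \<forall>b. t \<le> b \<and> b - t < d \<longrightarrow> P t b" if "0 \<le> t" for t
  proof (cases "t < T")
    case True
    then have "(x \<longlongrightarrow> x t) (at_right t)"
      using x that by (simp add: D_space_def)
    then have "eventually (\<lambda>s. dist (x s) (x t) < e/2) (at_right t)"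
      using e by (intro tendstoD) auto
    then obtain u where u: "u > t" "\<And>s. t < s \<Longrightarrow> s < u \<Longrightarrow> \<bar>x s - x t\<bar> < e/2"
      by (auto simp: eventually_at_right_field dist_real_def)
    have "P t b" if b: "b < u" for b
    proof (rule base)
      have near: "\<bar>x s - x t\<bar> < e/2" if "s \<in> {t..<b}" for s
        using u(2)[of s] that b e by (cases "s = t") auto
      fix s s' assume "s \<in> {t..<b}" "s' \<in> {t..<b}"
      then show "\<bar>x s - x s'\<bar> \<le> e"
        using near[of s] near[of s'] by linarith
    qed
    then show ?thesis using u(1) by (intro exI[of _ "u - t"]) simp
  next
    case False
    then show ?thesis unfolding P_def by (intro exI[of _ 1]) auto
  qed
  have left: "\<exists>d>0. \<forall>a. a \<le> t \<and> t - a < d \<longrightarrow> P a t" if "t \<le> T" for t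
  proof (cases "0 < t")
    case True
    then have "t \<in> {0<..T}" using that by simp
    then obtain l where "(x \<longlongrightarrow> l) (at_left t)"
      using x unfolding D_space_def by blast
    then have "eventually (\<lambda>s. dist (x s) l < e/2) (at_left t)"
      using e by (intro tendstoD) auto
    then obtain u where u: "u < t" "\<And>s. u < s \<Longrightarrow> s < t \<Longrightarrow> \<bar>x s - l\<bar> < e/2"
      by (auto simp: eventually_at_left_field dist_real_def)
    have "P a t" if a: "u < a" for a
    proof (rule base)
      fix s s' assume "s \<in> {a..<t}" "s' \<in> {a..<t}"
      then have "\<bar>x s - l\<bar> < e/2" "\<bar>x s' - l\<bar> < e/2"
        using a u(2)[of s] u(2)[of s'] by simp_all
      then show "\<bar>x s - x s'\<bar> \<le> e" by linarith
    qed
    then show ?thesis using u(1) by (intro exI[of _ "t - u"]) simp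
  next
    case False
    then show ?thesis unfolding P_def by (intro exI[of _ 1]) auto
  qed
  have local: "\<exists>d>0. \<forall>a b. a \<le> t \<and> t \<le> b \<and> b - a < d \<longrightarrow> P a b" if t: "0 \<le> t" "t \<le> T" for t
  proof -
    obtain d1 where d1: "d1 > 0" "\<And>b. t \<le> b \<Longrightarrow> b - t < d1 \<Longrightarrow> P t b"
      using right[OF t(1)] by blast
    obtain d2 where d2: "d2 > 0" "\<And>a. a \<le> t \<Longrightarrow> t - a < d2 \<Longrightarrow> P a t"
      using left[OF t(2)] by blast
    have "P a b" if "a \<le> t" "t \<le> b" "b - a < min d1 d2" for a b
      using that by (intro trans[of a t b] d1(2) d2(2)) simp_all
    then show ?thesis using d1(1) d2(1) by (intro exI[of _ "min d1 d2"]) simp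
  qed
  have "P 0 T"
  proof (rule Bolzano[of 0 T P])
    show "P a c" if "P a b" "P b c" "a \<le> b" "b \<le> c" for a b c
      using that by (rule trans)
  qed (use T local in simp_all)
  then show ?thesis using T by (simp add: P_def Q_def)
qed

lemma step_function_in_D_space:
  fixes v :: "int \<Rightarrow> real"
  assumes h: "0 < h"
  shows "(\<lambda>t\<in>{0..T}. v \<lfloor>t / h\<rfloor>) \<in> D_space T" (is "?s \<in> _")
proof -
  have "(?s \<longlongrightarrow> ?s t) (at_right t)" if t: "t \<in> {0..<T}" for t
  proof (rule tendsto_eventually)
    have "t / h < \<lfloor>t / h\<rfloor> + 1" by linarith
    then have "t < min T (h * (\<lfloor>t / h\<rfloor> + 1))"
      using h t by (simp add: field_simps)
    then have "eventually (\<lambda>s. s \<in> {t<..<min T (h * (\<lfloor>t / h\<rfloor> + 1))}) (at_right t)"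
      by (rule eventually_at_right_real)
    then show "eventually (\<lambda>s. ?s s = ?s t) (at_right t)"
    proof eventually_elim
      case (elim s)
      then have "t / h \<le> s / h" "s / h < \<lfloor>t / h\<rfloor> + 1"
        using h by (auto simp: field_simps)
      then have "\<lfloor>s / h\<rfloor> = \<lfloor>t / h\<rfloor>" by linarith
      then show ?case using elim t by auto
    qed
  qed
  \<comment> \<open>The left limit is the value on the preceding cell:
    \<open>\<lceil>t / h\<rceil> - 1\<close> differs from \<open>\<lfloor>t / h\<rfloor>\<close>
    exactly at grid points, where the step function may jump.\<close>
  moreover have "(?s \<longlongrightarrow> v (\<lceil>t / h\<rceil> - 1)) (at_left t)" if t: "t \<in> {0<..T}" for t
  proof (rule tendsto_eventually)
    have "\<lceil>t / h\<rceil> - 1 < t / h" by linarith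
    then have "max 0 (h * (\<lceil>t / h\<rceil> - 1)) < t"
      using h t by (simp add: field_simps)
    then have "eventually (\<lambda>s. s \<in> {max 0 (h * (\<lceil>t / h\<rceil> - 1))<..<t}) (at_left t)"
      by (rule eventually_at_left_real)
    then show "eventually (\<lambda>s. ?s s = v (\<lceil>t / h\<rceil> - 1)) (at_left t)"
    proof eventually_elim
      case (elim s)
      then have "\<lceil>t / h\<rceil> - 1 < s / h" "s / h < t / h"
        using h by (auto simp: field_simps)
      then have "\<lfloor>s / h\<rfloor> = \<lceil>t / h\<rceil> - 1" by linarith
      then show ?case using elim t by auto
    qed
  qed
  ultimately show ?thesis
    unfolding D_space_def by blast
qed

text \<open>Rounding the values as well makes the range of the discretisation countable, so that it is
  measurable for any topology on the range.\<close>

definition discretise :: "real \<Rightarrow> nat \<Rightarrow> (real \<Rightarrow> real) \<Rightarrow> real \<Rightarrow> real" where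
  "discretise T m x =
     (\<lambda>t\<in>{0..T}. \<lfloor>real m * x (grid_floor (T / real m) t)\<rfloor> / real m)"

lemma discretise_in_D_space:
  assumes "0 < T" "0 < m" shows "discretise T m x \<in> D_space T"
  using step_function_in_D_space[where h = "T / real m" and T = T and v =
      "\<lambda>j::int. \<lfloor>real m * x (T / real m * j)\<rfloor> / real m"] assms
  by (simp add: discretise_def grid_floor_def)

lemma discretise_tendsto:
  assumes x: "x \<in> D_space T" and T: "0 < T"
  shows "(\<lambda>m. J1_dist T x (discretise T m x)) \<longlonglongrightarrow> 0"
proof (rule tendstoI)
  fix e :: real assume e: "0 < e"
  obtain h0 where h0: "h0 > 0"
    "\<And>h. 0 < h \<Longrightarrow> h < h0 \<Longrightarrow> \<exists>\<mu>. grid_alignment x (e/3) h 0 T \<mu>"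
    using D_space_grid_alignment[OF x T, of "e/3"] e by auto
  have "eventually (\<lambda>m. T / real m < min h0 (e/3)) sequentially"
    using h0(1) e by (intro order_tendstoD(2)[OF lim_const_over_n]) simp
  moreover have "eventually (\<lambda>m. 1 / real m < e/3) sequentially"
    using e by (intro order_tendstoD(2)[OF lim_const_over_n]) simp
  moreover have "eventually (\<lambda>m. 0 < m) sequentially"
    by (rule eventually_gt_at_top)
  ultimately show "eventually (\<lambda>m. dist (J1_dist T x (discretise T m x)) 0 < e) sequentially"
  proof eventually_elim
    case (elim m)
    define h where "h = T / real m"
    have h: "0 < h" "h < h0" "h < e/3" using elim T by (auto simp: h_def)
    obtain \<mu> where \<mu>: "grid_alignment x (e/3) h 0 T \<mu>"
      using h0(2)[OF h(1,2)] by blast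
    have Th: "T / h = real m" using T by (simp add: h_def)
    \<comment> \<open>\<open>T\<close> is a multiple of the mesh, so rounding up fixes both end
      points and the alignment is a genuine time change of \<open>[0,T]\<close>.\<close>
    have "\<mu> 0 = 0" "\<mu> T = T"
      using \<mu> Th elim unfolding grid_alignment_def grid_ceiling_def by (simp_all add: h_def)
    then have tc: "\<mu> \<in> time_changes T"
      using \<mu> unfolding grid_alignment_def time_changes_def by blast
    have "\<bar>x t - discretise T m x (\<mu> t)\<bar> \<le> 2*e/3" if t: "t \<in> {0..T}" for t
    proof -
      have "\<bar>x t - x (grid_floor h (\<mu> t))\<bar> \<le> e/3"
      proof (cases "t = T")
        case True
        have "grid_floor h T = T"
          using elim by (simp add: grid_floor_def Th) (simp add: h_def)
        then show ?thesis using True \<open>\<mu> T = T\<close> e by simp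
      next
        case False
        then have "t \<in> {0..<T}" using t by simp
        then show ?thesis using \<mu> unfolding grid_alignment_def by blast
      qed
      moreover have "\<bar>x (grid_floor h (\<mu> t)) - discretise T m x (\<mu> t)\<bar> \<le> e/3"
      proof -
        define u where "u = x (grid_floor h (\<mu> t))"
        have "real m * u - 1 \<le> \<lfloor>real m * u\<rfloor>" "\<lfloor>real m * u\<rfloor> \<le> real m * u"
          by linarith+
        then have "(real m * u - 1) / real m \<le> \<lfloor>real m * u\<rfloor> / real m"
          "\<lfloor>real m * u\<rfloor> / real m \<le> real m * u / real m"
          by (intro divide_right_mono; simp)+
        then show ?thesis
          using elim time_change_in[OF tc t]
          by (simp add: discretise_def h_def[symmetric] u_def diff_divide_distrib)
      qed
      ultimately show ?thesis by linarith
    qed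
    moreover have "\<bar>\<mu> t - t\<bar> \<le> 2*e/3" if t: "t \<in> {0..T}" for t
    proof -
      have "\<bar>\<mu> t - t\<bar> \<le> h" using \<mu> t unfolding grid_alignment_def by blast
      then show ?thesis using h e by linarith
    qed
    ultimately have "J1_close T (2*e/3) x (discretise T m x)"
      unfolding J1_close_def using tc by blast
    then have "J1_dist T x (discretise T m x) \<le> 2*e/3"
      using discretise_in_D_space[OF T] elim e by (intro J1_dist_le x) auto
    then show ?case
      using e J1_dist_nonneg[of T x "discretise T m x"] by simp
  qed
qed


section \<open>Borel measurability of random cadlag paths\<close>

text \<open>The discretised path is decoded from a list of integers. There are countably many such
  lists, so \<open>U\<close> may be an arbitrary set of functions and no topology on paths is
  involved.\<close>

lemma measurable_discretise:
  assumes Y: "\<And>t. t \<in> {0..T} \<Longrightarrow> (\<lambda>\<omega>. Y \<omega> t) \<in> borel_measurable N" and T: "0 < T" and m: "0 < m"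
  shows "{\<omega> \<in> space N. discretise T m (Y \<omega>) \<in> U} \<in> sets N"
proof -
  \<comment> \<open>There are \<open>m + 1\<close> samples because the cell index \<open>m\<close>
    is reached at \<open>t = T\<close>.\<close>
  define code where
    "code \<omega> = map (\<lambda>j. \<lfloor>real m * Y \<omega> (T / real m * real j)\<rfloor>) [0..<Suc m]" for \<omega>
  define dec where "dec l = (\<lambda>t\<in>{0..T}. (l ! nat \<lfloor>t / (T / real m)\<rfloor>) / real m)" for l :: "int list"
  have eq: "discretise T m (Y \<omega>) = dec (code \<omega>)" for \<omega>
  proof (rule ext)
    fix t
    show "discretise T m (Y \<omega>) t = dec (code \<omega>) t"
    proof (cases "t \<in> {0..T}")
      case True
      define j where "j = nat \<lfloor>t / (T / real m)\<rfloor>"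
      have "0 \<le> t / (T / real m)" "t / (T / real m) \<le> real m"
        using True T m by (auto simp: field_simps)
      then have j: "\<lfloor>t / (T / real m)\<rfloor> = int j" "j < Suc m"
        unfolding j_def by linarith+
      have "code \<omega> ! j = \<lfloor>real m * Y \<omega> (T / real m * real j)\<rfloor>"
        using j(2) unfolding code_def by (subst nth_map) (simp_all del: upt_Suc)
      then show ?thesis
        using True j by (simp add: discretise_def dec_def grid_floor_def del: upt_Suc)
    qed (auto simp: discretise_def dec_def)
  qed
  have [measurable]: "(\<lambda>\<omega>. Y \<omega> (T / real m * real j)) \<in> borel_measurable N" if "j < Suc m" for j
  proof (rule Y)
    have "T * real j \<le> T * real m" using that T by (intro mult_left_mono) auto
    then show "T / real m * real j \<in> {0..T}" using T m by (simp add: field_simps)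
  qed
  have "{\<omega> \<in> space N. code \<omega> = l} \<in> sets N" for l
  proof -
    have "{\<omega> \<in> space N. code \<omega> = l} = {\<omega> \<in> space N. length l = Suc m \<and>
      (\<forall>j\<in>{..<Suc m}. \<lfloor>real m * Y \<omega> (T / real m * real j)\<rfloor> = l ! j)}"
      by (auto simp: code_def list_eq_iff_nth_eq simp del: upt_Suc)
    also have "\<dots> \<in> sets N"
      unfolding floor_eq_iff by measurable
    finally show ?thesis .
  qed
  moreover have "{\<omega> \<in> space N. discretise T m (Y \<omega>) \<in> U} =
      (\<Union>l\<in>{l. dec l \<in> U}. {\<omega> \<in> space N. code \<omega> = l})"
    by (auto simp: eq)
  ultimately show ?thesis
    by (auto intro!: sets.countable_UN')
qed

text \<open>Membership in an open set is expressed through the discretisations, which converge in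
  J1: they must eventually stay among points whose ball of some fixed radius is contained in
  \<open>U\<close>. The sets \<open>V j\<close> of such points need no regularity, since preimages
  under a discretisation are measurable for every set.\<close>

lemma measurable_borel_sigma_J1:
  assumes T: "0 < T" and Y: "\<And>\<omega>. \<omega> \<in> space N \<Longrightarrow> Y \<omega> \<in> D_space T"
    and coord: "\<And>t. t \<in> {0..T} \<Longrightarrow> (\<lambda>\<omega>. Y \<omega> t) \<in> borel_measurable N"
  shows "Y \<in> N \<rightarrow>\<^sub>M borel_sigma (J1_topology T)"
proof -
  interpret J: Metric_space "D_space T" "J1_dist T"
    using T by (intro Metric_space_J1) simp
  have top: "topspace (J1_topology T) = D_space T"
    using T by (simp add: topspace_J1_topology)
  have "{\<omega> \<in> space N. Y \<omega> \<in> U} \<in> sets N" if U: "openin (J1_topology T) U" for U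
  proof -
    \<comment> \<open>A radius common to all the approximations is what allows their limit to be put
      back into \<open>U\<close>; lying in \<open>U\<close> alone would not survive the
      limit.\<close>
    define V where "V j = {y \<in> D_space T. J.mball y (1 / real (Suc j)) \<subseteq> U}" for j
    have U': "U \<subseteq> D_space T" "\<And>y. y \<in> U \<Longrightarrow> \<exists>r>0. J.mball y r \<subseteq> U"
      using U by (auto simp: J1_topology_def J.openin_mtopology)
    have "{\<omega> \<in> space N. Y \<omega> \<in> U} =
      {\<omega> \<in> space N. \<exists>j k. \<forall>m. discretise T (Suc (k + m)) (Y \<omega>) \<in> V j}"
    proof (intro Collect_cong conj_cong refl iffI)
      fix \<omega> assume \<omega>: "\<omega> \<in> space N"
      note lim = discretise_tendsto[OF Y[OF \<omega>] T]
      have D: "discretise T m (Y \<omega>) \<in> D_space T" if "0 < m" for m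
        using discretise_in_D_space[OF T that] .
      {
        assume "Y \<omega> \<in> U"
        then obtain r where r: "r > 0" "J.mball (Y \<omega>) r \<subseteq> U"
          using U' by blast
        obtain j where j: "1 / real (Suc j) < r / 2"
          using r(1) by (meson half_gt_zero nat_approx_posE)
        obtain k where k: "\<And>m. k \<le> m \<Longrightarrow> J1_dist T (Y \<omega>) (discretise T m (Y \<omega>)) < r / 2"
          using tendstoD[OF lim, of "r/2"] r(1) J1_dist_nonneg
          by (auto simp: eventually_sequentially)
        have "discretise T m (Y \<omega>) \<in> V j" if "k < m" for m
        proof -
          have "J.mball (discretise T m (Y \<omega>)) (1 / real (Suc j)) \<subseteq> J.mball (Y \<omega>) r"
            using k[of m] j that D Y[OF \<omega>] by (intro J.mball_subset) (auto simp: J.commute[of "discretise T m (Y \<omega>)"])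
          then show ?thesis using r(2) D that by (auto simp: V_def)
        qed
        then show "\<exists>j k. \<forall>m. discretise T (Suc (k + m)) (Y \<omega>) \<in> V j"
          by (intro exI[of _ j] exI[of _ k]) simp
      next
        assume "\<exists>j k. \<forall>m. discretise T (Suc (k + m)) (Y \<omega>) \<in> V j"
        then obtain j k where jk: "\<And>m. discretise T (Suc (k + m)) (Y \<omega>) \<in> V j" by blast
        obtain k' where k': "\<And>m. k' \<le> m \<Longrightarrow>
            J1_dist T (Y \<omega>) (discretise T m (Y \<omega>)) < 1 / real (Suc j)"
          using tendstoD[OF lim, of "1 / real (Suc j)"] J1_dist_nonneg
          by (auto simp: eventually_sequentially)
        define m where "m = Suc (k + k')"
        have "Y \<omega> \<in> J.mball (discretise T m (Y \<omega>)) (1 / real (Suc j))"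
          using k'[of m] D[of m] Y[OF \<omega>] by (simp add: m_def J.commute)
        then show "Y \<omega> \<in> U" using jk[of k'] by (auto simp: V_def m_def)
      }
    qed
    moreover have "{\<omega> \<in> space N. \<exists>j k. \<forall>m. discretise T (Suc (k + m)) (Y \<omega>) \<in> V j} \<in> sets N"
      by (intro sets.sets_Collect_countable_Ex sets.sets_Collect_countable_All
          measurable_discretise coord T) simp_all
    ultimately show ?thesis by simp
  qed
  then show ?thesis
    unfolding borel_sigma_def
  proof (intro measurable_measure_of)
    show "{U. openin (J1_topology T) U} \<subseteq> Pow (topspace (J1_topology T))"
      using openin_subset by blast
  qed (use Y in \<open>auto simp: top vimage_def Int_def conj_commute\<close>)
qed

section \<open>Compactness and logarithmic asymptotics\<close>

text \<open>The functions may have jumps: the modulus bound for \<open>e\<close> is required only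
  from an index depending on \<open>e\<close>. A diagonal subsequence converges at the rational
  times, a finite net spreads this to all times, and the limit inherits every modulus bound.\<close>

lemma asymptotic_Arzela_Ascoli:
  fixes \<phi> :: "nat \<Rightarrow> real \<Rightarrow> real"
  assumes T: "0 < T" and bound: "\<And>k t. t \<in> {0..T} \<Longrightarrow> \<bar>\<phi> k t\<bar> \<le> B"
    and equi: "\<And>e. 0 < e \<Longrightarrow> \<exists>d>0. \<exists>K. \<forall>k\<ge>K. \<forall>s\<in>{0..T}. \<forall>t\<in>{0..T}.
      \<bar>s - t\<bar> < d \<longrightarrow> \<bar>\<phi> k s - \<phi> k t\<bar> \<le> e"
  obtains r g where "strict_mono (r :: nat \<Rightarrow> nat)" "continuous_on {0..T} g"
    "uniform_limit {0..T} (\<lambda>k. \<phi> (r k)) g sequentially"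
proof -
  define S where "S = {0..T} \<inter> \<rat>"
  have "countable S" unfolding S_def using countable_rat by (rule countable_Int2)
  then obtain r where r: "strict_mono (r :: nat \<Rightarrow> nat)"
    and conv: "\<And>q. q \<in> S \<Longrightarrow> \<exists>l. (\<lambda>k. \<phi> (r k) q) \<longlonglongrightarrow> l"
    using function_convergent_subsequence[of S \<phi> B] bound by (auto simp: S_def)
  have r_ge: "k \<le> r k" for k using r by (rule seq_suble)
  have "uniformly_Cauchy_on {0..T} (\<lambda>k. \<phi> (r k))"
  proof (rule uniformly_Cauchy_onI)
    fix e :: real assume e: "0 < e"
    obtain d K where d: "0 < d" and K: "\<And>k s t. K \<le> k \<Longrightarrow> s \<in> {0..T} \<Longrightarrow> t \<in> {0..T} \<Longrightarrow>
        \<bar>s - t\<bar> < d \<Longrightarrow> \<bar>\<phi> k s - \<phi> k t\<bar> \<le> e / 4"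
    proof -
      have "0 < e / 4" using e by simp
      from equi[OF this] that show ?thesis by blast
    qed
    have dense: "\<exists>q\<in>S. \<bar>t - q\<bar> < d" if t: "t \<in> {0..T}" for t
    proof -
      have "max 0 (t - d) < min T (t + d)" using t T d by auto
      then obtain q where "q \<in> \<rat>" "max 0 (t - d) < q" "q < min T (t + d)"
        using Rats_dense_in_real by blast
      then show ?thesis by (intro bexI[of _ q]) (auto simp: S_def)
    qed
    have "compact {0..T}" by simp
    moreover have "{0..T} \<subseteq> (\<Union>q\<in>S. ball q d)"
      using dense by (force simp: dist_real_def abs_minus_commute)
    ultimately obtain C where C: "C \<subseteq> S" "finite C" "{0..T} \<subseteq> (\<Union>q\<in>C. ball q d)"
      using compactE_image[of "{0..T}" S "\<lambda>q. ball q d"] by (metis open_ball)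
    have "\<forall>q\<in>C. \<exists>M. \<forall>m\<ge>M. \<forall>n\<ge>M. dist (\<phi> (r m) q) (\<phi> (r n) q) < e / 4"
    proof
      fix q assume "q \<in> C"
      then have "convergent (\<lambda>k. \<phi> (r k) q)" using conv C(1) by (auto simp: convergent_def)
      then have "Cauchy (\<lambda>k. \<phi> (r k) q)" by (rule convergent_Cauchy)
      from metric_CauchyD[OF this, of "e / 4"] e
      show "\<exists>M. \<forall>m\<ge>M. \<forall>n\<ge>M. dist (\<phi> (r m) q) (\<phi> (r n) q) < e / 4" by simp
    qed
    then obtain M where M: "\<And>q m n. q \<in> C \<Longrightarrow> M q \<le> m \<Longrightarrow> M q \<le> n \<Longrightarrow>
        dist (\<phi> (r m) q) (\<phi> (r n) q) < e / 4"
      by metis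
    \<comment> \<open>Beyond \<open>P\<close> the sequence is Cauchy at every point of the net, and
      \<open>k \<le> r k\<close> makes the modulus bound available for the subsequence too.\<close>
    define P where "P = max K (Max (insert 0 (M ` C)))"
    show "\<exists>P. \<forall>t\<in>{0..T}. \<forall>m\<ge>P. \<forall>n\<ge>P. dist (\<phi> (r m) t) (\<phi> (r n) t) < e"
    proof (intro exI[of _ P] ballI allI impI)
      fix t m n assume t: "t \<in> {0..T}" and mn: "P \<le> m" "P \<le> n"
      obtain q where q: "q \<in> C" "\<bar>t - q\<bar> < d"
        using C(3) t by (force simp: dist_real_def abs_minus_commute)
      have "M q \<le> P" using q(1) C(2) by (auto simp: P_def intro!: max.coboundedI2 Max_ge)
      then have "dist (\<phi> (r m) q) (\<phi> (r n) q) < e / 4" using mn by (intro M q(1)) auto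
      moreover have "q \<in> {0..T}" using q(1) C(1) by (auto simp: S_def)
      moreover have "K \<le> r m" "K \<le> r n"
        using r_ge[of m] r_ge[of n] mn by (auto simp: P_def)
      ultimately show "dist (\<phi> (r m) t) (\<phi> (r n) t) < e"
        using K[of "r m" t q] K[of "r n" t q] t q(2) e unfolding dist_real_def by linarith
    qed
  qed
  then have "uniformly_convergent_on {0..T} (\<lambda>k. \<phi> (r k))"
    by (rule Cauchy_uniformly_convergent)
  then obtain g where g: "uniform_limit {0..T} (\<lambda>k. \<phi> (r k)) g sequentially"
    by (auto simp: uniformly_convergent_on_def)
  have "continuous_on {0..T} g"
    unfolding continuous_on_iff
  proof (intro ballI allI impI)
    fix t e :: real assume t: "t \<in> {0..T}" and e: "0 < e"
    obtain d K where d: "0 < d" and K: "\<And>k s t. K \<le> k \<Longrightarrow> s \<in> {0..T} \<Longrightarrow> t \<in> {0..T} \<Longrightarrow>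
        \<bar>s - t\<bar> < d \<Longrightarrow> \<bar>\<phi> k s - \<phi> k t\<bar> \<le> e / 2"
    proof -
      have "0 < e / 2" using e by simp
      from equi[OF this] that show ?thesis by blast
    qed
    show "\<exists>d>0. \<forall>s\<in>{0..T}. dist s t < d \<longrightarrow> dist (g s) (g t) < e"
    proof (intro exI[of _ d] conjI ballI impI d)
      fix s assume s: "s \<in> {0..T}" "dist s t < d"
      have "(\<lambda>k. \<bar>\<phi> (r k) s - \<phi> (r k) t\<bar>) \<longlonglongrightarrow> \<bar>g s - g t\<bar>"
        using tendsto_uniform_limitI[OF g] s t by (intro tendsto_intros) auto
      moreover have "eventually (\<lambda>k. \<bar>\<phi> (r k) s - \<phi> (r k) t\<bar> \<le> e / 2) sequentially"
        using eventually_ge_at_top[of K]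
      proof eventually_elim
        case (elim k)
        then show ?case using K[of "r k" s t] r_ge[of k] s t by (simp add: dist_real_def)
      qed
      ultimately have "\<bar>g s - g t\<bar> \<le> e / 2"
        by (intro tendsto_upperbound) auto
      then show "dist (g s) (g t) < e" using e by (simp add: dist_real_def)
    qed
  qed
  with r g that show ?thesis by blast
qed

section \<open>Exponential bounds and logarithmic rates\<close>

lemma limsup_log_prob_le:
  assumes p: "\<And>n. 1 \<le> n \<Longrightarrow> p n \<le> c * exp (- (real n * a))" and p0: "\<And>n. 0 \<le> p n"
  shows "limsup (\<lambda>n. ereal (1 / real n) * log_prob (p n)) \<le> - ereal a"
proof -
  \<comment> \<open>Enlarging the prefactor to at least 1 keeps the bound and makes its logarithm
    meaningful; that logarithm disappears after division by \<open>n\<close>.\<close>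
  define c' where "c' = max c 1"
  have c': "0 < c'" by (simp add: c'_def)
  have le: "ereal (1 / real n) * log_prob (p n) \<le> ereal (ln c' / real n - a)" if n: "1 \<le> n" for n
  proof (cases "p n = 0")
    case True
    then show ?thesis using n by (simp add: log_prob_def)
  next
    case False
    then have "0 < p n" using p0[of n] by simp
    have "p n \<le> c' * exp (- (real n * a))"
      using p[OF n] by (rule order_trans) (simp add: c'_def)
    then have "ln (p n) \<le> ln (c' * exp (- (real n * a)))"
      using \<open>0 < p n\<close> c' by (subst ln_le_cancel_iff) auto
    also have "\<dots> = ln c' - real n * a"
      using c' by (simp add: ln_mult)
    finally have "ln (p n) / real n \<le> ln c' / real n - a"
      using n by (simp add: field_simps)
    then show ?thesis using False by (simp add: log_prob_def)
  qed
  have "(\<lambda>n. ln c' / real n - a) \<longlonglongrightarrow> 0 - a"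
    by (intro tendsto_intros lim_const_over_n)
  then have "limsup (\<lambda>n. ereal (ln c' / real n - a)) = ereal (- a)"
    by (intro lim_imp_Limsup) simp_all
  moreover have "limsup (\<lambda>n. ereal (1 / real n) * log_prob (p n)) \<le>
      limsup (\<lambda>n. ereal (ln c' / real n - a))"
    using le by (intro Limsup_mono) (auto simp: eventually_sequentially)
  ultimately show ?thesis by simp
qed

lemma liminf_log_prob_ge:
  assumes "eventually (\<lambda>n. exp (- (real n * b)) / 2 \<le> p n) sequentially"
  shows "- ereal b \<le> liminf (\<lambda>n. ereal (1 / real n) * log_prob (p n))"
proof -
  have "(\<lambda>n. - ln 2 / real n - b) \<longlonglongrightarrow> 0 - b"
    by (intro tendsto_intros lim_const_over_n)
  then have "liminf (\<lambda>n. ereal (- ln 2 / real n - b)) = ereal (- b)"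
    by (intro lim_imp_Liminf) simp_all
  moreover have "eventually (\<lambda>n. ereal (- ln 2 / real n - b) \<le>
      ereal (1 / real n) * log_prob (p n)) sequentially"
    using assms eventually_ge_at_top[of 1]
  proof eventually_elim
    case (elim n)
    have pos: "0 < exp (- (real n * b)) / 2" by simp
    then have "0 < p n" using elim(1) by linarith
    have "ln (exp (- (real n * b)) / 2) \<le> ln (p n)"
      using elim(1) pos \<open>0 < p n\<close> by (subst ln_le_cancel_iff) auto
    then have "- (real n * b) - ln 2 \<le> ln (p n)"
      by (simp add: ln_div)
    then have "(- (real n * b) - ln 2) / real n \<le> ln (p n) / real n"
      by (rule divide_right_mono) simp
    then have "- ln 2 / real n - b \<le> ln (p n) / real n"
      using elim(2) by (simp add: diff_divide_distrib)
    then show ?case using \<open>0 < p n\<close> by (simp add: log_prob_def)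
  qed
  ultimately show ?thesis
    using Liminf_mono by fastforce
qed

text \<open>\<open>X 1\<close> is the reference copy throughout; it must not be rewritten to \<open>X (Suc 0)\<close>.\<close>

declare One_nat_def [simp del]

section \<open>Multivariate Cramer lower bound\<close>

text \<open>\<open>S\<close> is arbitrary: it will be the uncountable set of times, while all
  functions that are integrated depend on finitely many coordinates and are therefore measurable for
  the product \<open>\<sigma>\<close>-algebra.\<close>

locale iid_fields = prob_space N for N :: "'b measure" +
  fixes S :: "'i set" and X :: "nat \<Rightarrow> 'b \<Rightarrow> 'i \<Rightarrow> real"
  assumes indep: "indep_vars (\<lambda>_. Pi\<^sub>M S (\<lambda>_. borel)) X {1..}"
    and same_law: "1 \<le> i \<Longrightarrow> distr N (Pi\<^sub>M S (\<lambda>_. borel)) (X i) = distr N (Pi\<^sub>M S (\<lambda>_. borel)) (X 1)"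
begin

lemma X_measurable: "1 \<le> i \<Longrightarrow> X i \<in> N \<rightarrow>\<^sub>M Pi\<^sub>M S (\<lambda>_. borel)"
  using indep by (simp add: indep_vars_def)

lemma X_coord_measurable: "1 \<le> i \<Longrightarrow> t \<in> S \<Longrightarrow> (\<lambda>\<omega>. X i \<omega> t) \<in> borel_measurable N"
  using measurable_compose[OF X_measurable measurable_component_singleton] by blast

lemma integrable_law:
  fixes g :: "('i \<Rightarrow> real) \<Rightarrow> real"
  assumes "g \<in> borel_measurable (Pi\<^sub>M S (\<lambda>_. borel))" "1 \<le> i"
  shows "integrable N (\<lambda>\<omega>. g (X i \<omega>)) \<longleftrightarrow> integrable N (\<lambda>\<omega>. g (X 1 \<omega>))"
    and "expectation (\<lambda>\<omega>. g (X i \<omega>)) = expectation (\<lambda>\<omega>. g (X 1 \<omega>))"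
  using integrable_distr_eq[OF X_measurable[OF assms(2)] assms(1)]
    integrable_distr_eq[OF X_measurable[of 1] assms(1)]
    integral_distr[OF X_measurable[OF assms(2)] assms(1)]
    integral_distr[OF X_measurable[of 1] assms(1)] same_law[OF assms(2)]
  by simp_all

text \<open>The factor may depend on the index, because the second-moment computation under the tilt
  inserts extra factors at one or two of the indices.\<close>

lemma expectation_prod:
  fixes g :: "nat \<Rightarrow> ('i \<Rightarrow> real) \<Rightarrow> real"
  assumes g: "\<And>i. g i \<in> borel_measurable (Pi\<^sub>M S (\<lambda>_. borel))"
    and int: "\<And>i. integrable N (\<lambda>\<omega>. g i (X 1 \<omega>))"
  shows "integrable N (\<lambda>\<omega>. \<Prod>i=1..n. g i (X i \<omega>))"
    and "expectation (\<lambda>\<omega>. \<Prod>i=1..n. g i (X i \<omega>)) = (\<Prod>i=1..n. expectation (\<lambda>\<omega>. g i (X 1 \<omega>)))"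
proof -
  have ind: "indep_vars (\<lambda>_. borel) (\<lambda>i \<omega>. g i (X i \<omega>)) {1..n}"
    using indep_vars_compose2[OF indep_vars_subset[OF indep, of "{1..n}"], of g "\<lambda>_. borel"] g
    by auto
  have int': "integrable N (\<lambda>\<omega>. g i (X i \<omega>))" if "i \<in> {1..n}" for i
    using integrable_law(1)[OF g[of i], of i] int that by simp
  show "integrable N (\<lambda>\<omega>. \<Prod>i=1..n. g i (X i \<omega>))"
    by (rule indep_vars_integrable[OF _ ind int']) simp_all
  have "expectation (\<lambda>\<omega>. \<Prod>i=1..n. g i (X i \<omega>)) = (\<Prod>i=1..n. expectation (\<lambda>\<omega>. g i (X i \<omega>)))"
    by (rule indep_vars_lebesgue_integral[OF _ ind int']) simp_all
  also have "\<dots> = (\<Prod>i=1..n. expectation (\<lambda>\<omega>. g i (X 1 \<omega>)))"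
    by (intro prod.cong refl integrable_law(2) g) simp
  finally show "expectation (\<lambda>\<omega>. \<Prod>i=1..n. g i (X i \<omega>)) = \<dots>" .
qed

lemma chernoff:
  fixes g :: "('i \<Rightarrow> real) \<Rightarrow> real"
  assumes g: "g \<in> borel_measurable (Pi\<^sub>M S (\<lambda>_. borel))"
    and int: "integrable N (\<lambda>\<omega>. exp (g (X 1 \<omega>)))"
  shows "prob {\<omega> \<in> space N. real n * b \<le> (\<Sum>i=1..n. g (X i \<omega>))}
    \<le> exp (- (real n * b)) * expectation (\<lambda>\<omega>. exp (g (X 1 \<omega>))) ^ n"
proof -
  let ?Y = "\<lambda>\<omega>. \<Prod>i=1..n. exp (g (X i \<omega>))"
  have "integrable N ?Y" "expectation ?Y = expectation (\<lambda>\<omega>. exp (g (X 1 \<omega>))) ^ n"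
    using expectation_prod[of "\<lambda>_ x. exp (g x)" n] g int by simp_all
  moreover have "prob {\<omega> \<in> space N. exp (real n * b) \<le> ?Y \<omega>} \<le> expectation ?Y / exp (real n * b)"
    using calculation(1) by (intro integral_Markov_inequality_measure[where A="space N"]) (auto intro!: prod_nonneg)
  moreover have "exp (real n * b) \<le> ?Y \<omega> \<longleftrightarrow> real n * b \<le> (\<Sum>i=1..n. g (X i \<omega>))" for \<omega>
    by (simp flip: exp_sum)
  ultimately show ?thesis
    by (simp add: exp_minus divide_inverse mult.commute)
qed

end

section \<open>Exponential tilting of random vectors\<close>

text \<open>A first-order expansion whose remainder is \<open>t\<^sup>2\<close> times a factor free
  of \<open>t\<close>. Integrated against a tilt, it replaces differentiation of the moment
  generating function under the integral.\<close>

lemma exp_le_quadratic: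
  fixes t x :: real
  assumes "\<bar>t\<bar> \<le> 1"
  shows "exp (t * x) \<le> 1 + t * x + t\<^sup>2 * exp (2 * \<bar>x\<bar>)"
proof -
  obtain u where u: "\<bar>u\<bar> \<le> \<bar>t * x\<bar>" "exp (t * x) = 1 + t * x + exp u / 2 * (t * x)\<^sup>2"
    using Maclaurin_exp_le[of "t * x" 2] by (auto simp: numeral_2_eq_2)
  have "\<bar>t * x\<bar> \<le> \<bar>x\<bar>"
    using assms by (simp add: abs_mult mult_left_le_one_le)
  then have "exp u \<le> exp \<bar>x\<bar>" using u(1) by simp
  moreover have "x\<^sup>2 / 2 \<le> exp \<bar>x\<bar>"
    using exp_lower_Taylor_quadratic[of "\<bar>x\<bar>"] by simp
  ultimately have "exp u * (x\<^sup>2 / 2) \<le> exp \<bar>x\<bar> * exp \<bar>x\<bar>"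
    by (intro mult_mono) auto
  then have "t\<^sup>2 * (exp u * (x\<^sup>2 / 2)) \<le> t\<^sup>2 * exp (2 * \<bar>x\<bar>)"
    by (intro mult_left_mono) (simp_all add: exp_double power2_eq_square)
  then show ?thesis using u(2) by (simp add: power_mult_distrib algebra_simps)
qed

locale iid_vectors = iid_fields N S X for N :: "'b measure" and S :: "'i set" and X +
  fixes J :: "'i set"
  assumes J: "finite J" "J \<subseteq> S"
    and exp_moments: "\<And>\<alpha>. integrable N (\<lambda>\<omega>. exp (\<Sum>l\<in>J. \<alpha> l * X 1 \<omega> l))"
begin

definition mgf :: "('i \<Rightarrow> real) \<Rightarrow> real" where
  "mgf \<alpha> = expectation (\<lambda>\<omega>. exp (\<Sum>l\<in>J. \<alpha> l * X 1 \<omega> l))"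

lemma linear_measurable [measurable]:
  "(\<lambda>x. \<Sum>l\<in>J. \<alpha> l * x l) \<in> borel_measurable (Pi\<^sub>M S (\<lambda>_. borel :: real measure))"
  using J by (intro borel_measurable_sum borel_measurable_times measurable_component_singleton) auto

lemma X1_measurable [measurable]: "l \<in> J \<Longrightarrow> (\<lambda>\<omega>. X 1 \<omega> l) \<in> borel_measurable N"
  using X_coord_measurable[of 1 l] J by auto

lemma mgf_pos: "0 < mgf \<alpha>"
proof -
  have "0 < expectation (\<lambda>\<omega>. exp (\<Sum>l\<in>J. \<alpha> l * X 1 \<omega> l))"
    by (rule expectation_greater[OF exp_moments]) simp
  then show ?thesis by (simp add: mgf_def)
qed

text \<open>Bounding \<open>exp (R * \<bar>y\<bar>)\<close> by
  \<open>exp (R * y) + exp (- (R * y))\<close> and expanding the product over \<open>J\<close>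
  leaves one exponential of a linear form for each pattern of signs, and each of these is integrable
  by assumption.\<close>

lemma integrable_exp_abs: "integrable N (\<lambda>\<omega>. exp (R * (\<Sum>l\<in>J. \<bar>X 1 \<omega> l\<bar>)))"
proof (rule Bochner_Integration.integrable_bound)
  have eq: "(\<Prod>l\<in>J. exp (R * X 1 \<omega> l) + exp (- (R * X 1 \<omega> l))) =
    (\<Sum>B\<in>Pow J. exp (\<Sum>l\<in>J. (if l \<in> B then R else - R) * X 1 \<omega> l))" for \<omega>
  proof -
    have "(\<Prod>l\<in>J. exp (R * X 1 \<omega> l) + exp (- (R * X 1 \<omega> l))) =
      (\<Sum>B\<in>Pow J. (\<Prod>l\<in>B. exp (R * X 1 \<omega> l)) * (\<Prod>l\<in>J-B. exp (- (R * X 1 \<omega> l))))"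
      by (rule prod_add[OF J(1)])
    also have "\<dots> = (\<Sum>B\<in>Pow J. \<Prod>l\<in>J. exp ((if l \<in> B then R else - R) * X 1 \<omega> l))"
    proof (intro sum.cong refl)
      fix B assume B: "B \<in> Pow J"
      have "(\<Prod>l\<in>J. exp ((if l \<in> B then R else - R) * X 1 \<omega> l)) =
        (\<Prod>l\<in>J-B. exp ((if l \<in> B then R else - R) * X 1 \<omega> l)) *
        (\<Prod>l\<in>B. exp ((if l \<in> B then R else - R) * X 1 \<omega> l))"
        using B J(1) by (intro prod.subset_diff) auto
      then show "(\<Prod>l\<in>B. exp (R * X 1 \<omega> l)) * (\<Prod>l\<in>J-B. exp (- (R * X 1 \<omega> l))) =
        (\<Prod>l\<in>J. exp ((if l \<in> B then R else - R) * X 1 \<omega> l))"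
        by (simp add: mult.commute)
    qed
    finally show ?thesis by (simp add: exp_sum J(1))
  qed
  show "integrable N (\<lambda>\<omega>. \<Prod>l\<in>J. exp (R * X 1 \<omega> l) + exp (- (R * X 1 \<omega> l)))"
    unfolding eq by (intro Bochner_Integration.integrable_sum exp_moments)
  show "AE \<omega> in N. norm (exp (R * (\<Sum>l\<in>J. \<bar>X 1 \<omega> l\<bar>))) \<le>
    norm (\<Prod>l\<in>J. exp (R * X 1 \<omega> l) + exp (- (R * X 1 \<omega> l)))"
  proof (intro AE_I2)
    fix \<omega>
    have "exp (R * \<bar>y\<bar>) \<le> exp (R * y) + exp (- (R * y))" for y
      by (cases "0 \<le> y") auto
    then have "(\<Prod>l\<in>J. exp (R * \<bar>X 1 \<omega> l\<bar>)) \<le> (\<Prod>l\<in>J. exp (R * X 1 \<omega> l) + exp (- (R * X 1 \<omega> l)))"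
      by (intro prod_mono) auto
    then show "norm (exp (R * (\<Sum>l\<in>J. \<bar>X 1 \<omega> l\<bar>))) \<le>
      norm (\<Prod>l\<in>J. exp (R * X 1 \<omega> l) + exp (- (R * X 1 \<omega> l)))"
      by (simp add: sum_distrib_left exp_sum J(1)) (simp add: abs_of_pos prod_pos add_pos_pos)
  qed
qed measurable

lemma linear_le_abs:
  fixes \<alpha> x :: "'i \<Rightarrow> real"
  assumes "\<And>l. l \<in> J \<Longrightarrow> \<bar>\<alpha> l\<bar> \<le> R"
  shows "(\<Sum>l\<in>J. \<alpha> l * x l) \<le> R * (\<Sum>l\<in>J. \<bar>x l\<bar>)"
  unfolding sum_distrib_left
proof (rule sum_mono)
  fix l assume "l \<in> J"
  have "\<alpha> l * x l \<le> \<bar>\<alpha> l\<bar> * \<bar>x l\<bar>" by (metis abs_ge_self abs_mult)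
  also have "\<dots> \<le> R * \<bar>x l\<bar>" using assms[OF \<open>l \<in> J\<close>] by (intro mult_right_mono) auto
  finally show "\<alpha> l * x l \<le> R * \<bar>x l\<bar>" .
qed

lemma mgf_tendsto:
  assumes lim: "\<And>l. l \<in> J \<Longrightarrow> (\<lambda>k. a k l) \<longlonglongrightarrow> \<alpha> l"
    and bound: "\<And>k l. l \<in> J \<Longrightarrow> \<bar>a k l\<bar> \<le> R"
  shows "(\<lambda>k. mgf (a k)) \<longlonglongrightarrow> mgf \<alpha>"
  unfolding mgf_def
proof (rule integral_dominated_convergence[OF _ _ integrable_exp_abs[of R]])
  show "AE \<omega> in N. (\<lambda>k. exp (\<Sum>l\<in>J. a k l * X 1 \<omega> l)) \<longlonglongrightarrow> exp (\<Sum>l\<in>J. \<alpha> l * X 1 \<omega> l)"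
    by (intro AE_I2 tendsto_intros lim)
  show "AE \<omega> in N. norm (exp (\<Sum>l\<in>J. a k l * X 1 \<omega> l)) \<le> exp (R * (\<Sum>l\<in>J. \<bar>X 1 \<omega> l\<bar>))" for k
    using linear_le_abs[of "a k" R "X 1 _", OF bound] by (intro AE_I2) simp
qed measurable

text \<open>The change of measure with density \<open>\<Prod>\<^sub>i exp (\<alpha> \<cdot> X\<^sub>i) / mgf \<alpha>\<close>; the law of large numbers under the
  tilted measure is Chebyshev's inequality.\<close>

lemma tilted_lower_bound:
  assumes w: "\<And>l. l \<in> J \<Longrightarrow>
      expectation (\<lambda>\<omega>. exp (\<Sum>l\<in>J. \<alpha> l * X 1 \<omega> l) * (X 1 \<omega> l - w l)) = 0"
    and \<eta>: "0 < \<eta>"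
  shows "\<exists>C. \<forall>n\<ge>1. (1 - C / real n) *
      exp (- real n * ((\<Sum>l\<in>J. \<alpha> l * w l) - ln (mgf \<alpha>) + \<eta> * (\<Sum>l\<in>J. \<bar>\<alpha> l\<bar>)))
    \<le> prob {\<omega> \<in> space N. \<forall>l\<in>J. \<bar>(\<Sum>i=1..n. X i \<omega> l) / real n - w l\<bar> < \<eta>}"
proof -
  define g where "g x = exp (\<Sum>l\<in>J. \<alpha> l * x l) / mgf \<alpha>" for x :: "'i \<Rightarrow> real"
  have g_meas [measurable]: "g \<in> borel_measurable (Pi\<^sub>M S (\<lambda>_. borel))"
    unfolding g_def by measurable
  have g_pos: "0 < g x" for x by (simp add: g_def mgf_pos)
  have g_int: "integrable N (\<lambda>\<omega>. g (X 1 \<omega>))" and g_exp: "expectation (\<lambda>\<omega>. g (X 1 \<omega>)) = 1"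
    using exp_moments[of \<alpha>] mgf_pos[of \<alpha>] by (simp_all add: g_def mgf_def)
  define Y where "Y n \<omega> = (\<Prod>i=1..n. g (X i \<omega>))" for n \<omega>
  have Y_int: "integrable N (Y n)" and Y_exp: "expectation (Y n) = 1" for n
    using expectation_prod[of "\<lambda>_. g" n] g_int g_exp by (simp_all add: Y_def[abs_def])
  have Y_pos: "0 < Y n \<omega>" for n \<omega> by (simp add: Y_def prod_pos g_pos)
  define d where "d l x = x l - w l" for l and x :: "'i \<Rightarrow> real"
  have d_meas [measurable]: "d l \<in> borel_measurable (Pi\<^sub>M S (\<lambda>_. borel))" if "l \<in> J" for l
    using that J unfolding d_def by (intro borel_measurable_diff measurable_component_singleton) auto
  have gd2: "integrable N (\<lambda>\<omega>. g (X 1 \<omega>) * (d l (X 1 \<omega>))\<^sup>2)" if l: "l \<in> J" for l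
  proof (rule Bochner_Integration.integrable_bound)
    \<comment> \<open>The extra 2 absorbs the squared deviation, which is bounded by a multiple of
      \<open>exp (2 * (s + \<bar>w l\<bar>))\<close>.\<close>
    define R where "R = (\<Sum>l\<in>J. \<bar>\<alpha> l\<bar>) + 2"
    show "integrable N (\<lambda>\<omega>. (4 * exp \<bar>w l\<bar> * exp \<bar>w l\<bar> / mgf \<alpha>) * exp (R * (\<Sum>l\<in>J. \<bar>X 1 \<omega> l\<bar>)))"
      by (intro integrable_mult_right integrable_exp_abs)
    show "AE \<omega> in N. norm (g (X 1 \<omega>) * (d l (X 1 \<omega>))\<^sup>2) \<le>
        norm ((4 * exp \<bar>w l\<bar> * exp \<bar>w l\<bar> / mgf \<alpha>) * exp (R * (\<Sum>l\<in>J. \<bar>X 1 \<omega> l\<bar>)))"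
    proof (intro AE_I2)
      fix \<omega>
      define s where "s = (\<Sum>l\<in>J. \<bar>X 1 \<omega> l\<bar>)"
      have s: "\<bar>X 1 \<omega> l\<bar> \<le> s" unfolding s_def using l J by (intro member_le_sum) auto
      have "\<bar>\<alpha> k\<bar> \<le> R - 2" if "k \<in> J" for k
        unfolding R_def using member_le_sum[of k J "\<lambda>l. \<bar>\<alpha> l\<bar>"] that J(1) by simp
      then have "(\<Sum>l\<in>J. \<alpha> l * X 1 \<omega> l) \<le> (R - 2) * s"
        unfolding s_def by (rule linear_le_abs)
      then have 1: "g (X 1 \<omega>) \<le> exp ((R - 2) * s) / mgf \<alpha>"
        using mgf_pos[of \<alpha>] by (simp add: g_def divide_right_mono)
      define y where "y = \<bar>X 1 \<omega> l\<bar> + \<bar>w l\<bar>"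
      have "(d l (X 1 \<omega>))\<^sup>2 \<le> y\<^sup>2"
        unfolding y_def d_def by (intro abs_le_square_iff[THEN iffD1]) linarith
      also have "\<dots> \<le> 4 * exp y"
      proof -
        have "0 \<le> y" by (simp add: y_def)
        then show ?thesis
          using exp_lower_Taylor_quadratic[of y] exp_ge_zero[of y] by linarith
      qed
      also have "\<dots> \<le> 4 * exp (2 * (s + \<bar>w l\<bar>))"
        using s by (simp add: y_def)
      finally have "g (X 1 \<omega>) * (d l (X 1 \<omega>))\<^sup>2 \<le>
          exp ((R - 2) * s) / mgf \<alpha> * (4 * exp (2 * (s + \<bar>w l\<bar>)))"
        using 1 g_pos[of "X 1 \<omega>"] mgf_pos[of \<alpha>] by (intro mult_mono) auto
      also have "\<dots> = (4 * exp \<bar>w l\<bar> * exp \<bar>w l\<bar> / mgf \<alpha>) * exp (R * s)"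
        by (simp add: exp_double exp_add[symmetric] field_simps)
      finally show "norm (g (X 1 \<omega>) * (d l (X 1 \<omega>))\<^sup>2) \<le>
        norm ((4 * exp \<bar>w l\<bar> * exp \<bar>w l\<bar> / mgf \<alpha>) * exp (R * (\<Sum>l\<in>J. \<bar>X 1 \<omega> l\<bar>)))"
        using g_pos[of "X 1 \<omega>"] mgf_pos[of \<alpha>] by (simp add: s_def abs_mult)
    qed
  qed (use l g_meas d_meas X_measurable[of 1] in measurable)
  have gd: "integrable N (\<lambda>\<omega>. g (X 1 \<omega>) * d l (X 1 \<omega>))" if l: "l \<in> J" for l
  proof (rule Bochner_Integration.integrable_bound)
    show "integrable N (\<lambda>\<omega>. g (X 1 \<omega>) + g (X 1 \<omega>) * (d l (X 1 \<omega>))\<^sup>2)"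
      by (intro Bochner_Integration.integrable_add g_int gd2 l)
    have "\<bar>y\<bar> \<le> 1 + y\<^sup>2" for y :: real
      using zero_le_power2[of "\<bar>y\<bar> - 1"] by (simp add: power2_eq_square algebra_simps)
    then have le: "g x * \<bar>d l x\<bar> \<le> g x * (1 + (d l x)\<^sup>2)" for x
      using g_pos[of x] by (intro mult_left_mono) auto
    have "\<bar>g x * d l x\<bar> \<le> \<bar>g x + g x * (d l x)\<^sup>2\<bar>" for x
    proof -
      have "\<bar>g x * d l x\<bar> = g x * \<bar>d l x\<bar>" using g_pos[of x] by (simp add: abs_mult)
      also have "\<dots> \<le> g x + g x * (d l x)\<^sup>2" using le[of x] by (simp add: distrib_left)
      finally show ?thesis by linarith
    qed
    then show "AE \<omega> in N. norm (g (X 1 \<omega>) * d l (X 1 \<omega>)) \<le>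
        norm (g (X 1 \<omega>) + g (X 1 \<omega>) * (d l (X 1 \<omega>))\<^sup>2)"
      by (intro AE_I2) simp
  qed (use l g_meas d_meas X_measurable[of 1] in measurable)
  have gd0: "expectation (\<lambda>\<omega>. g (X 1 \<omega>) * d l (X 1 \<omega>)) = 0" if "l \<in> J" for l
    using w[OF that] by (simp add: g_def d_def)
  define \<sigma> where "\<sigma> l = expectation (\<lambda>\<omega>. g (X 1 \<omega>) * (d l (X 1 \<omega>))\<^sup>2)" for l
  have pair: "integrable N (\<lambda>\<omega>. Y n \<omega> * (d l (X i \<omega>) * d l (X j \<omega>)))"
      "expectation (\<lambda>\<omega>. Y n \<omega> * (d l (X i \<omega>) * d l (X j \<omega>))) = (if i = j then \<sigma> l else 0)"
    if l: "l \<in> J" and ij: "i \<in> {1..n}" "j \<in> {1..n}" for l n i j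
  proof -
    \<comment> \<open>Spreading the integrand over all indices makes \<open>expectation_prod\<close>
      applicable. For \<open>i = j\<close> both extra factors meet and give the second moment;
      otherwise index \<open>i\<close> contributes a first moment, which vanishes under the
      tilt.\<close>
    define G where "G k x = g x * ((if k = i then d l x else 1) * (if k = j then d l x else 1))"
      for k x
    have eq: "(\<Prod>k=1..n. G k (X k \<omega>)) = Y n \<omega> * (d l (X i \<omega>) * d l (X j \<omega>))" for \<omega>
      using ij by (simp add: G_def Y_def prod.distrib prod.delta)
    have "G k \<in> borel_measurable (Pi\<^sub>M S (\<lambda>_. borel))" for k
      unfolding G_def using l by measurable
    moreover have "integrable N (\<lambda>\<omega>. G k (X 1 \<omega>))" for k
      unfolding G_def using g_int gd[OF l] gd2[OF l]
      by (cases "k = i"; cases "k = j") (simp_all add: power2_eq_square)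
    ultimately have *: "integrable N (\<lambda>\<omega>. \<Prod>k=1..n. G k (X k \<omega>))"
      "expectation (\<lambda>\<omega>. \<Prod>k=1..n. G k (X k \<omega>)) = (\<Prod>k=1..n. expectation (\<lambda>\<omega>. G k (X 1 \<omega>)))"
      using expectation_prod[of G n] by blast+
    have EG: "expectation (\<lambda>\<omega>. G k (X 1 \<omega>)) = (if k = i then (if i = j then \<sigma> l else 0) else
        (if k = j then 0 else 1))" for k
      using gd0[OF l] g_exp
      by (cases "k = i"; cases "k = j") (simp_all add: G_def \<sigma>_def power2_eq_square)
    have "(\<Prod>k=1..n. expectation (\<lambda>\<omega>. G k (X 1 \<omega>))) = (if i = j then \<sigma> l else 0)"
    proof (cases "i = j")
      case True
      then have "(\<Prod>k=1..n. expectation (\<lambda>\<omega>. G k (X 1 \<omega>))) = (\<Prod>k=1..n. if k = i then \<sigma> l else 1)"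
        using EG by (intro prod.cong) simp_all
      then show ?thesis using ij True by (simp add: prod.delta)
    next
      case False
      then show ?thesis
        using ij EG
        by (auto intro!: prod_zero bexI[of _ i])
    qed
    with * show "integrable N (\<lambda>\<omega>. Y n \<omega> * (d l (X i \<omega>) * d l (X j \<omega>)))"
      "expectation (\<lambda>\<omega>. Y n \<omega> * (d l (X i \<omega>) * d l (X j \<omega>))) = (if i = j then \<sigma> l else 0)"
      by (simp_all add: eq)
  qed
  define D where "D n l \<omega> = (\<Sum>i=1..n. X i \<omega> l) / real n - w l" for n l \<omega>
  have sq: "integrable N (\<lambda>\<omega>. Y n \<omega> * (D n l \<omega>)\<^sup>2)"
      "expectation (\<lambda>\<omega>. Y n \<omega> * (D n l \<omega>)\<^sup>2) = \<sigma> l / real n"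
    if l: "l \<in> J" and n: "1 \<le> n" for n l
  proof -
    have "D n l \<omega> = (\<Sum>i=1..n. d l (X i \<omega>)) / real n" for \<omega>
      using n by (simp add: D_def d_def sum_subtractf field_simps)
    then have eq: "Y n \<omega> * (D n l \<omega>)\<^sup>2 =
        (\<Sum>i=1..n. \<Sum>j=1..n. Y n \<omega> * (d l (X i \<omega>) * d l (X j \<omega>))) / (real n)\<^sup>2" for \<omega>
    proof -
      assume D: "\<And>\<omega>. D n l \<omega> = (\<Sum>i=1..n. d l (X i \<omega>)) / real n"
      have "(\<Sum>i=1..n. d l (X i \<omega>))\<^sup>2 = (\<Sum>i=1..n. \<Sum>j=1..n. d l (X i \<omega>) * d l (X j \<omega>))"
        by (simp only: power2_eq_square sum_product)
      then have "Y n \<omega> * (\<Sum>i=1..n. d l (X i \<omega>))\<^sup>2 =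
          (\<Sum>i=1..n. \<Sum>j=1..n. Y n \<omega> * (d l (X i \<omega>) * d l (X j \<omega>)))"
        by (simp only: sum_distrib_left)
      then show ?thesis by (simp only: D power_divide times_divide_eq_right)
    qed
    show "integrable N (\<lambda>\<omega>. Y n \<omega> * (D n l \<omega>)\<^sup>2)"
      unfolding eq by (intro integrable_divide Bochner_Integration.integrable_sum pair l)
    have "expectation (\<lambda>\<omega>. \<Sum>i=1..n. \<Sum>j=1..n. Y n \<omega> * (d l (X i \<omega>) * d l (X j \<omega>))) =
        (\<Sum>i=1..n. expectation (\<lambda>\<omega>. \<Sum>j=1..n. Y n \<omega> * (d l (X i \<omega>) * d l (X j \<omega>))))"
      by (intro Bochner_Integration.integral_sum Bochner_Integration.integrable_sum pair(1)[OF l])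
    also have "\<dots> = (\<Sum>i=1..n. \<Sum>j=1..n. expectation (\<lambda>\<omega>. Y n \<omega> * (d l (X i \<omega>) * d l (X j \<omega>))))"
      by (intro sum.cong refl Bochner_Integration.integral_sum pair(1)[OF l])
    also have "\<dots> = (\<Sum>i=1..n. \<Sum>j=1..n. if i = j then \<sigma> l else 0)"
      by (intro sum.cong refl pair(2)[OF l])
    finally have "expectation (\<lambda>\<omega>. Y n \<omega> * (D n l \<omega>)\<^sup>2) =
        (\<Sum>i=1..n. \<Sum>j=1..n. if i = j then \<sigma> l else 0) / (real n)\<^sup>2"
      unfolding eq by simp
    then show "expectation (\<lambda>\<omega>. Y n \<omega> * (D n l \<omega>)\<^sup>2) = \<sigma> l / real n"
      using n by (simp add: power2_eq_square)
  qed
  \<comment> \<open>On the target event the density is at most \<open>exp (n * e)\<close>: the first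
    two terms are its exponent at the mean \<open>w\<close>, and the last one pays for deviations up
    to \<open>\<eta>\<close>.\<close>
  define e where "e = (\<Sum>l\<in>J. \<alpha> l * w l) - ln (mgf \<alpha>) + \<eta> * (\<Sum>l\<in>J. \<bar>\<alpha> l\<bar>)"
  have main: "(1 - (\<Sum>l\<in>J. \<sigma> l) / \<eta>\<^sup>2 / real n) * exp (- real n * e)
      \<le> prob {\<omega> \<in> space N. \<forall>l\<in>J. \<bar>D n l \<omega>\<bar> < \<eta>}" if n: "1 \<le> n" for n
  proof -
    define E where "E = {\<omega> \<in> space N. \<forall>l\<in>J. \<bar>D n l \<omega>\<bar> < \<eta>}"
    have D_meas: "(\<lambda>\<omega>. D n l \<omega>) \<in> borel_measurable N" if "l \<in> J" for l
      unfolding D_def using that J X_coord_measurable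
      by (intro borel_measurable_diff borel_measurable_divide borel_measurable_sum) auto
    have E: "E \<in> sets N"
      unfolding E_def using D_meas J(1)
      by (intro sets.sets_Collect_finite_All) auto
    have Y_bound: "Y n \<omega> \<le> exp (real n * e)" if "\<omega> \<in> E" for \<omega>
    proof -
      have "(\<Sum>l\<in>J. \<alpha> l * D n l \<omega>) \<le> (\<Sum>l\<in>J. \<bar>\<alpha> l\<bar> * \<eta>)"
      proof (rule sum_mono)
        fix l assume l: "l \<in> J"
        have "\<alpha> l * D n l \<omega> \<le> \<bar>\<alpha> l\<bar> * \<bar>D n l \<omega>\<bar>" by (metis abs_ge_self abs_mult)
        also have "\<dots> \<le> \<bar>\<alpha> l\<bar> * \<eta>"
          using that l by (intro mult_left_mono) (auto simp: E_def less_imp_le)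
        finally show "\<alpha> l * D n l \<omega> \<le> \<bar>\<alpha> l\<bar> * \<eta>" .
      qed
      moreover have "(\<Sum>i=1..n. \<Sum>l\<in>J. \<alpha> l * X i \<omega> l) = real n * (\<Sum>l\<in>J. \<alpha> l * (D n l \<omega> + w l))"
      proof -
        have "(\<Sum>i=1..n. X i \<omega> l) = real n * (D n l \<omega> + w l)" for l
          using n by (simp add: D_def)
        moreover have "(\<Sum>i=1..n. \<Sum>l\<in>J. \<alpha> l * X i \<omega> l) = (\<Sum>l\<in>J. \<alpha> l * (\<Sum>i=1..n. X i \<omega> l))"
          by (subst sum.swap) (simp only: sum_distrib_left)
        ultimately show ?thesis by (simp add: sum_distrib_left mult.left_commute)
      qed
      moreover have "(\<Sum>l\<in>J. \<alpha> l * (D n l \<omega> + w l)) = (\<Sum>l\<in>J. \<alpha> l * D n l \<omega>) + (\<Sum>l\<in>J. \<alpha> l * w l)"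
        by (simp only: distrib_left sum.distrib)
      moreover have "(\<Sum>l\<in>J. \<bar>\<alpha> l\<bar> * \<eta>) = \<eta> * (\<Sum>l\<in>J. \<bar>\<alpha> l\<bar>)"
        by (simp only: sum_distrib_left mult.commute)
      ultimately have "(\<Sum>i=1..n. \<Sum>l\<in>J. \<alpha> l * X i \<omega> l) \<le>
          real n * ((\<Sum>l\<in>J. \<alpha> l * w l) + \<eta> * (\<Sum>l\<in>J. \<bar>\<alpha> l\<bar>))"
        by (simp only:) (intro mult_left_mono, linarith, simp)
      moreover have "Y n \<omega> = exp ((\<Sum>i=1..n. \<Sum>l\<in>J. \<alpha> l * X i \<omega> l) - real n * ln (mgf \<alpha>))"
        using mgf_pos[of \<alpha>]
        by (simp add: Y_def g_def prod_dividef exp_diff exp_sum exp_of_nat_mult)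
      ultimately show ?thesis by (simp add: e_def algebra_simps)
    qed
    have "1 - (\<Sum>l\<in>J. \<sigma> l) / \<eta>\<^sup>2 / real n =
        expectation (\<lambda>\<omega>. Y n \<omega> - (\<Sum>l\<in>J. Y n \<omega> * (D n l \<omega>)\<^sup>2) / \<eta>\<^sup>2)"
      using Y_int[of n] Y_exp[of n] sq[OF _ n]
      by (simp add: Bochner_Integration.integral_diff Bochner_Integration.integral_sum
          Bochner_Integration.integrable_sum sum_divide_distrib mult.commute)
    \<comment> \<open>Chebyshev's inequality and the change of measure in one pointwise bound: on
      \<open>E\<close> the subtracted sum is dropped and the density bounded, while off
      \<open>E\<close> one coordinate already makes the left side nonpositive.\<close>
    also have "\<dots> \<le> expectation (\<lambda>\<omega>. exp (real n * e) * indicator E \<omega>)"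
    proof (rule integral_mono)
      fix \<omega> assume \<omega>: "\<omega> \<in> space N"
      show "Y n \<omega> - (\<Sum>l\<in>J. Y n \<omega> * (D n l \<omega>)\<^sup>2) / \<eta>\<^sup>2 \<le> exp (real n * e) * indicator E \<omega>"
      proof (cases "\<omega> \<in> E")
        case True
        have "0 \<le> (\<Sum>l\<in>J. Y n \<omega> * (D n l \<omega>)\<^sup>2) / \<eta>\<^sup>2"
          using Y_pos[of n \<omega>] by (intro divide_nonneg_nonneg sum_nonneg) auto
        then show ?thesis using Y_bound[OF True] True by simp
      next
        case False
        then obtain l where l: "l \<in> J" "\<eta> \<le> \<bar>D n l \<omega>\<bar>"
          using \<omega> by (auto simp: E_def not_less)
        have "\<eta>\<^sup>2 \<le> (D n l \<omega>)\<^sup>2"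
          using l(2) \<eta> by (metis abs_le_square_iff abs_of_pos)
        then have "Y n \<omega> * \<eta>\<^sup>2 \<le> Y n \<omega> * (D n l \<omega>)\<^sup>2"
          using Y_pos[of n \<omega>] by (intro mult_left_mono) auto
        also have "\<dots> \<le> (\<Sum>l\<in>J. Y n \<omega> * (D n l \<omega>)\<^sup>2)"
          using l(1) J(1) Y_pos[of n \<omega>] by (intro member_le_sum) auto
        finally show ?thesis using False \<eta> by (simp add: field_simps)
      qed
    qed (use Y_int[of n] sq(1)[OF _ n] E in \<open>auto intro!: Bochner_Integration.integrable_diff
        integrable_divide Bochner_Integration.integrable_sum
        integrable_real_indicator simp: emeasure_eq_measure\<close>)
    also have "\<dots> = exp (real n * e) * prob E" using E by simp
    finally have "(1 - (\<Sum>l\<in>J. \<sigma> l) / \<eta>\<^sup>2 / real n) * exp (- real n * e) \<le>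
        exp (real n * e) * prob E * exp (- real n * e)"
      by (intro mult_right_mono) auto
    also have "\<dots> = prob E" by (simp add: mult_exp_exp)
    finally show ?thesis unfolding E_def .
  qed
  show ?thesis
    by (intro exI[of _ "(\<Sum>l\<in>J. \<sigma> l) / \<eta>\<^sup>2"]) (use main in \<open>simp add: e_def D_def\<close>)
qed

lemma tilt_attaining_near:
  assumes I: "\<And>\<alpha>. (\<Sum>l\<in>J. \<alpha> l * v l) - ln (mgf \<alpha>) \<le> I" and \<epsilon>: "0 < \<epsilon>"
  obtains \<beta> w where "\<And>l. l \<in> J \<Longrightarrow>
      expectation (\<lambda>\<omega>. exp (\<Sum>l\<in>J. \<beta> l * X 1 \<omega> l) * (X 1 \<omega> l - w l)) = 0"
    "(\<Sum>l\<in>J. \<beta> l * w l) - ln (mgf \<beta>) \<le> I"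
    "\<And>l. l \<in> J \<Longrightarrow> (w l - v l)\<^sup>2 \<le> 4 * \<epsilon> * I"
proof -
  text \<open>The quadratic term makes the minimum exist, and at the minimiser it displaces the tilted mean
    from \<open>v\<close> by only \<open>O(sqrt \<epsilon>)\<close>.\<close>
  define h where "h \<alpha> = ln (mgf \<alpha>) - (\<Sum>l\<in>J. \<alpha> l * v l) + \<epsilon> * (\<Sum>l\<in>J. (\<alpha> l)\<^sup>2)" for \<alpha>
  have h_lower: "- I + \<epsilon> * (\<Sum>l\<in>J. (\<alpha> l)\<^sup>2) \<le> h \<alpha>" for \<alpha>
    using I[of \<alpha>] by (simp add: h_def)
  have h_lower': "- I \<le> h \<alpha>" for \<alpha>
  proof -
    have "0 \<le> \<epsilon> * (\<Sum>l\<in>J. (\<alpha> l)\<^sup>2)" using \<epsilon> by (intro mult_nonneg_nonneg sum_nonneg) auto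
    then show ?thesis using h_lower[of \<alpha>] by linarith
  qed
  define m where "m = Inf (range h)"
  have bdd: "bdd_below (range h)" using h_lower' by (intro bdd_belowI[of _ "- I"]) auto
  have m_le: "m \<le> h \<alpha>" for \<alpha> unfolding m_def by (intro cInf_lower bdd) auto
  have "\<exists>\<alpha>. h \<alpha> < m + 1 / real (Suc k)" for k
  proof -
    have "Inf (range h) < m + 1 / real (Suc k)" by (simp add: m_def)
    from cInf_lessD[OF _ this] show ?thesis by auto
  qed
  then obtain a where a: "\<And>k. h (a k) < m + 1 / real (Suc k)" by metis
  \<comment> \<open>The lower bound \<open>- I + \<epsilon> * \<bar>\<alpha>\<bar>^2\<close> makes
    \<open>h\<close> coercive. Along a minimising sequence with \<open>h\<close> below
    \<open>m + 1\<close> it confines every squared coordinate to \<open>R\<close>, which gives a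
    convergent subsequence.\<close>
  define R where "R = (I + m + 1) / \<epsilon>"
  have a_sq: "(a k l)\<^sup>2 \<le> R" if l: "l \<in> J" for k l
  proof -
    have "(a k l)\<^sup>2 \<le> (\<Sum>l\<in>J. (a k l)\<^sup>2)" using l J(1) by (intro member_le_sum) auto
    then have "\<epsilon> * (a k l)\<^sup>2 \<le> \<epsilon> * (\<Sum>l\<in>J. (a k l)\<^sup>2)" using \<epsilon> by (intro mult_left_mono) auto
    also have "\<dots> \<le> I + h (a k)" using h_lower[of "a k"] by simp
    also have "\<dots> \<le> I + (m + 1)"
    proof -
      have "1 / real (Suc k) \<le> 1" by simp
      then show ?thesis using a[of k] by linarith
    qed
    finally show ?thesis using \<epsilon> by (simp add: R_def field_simps)
  qed
  have a_abs: "\<bar>a k l\<bar> \<le> sqrt R" if "l \<in> J" for k l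
    using real_sqrt_le_mono[OF a_sq[OF that, of k]] by simp
  obtain r \<beta> where r: "strict_mono (r :: nat \<Rightarrow> nat)"
    and lim: "\<And>l. l \<in> J \<Longrightarrow> (\<lambda>k. a (r k) l) \<longlonglongrightarrow> \<beta> l"
  proof -
    obtain r where "strict_mono (r :: nat \<Rightarrow> nat)" "\<And>l. l \<in> J \<Longrightarrow> \<exists>b. (\<lambda>k. a (r k) l) \<longlonglongrightarrow> b"
      using function_convergent_subsequence[of J a "sqrt R"] a_abs J(1)
      by (metis countable_finite real_norm_def)
    then show ?thesis using that by metis
  qed
  have "(\<lambda>k. h (a (r k))) \<longlonglongrightarrow> h \<beta>"
    unfolding h_def using mgf_pos[of \<beta>]
    by (intro tendsto_intros mgf_tendsto[where R = "sqrt R"] lim a_abs) auto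
  moreover have "(\<lambda>k. m + 1 / real (Suc (r k))) \<longlonglongrightarrow> m + 0"
    using LIMSEQ_subseq_LIMSEQ[OF LIMSEQ_inverse_real_of_nat r]
    by (intro tendsto_intros) (simp add: o_def inverse_eq_divide)
  ultimately have "h \<beta> \<le> m + 0"
    using a by (intro LIMSEQ_le[where X = "\<lambda>k. h (a (r k))"]) (auto intro: less_imp_le)
  then have min: "h \<beta> \<le> h \<alpha>" for \<alpha> using m_le[of \<alpha>] by simp
  define g where "g \<omega> = exp (\<Sum>l\<in>J. \<beta> l * X 1 \<omega> l)" for \<omega>
  have g_pos: "0 < g \<omega>" for \<omega> by (simp add: g_def)
  have g_int: "integrable N g" "expectation g = mgf \<beta>"
    using exp_moments[of \<beta>] by (simp_all add: g_def[abs_def] mgf_def)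
  \<comment> \<open>Stationarity of \<open>h\<close> at \<open>\<beta>\<close> says that the tilted
    mean minus \<open>v l\<close> plus \<open>2 * \<epsilon> * \<beta> l\<close> vanishes, so this
    is the only candidate for the mean.\<close>
  define w where "w l = v l - 2 * \<epsilon> * \<beta> l" for l
  have gx: "integrable N (\<lambda>\<omega>. g \<omega> * X 1 \<omega> l)" and K: "integrable N (\<lambda>\<omega>. g \<omega> * exp (2 * \<bar>X 1 \<omega> l\<bar>))"
    if l: "l \<in> J" for l
  proof -
    define R where "R = (\<Sum>l\<in>J. \<bar>\<beta> l\<bar>) + 2"
    have bound: "g \<omega> * exp (2 * \<bar>X 1 \<omega> l\<bar>) \<le> exp (R * (\<Sum>l\<in>J. \<bar>X 1 \<omega> l\<bar>))" for \<omega>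
    proof -
      have "\<bar>\<beta> k\<bar> \<le> R - 2" if "k \<in> J" for k
        unfolding R_def using member_le_sum[of k J "\<lambda>l. \<bar>\<beta> l\<bar>"] that J(1) by simp
      then have "(\<Sum>l\<in>J. \<beta> l * X 1 \<omega> l) \<le> (R - 2) * (\<Sum>l\<in>J. \<bar>X 1 \<omega> l\<bar>)"
        by (rule linear_le_abs)
      moreover have "\<bar>X 1 \<omega> l\<bar> \<le> (\<Sum>l\<in>J. \<bar>X 1 \<omega> l\<bar>)"
        using l J(1) by (intro member_le_sum) auto
      ultimately have "(\<Sum>l\<in>J. \<beta> l * X 1 \<omega> l) + 2 * \<bar>X 1 \<omega> l\<bar> \<le> R * (\<Sum>l\<in>J. \<bar>X 1 \<omega> l\<bar>)"
        by (simp add: algebra_simps)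
      then show ?thesis by (simp add: g_def mult_exp_exp)
    qed
    have [measurable]: "(\<lambda>\<omega>. X 1 \<omega> l) \<in> borel_measurable N" "g \<in> borel_measurable N"
      using X1_measurable[OF l] g_int(1) by auto
    show "integrable N (\<lambda>\<omega>. g \<omega> * exp (2 * \<bar>X 1 \<omega> l\<bar>))"
      using bound g_pos by (intro Bochner_Integration.integrable_bound[OF integrable_exp_abs[of R]])
        (auto simp: abs_mult less_imp_le)
    have "y \<le> exp (2 * y)" if "0 \<le> y" for y :: real
      using exp_ge_add_one_self[of "2 * y"] that by linarith
    then have "g \<omega> * \<bar>X 1 \<omega> l\<bar> \<le> g \<omega> * exp (2 * \<bar>X 1 \<omega> l\<bar>)" for \<omega>
      using g_pos[of \<omega>] by (intro mult_left_mono) auto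
    then have "g \<omega> * \<bar>X 1 \<omega> l\<bar> \<le> exp (R * (\<Sum>l\<in>J. \<bar>X 1 \<omega> l\<bar>))" for \<omega>
      using bound[of \<omega>] by (meson order_trans)
    then show "integrable N (\<lambda>\<omega>. g \<omega> * X 1 \<omega> l)"
      using g_pos by (intro Bochner_Integration.integrable_bound[OF integrable_exp_abs[of R]])
        (auto simp: abs_mult less_imp_le)
  qed
  have tilted_mean: "expectation (\<lambda>\<omega>. g \<omega> * X 1 \<omega> l) = mgf \<beta> * w l" if l: "l \<in> J" for l
  proof -
    define \<mu> where "\<mu> = expectation (\<lambda>\<omega>. g \<omega> * X 1 \<omega> l) / mgf \<beta>"
    define C where "C = expectation (\<lambda>\<omega>. g \<omega> * exp (2 * \<bar>X 1 \<omega> l\<bar>)) / mgf \<beta>"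
    \<comment> \<open>Minimality is tested by moving one coordinate by \<open>t\<close>. The bound
      \<open>ln q \<le> q - 1\<close> passes from the moment generating function to its logarithm;
      both signs of \<open>t\<close>, divided by its size and sent to 0, then yield the stationarity
      condition.\<close>
    have step: "0 \<le> t * (\<mu> - w l) + (C + \<epsilon>) * t\<^sup>2" if t: "\<bar>t\<bar> \<le> 1" for t
    proof -
      define \<alpha> where "\<alpha> = \<beta>(l := \<beta> l + t)"
      have sum_upd: "(\<Sum>k\<in>J. f k (\<alpha> k)) = (\<Sum>k\<in>J. f k (\<beta> k)) + (f l (\<beta> l + t) - f l (\<beta> l))"
        for f :: "'i \<Rightarrow> real \<Rightarrow> real"
        using J(1) l by (simp add: \<alpha>_def sum.remove[of J l])
      have lin: "(\<Sum>k\<in>J. \<alpha> k * y k) = (\<Sum>k\<in>J. \<beta> k * y k) + t * y l" for y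
        using sum_upd[of "\<lambda>k z. z * y k"] by (simp add: algebra_simps)
      have sq: "(\<Sum>k\<in>J. (\<alpha> k)\<^sup>2) = (\<Sum>k\<in>J. (\<beta> k)\<^sup>2) + (2 * t * \<beta> l + t\<^sup>2)"
        using sum_upd[of "\<lambda>k z. z\<^sup>2"] by (simp add: power2_eq_square algebra_simps)
      have "mgf \<alpha> \<le> expectation (\<lambda>\<omega>. g \<omega> + t * (g \<omega> * X 1 \<omega> l) + t\<^sup>2 * (g \<omega> * exp (2 * \<bar>X 1 \<omega> l\<bar>)))"
        unfolding mgf_def
      proof (rule integral_mono[OF exp_moments])
        show "integrable N (\<lambda>\<omega>. g \<omega> + t * (g \<omega> * X 1 \<omega> l) + t\<^sup>2 * (g \<omega> * exp (2 * \<bar>X 1 \<omega> l\<bar>)))"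
          using g_int(1) gx[OF l] K[OF l] by simp
        fix \<omega>
        have "exp (\<Sum>l\<in>J. \<alpha> l * X 1 \<omega> l) = g \<omega> * exp (t * X 1 \<omega> l)"
          by (simp add: lin g_def exp_add)
        also have "\<dots> \<le> g \<omega> * (1 + t * X 1 \<omega> l + t\<^sup>2 * exp (2 * \<bar>X 1 \<omega> l\<bar>))"
          using exp_le_quadratic[OF t] g_pos[of \<omega>] by (intro mult_left_mono) auto
        finally show "exp (\<Sum>l\<in>J. \<alpha> l * X 1 \<omega> l) \<le>
            g \<omega> + t * (g \<omega> * X 1 \<omega> l) + t\<^sup>2 * (g \<omega> * exp (2 * \<bar>X 1 \<omega> l\<bar>))"
          by (simp add: algebra_simps)
      qed
      also have "\<dots> = mgf \<beta> * (1 + (t * \<mu> + C * t\<^sup>2))"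
      proof -
        have "expectation (\<lambda>\<omega>. g \<omega> + t * (g \<omega> * X 1 \<omega> l) + t\<^sup>2 * (g \<omega> * exp (2 * \<bar>X 1 \<omega> l\<bar>))) =
            expectation g + t * expectation (\<lambda>\<omega>. g \<omega> * X 1 \<omega> l) +
            t\<^sup>2 * expectation (\<lambda>\<omega>. g \<omega> * exp (2 * \<bar>X 1 \<omega> l\<bar>))"
          using g_int(1) gx[OF l] K[OF l] by simp
        then show ?thesis
          using g_int(2) mgf_pos[of \<beta>] by (simp add: \<mu>_def C_def field_simps)
      qed
      finally have "mgf \<alpha> / mgf \<beta> \<le> 1 + (t * \<mu> + C * t\<^sup>2)"
        using mgf_pos[of \<beta>] by (simp add: field_simps)
      moreover have "1 + ln (mgf \<alpha> / mgf \<beta>) \<le> mgf \<alpha> / mgf \<beta>"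
        using ln_le_minus_one[of "mgf \<alpha> / mgf \<beta>"] mgf_pos[of \<alpha>] mgf_pos[of \<beta>] by simp
      moreover have "ln (mgf \<alpha> / mgf \<beta>) = ln (mgf \<alpha>) - ln (mgf \<beta>)"
        using mgf_pos[of \<alpha>] mgf_pos[of \<beta>] by (simp add: ln_div)
      moreover have "h \<alpha> = h \<beta> + (ln (mgf \<alpha>) - ln (mgf \<beta>)) - t * v l + \<epsilon> * (2 * t * \<beta> l + t\<^sup>2)"
        by (simp add: h_def lin sq algebra_simps)
      ultimately have "0 \<le> (t * \<mu> + C * t\<^sup>2) - t * v l + \<epsilon> * (2 * t * \<beta> l + t\<^sup>2)"
        using min[of \<alpha>] by linarith
      then show ?thesis by (simp add: w_def algebra_simps)
    qed
    have "\<bar>\<mu> - w l\<bar> \<le> (C + \<epsilon>) * t" if t: "0 < t" "t \<le> 1" for t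
    proof -
      have "0 \<le> t * ((\<mu> - w l) + (C + \<epsilon>) * t)" "0 \<le> t * (- (\<mu> - w l) + (C + \<epsilon>) * t)"
        using step[of t] step[of "- t"] t by (simp_all add: power2_eq_square algebra_simps)
      then have "0 \<le> (\<mu> - w l) + (C + \<epsilon>) * t" "0 \<le> - (\<mu> - w l) + (C + \<epsilon>) * t"
        using t(1) by (simp_all only: zero_le_mult_iff) auto
      then show ?thesis by linarith
    qed
    then have "eventually (\<lambda>t. \<bar>\<mu> - w l\<bar> \<le> (C + \<epsilon>) * t) (at_right 0)"
      using eventually_at_right_real[of 0 1] by (auto elim!: eventually_mono)
    moreover have "((\<lambda>t. (C + \<epsilon>) * t) \<longlongrightarrow> (C + \<epsilon>) * 0) (at_right 0)"
      by (intro tendsto_intros)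
    ultimately have "\<bar>\<mu> - w l\<bar> \<le> (C + \<epsilon>) * 0"
      by (intro tendsto_lowerbound) auto
    then show ?thesis using mgf_pos[of \<beta>] by (simp add: \<mu>_def field_simps)
  qed
  \<comment> \<open>Comparison with \<open>h\<close> at the origin, where the moment generating
    function is 1. It gives \<open>\<epsilon> * \<bar>\<beta>\<bar>^2 \<le> I\<close>, and thus a
    displacement \<open>2 * \<epsilon> * \<beta>\<close> of order
    \<open>sqrt \<epsilon>\<close>.\<close>
  have "h \<beta> \<le> 0"
    using min[of "\<lambda>_. 0"] by (simp add: h_def mgf_def prob_space)
  then have sq: "\<epsilon> * (\<Sum>l\<in>J. (\<beta> l)\<^sup>2) \<le> I" using h_lower[of \<beta>] by linarith
  show ?thesis
  proof (rule that[of \<beta> w])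
    fix l assume l: "l \<in> J"
    have "expectation (\<lambda>\<omega>. g \<omega> * X 1 \<omega> l - g \<omega> * w l) = 0"
      using g_int gx[OF l] tilted_mean[OF l] by simp
    then show "expectation (\<lambda>\<omega>. exp (\<Sum>l\<in>J. \<beta> l * X 1 \<omega> l) * (X 1 \<omega> l - w l)) = 0"
      by (simp add: g_def algebra_simps)
    have "(\<beta> l)\<^sup>2 \<le> (\<Sum>l\<in>J. (\<beta> l)\<^sup>2)" using l J(1) by (intro member_le_sum) auto
    then have "\<epsilon> * (\<beta> l)\<^sup>2 \<le> \<epsilon> * (\<Sum>l\<in>J. (\<beta> l)\<^sup>2)" using \<epsilon> by (intro mult_left_mono) auto
    then have "\<epsilon> * (\<beta> l)\<^sup>2 \<le> I" using sq by linarith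
    then have "4 * \<epsilon> * (\<epsilon> * (\<beta> l)\<^sup>2) \<le> 4 * \<epsilon> * I" using \<epsilon> by (intro mult_left_mono) simp_all
    then show "(w l - v l)\<^sup>2 \<le> 4 * \<epsilon> * I"
      by (simp add: w_def power2_eq_square algebra_simps)
  next
    have "(\<Sum>l\<in>J. \<beta> l * w l) = (\<Sum>l\<in>J. \<beta> l * v l) - 2 * (\<epsilon> * (\<Sum>l\<in>J. (\<beta> l)\<^sup>2))"
      by (simp add: w_def sum_subtractf sum_distrib_left power2_eq_square algebra_simps)
    moreover have "0 \<le> \<epsilon> * (\<Sum>l\<in>J. (\<beta> l)\<^sup>2)" using \<epsilon> by (intro mult_nonneg_nonneg sum_nonneg) auto
    ultimately show "(\<Sum>l\<in>J. \<beta> l * w l) - ln (mgf \<beta>) \<le> I" using I[of \<beta>] by linarith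
  qed
qed

theorem cramer_lower_bound:
  assumes I: "\<And>\<alpha>. (\<Sum>l\<in>J. \<alpha> l * v l) - ln (mgf \<alpha>) \<le> I" and \<eta>: "0 < \<eta>" and \<delta>: "0 < \<delta>"
  shows "eventually (\<lambda>n. exp (- real n * (I + \<delta>)) / 2
    \<le> prob {\<omega> \<in> space N. \<forall>l\<in>J. \<bar>(\<Sum>i=1..n. X i \<omega> l) / real n - v l\<bar> < \<eta>}) sequentially"
proof -
  have "0 \<le> I" using I[of "\<lambda>_. 0"] by (simp add: mgf_def prob_space)
  \<comment> \<open>Chosen so that \<open>4 * \<epsilon> * I \<le> (\<eta> / 2)\<^sup>2\<close>,
    which brings \<open>w\<close> within \<open>\<eta> / 2\<close> of \<open>v\<close>; adding 1
    avoids division by zero when \<open>I = 0\<close>.\<close>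
  define \<epsilon> where "\<epsilon> = (\<eta> / 4)\<^sup>2 / (I + 1)"
  have \<epsilon>: "0 < \<epsilon>" "\<epsilon> * I \<le> (\<eta> / 4)\<^sup>2"
  proof -
    show "0 < \<epsilon>" using \<eta> \<open>0 \<le> I\<close> by (simp add: \<epsilon>_def)
    have "\<epsilon> * (I + 1) = (\<eta> / 4)\<^sup>2" using \<open>0 \<le> I\<close> by (simp add: \<epsilon>_def)
    then show "\<epsilon> * I \<le> (\<eta> / 4)\<^sup>2" using \<open>0 < \<epsilon>\<close> by (simp add: algebra_simps)
  qed
  obtain \<beta> w where \<beta>: "\<And>l. l \<in> J \<Longrightarrow>
      expectation (\<lambda>\<omega>. exp (\<Sum>l\<in>J. \<beta> l * X 1 \<omega> l) * (X 1 \<omega> l - w l)) = 0"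
    and cost: "(\<Sum>l\<in>J. \<beta> l * w l) - ln (mgf \<beta>) \<le> I"
    and wv: "\<And>l. l \<in> J \<Longrightarrow> (w l - v l)\<^sup>2 \<le> 4 * \<epsilon> * I"
    using tilt_attaining_near[OF I \<epsilon>(1)] by blast
  have wv': "\<bar>w l - v l\<bar> \<le> \<eta> / 2" if "l \<in> J" for l
  proof -
    have "(w l - v l)\<^sup>2 \<le> (\<eta> / 2)\<^sup>2"
      using wv[OF that] \<epsilon>(2) by (simp add: power2_eq_square)
    then show ?thesis using \<eta> by (metis abs_le_square_iff abs_of_pos half_gt_zero)
  qed
  define s where "s = (\<Sum>l\<in>J. \<bar>\<beta> l\<bar>)"
  have s: "0 \<le> s" by (simp add: s_def sum_nonneg)
  \<comment> \<open>The first bound fits the window around \<open>w\<close> into the window around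
    \<open>v\<close>; the second keeps the extra exponent \<open>\<eta>' * s\<close> below
    \<open>\<delta>\<close>.\<close>
  define \<eta>' where "\<eta>' = min (\<eta> / 2) (\<delta> / (s + 1))"
  have \<eta>': "0 < \<eta>'" "\<eta>' \<le> \<eta> / 2" "\<eta>' * s \<le> \<delta>"
  proof -
    show "0 < \<eta>'" using \<eta> \<delta> s by (auto simp: \<eta>'_def)
    show "\<eta>' \<le> \<eta> / 2" unfolding \<eta>'_def by (rule min.cobounded1)
    have "\<eta>' * s \<le> \<eta>' * (s + 1)" using \<open>0 < \<eta>'\<close> by simp
    also have "\<dots> \<le> \<delta> / (s + 1) * (s + 1)" using s by (intro mult_right_mono) (auto simp: \<eta>'_def)
    finally show "\<eta>' * s \<le> \<delta>" using s by simp
  qed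
  obtain C where C: "\<And>n. 1 \<le> n \<Longrightarrow> (1 - C / real n) *
      exp (- real n * ((\<Sum>l\<in>J. \<beta> l * w l) - ln (mgf \<beta>) + \<eta>' * s))
    \<le> prob {\<omega> \<in> space N. \<forall>l\<in>J. \<bar>(\<Sum>i=1..n. X i \<omega> l) / real n - w l\<bar> < \<eta>'}"
    using tilted_lower_bound[OF \<beta> \<eta>'(1)] unfolding s_def by blast
  have "eventually (\<lambda>n. C / real n < 1 / 2) sequentially"
    by (intro order_tendstoD(2)[OF lim_const_over_n]) simp
  with eventually_ge_at_top[of 1] show ?thesis
  proof eventually_elim
    case (elim n)
    have "exp (- real n * (I + \<delta>)) / 2 = (1 / 2) * exp (- real n * (I + \<delta>))" by simp
    also have "\<dots> \<le> (1 - C / real n) *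
        exp (- real n * ((\<Sum>l\<in>J. \<beta> l * w l) - ln (mgf \<beta>) + \<eta>' * s))"
    proof (intro mult_mono)
      have "real n * ((\<Sum>l\<in>J. \<beta> l * w l) - ln (mgf \<beta>) + \<eta>' * s) \<le> real n * (I + \<delta>)"
        using cost \<eta>'(3) by (intro mult_left_mono) auto
      then show "exp (- real n * (I + \<delta>)) \<le>
          exp (- real n * ((\<Sum>l\<in>J. \<beta> l * w l) - ln (mgf \<beta>) + \<eta>' * s))"
        by simp
    qed (use elim in auto)
    also have "\<dots> \<le> prob {\<omega> \<in> space N. \<forall>l\<in>J. \<bar>(\<Sum>i=1..n. X i \<omega> l) / real n - w l\<bar> < \<eta>'}"
      using C elim by simp
    also have "\<dots> \<le> prob {\<omega> \<in> space N. \<forall>l\<in>J. \<bar>(\<Sum>i=1..n. X i \<omega> l) / real n - v l\<bar> < \<eta>}"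
    proof (rule finite_measure_mono)
      show "{\<omega> \<in> space N. \<forall>l\<in>J. \<bar>(\<Sum>i=1..n. X i \<omega> l) / real n - w l\<bar> < \<eta>'} \<subseteq>
          {\<omega> \<in> space N. \<forall>l\<in>J. \<bar>(\<Sum>i=1..n. X i \<omega> l) / real n - v l\<bar> < \<eta>}"
      proof safe
        fix \<omega> l assume *: "\<forall>l\<in>J. \<bar>(\<Sum>i=1..n. X i \<omega> l) / real n - w l\<bar> < \<eta>'" "l \<in> J"
        then have "\<bar>(\<Sum>i=1..n. X i \<omega> l) / real n - w l\<bar> < \<eta>'" by blast
        then show "\<bar>(\<Sum>i=1..n. X i \<omega> l) / real n - v l\<bar> < \<eta>"
          using wv'[OF *(2)] \<eta>'(2) by linarith
      qed
      have "(\<lambda>\<omega>. (\<Sum>i=1..n. X i \<omega> l) / real n - v l) \<in> borel_measurable N" if "l \<in> J" for l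
        using that J X_coord_measurable
        by (intro borel_measurable_diff borel_measurable_divide borel_measurable_sum) auto
      then show "{\<omega> \<in> space N. \<forall>l\<in>J. \<bar>(\<Sum>i=1..n. X i \<omega> l) / real n - v l\<bar> < \<eta>} \<in> events"
        using J(1) by (intro sets.sets_Collect_finite_All) auto
    qed
    finally show ?case .
  qed
qed

end

section \<open>Large deviations of empirical means of counting paths\<close>

text \<open>The bracket in \<open>rate_I\<close>, with a finite set of times in place of an
  increasing enumeration and with coefficients attached to the times themselves.\<close>

definition cost :: "'b measure \<Rightarrow> ('b \<Rightarrow> real \<Rightarrow> real) \<Rightarrow> real set \<Rightarrow> (real \<Rightarrow> real) \<Rightarrow> (real \<Rightarrow> real) \<Rightarrow> real"
  where "cost N A J \<alpha> \<phi> =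
    (\<Sum>t\<in>J. \<alpha> t * \<phi> t) - ln (\<integral>\<omega>. exp (\<Sum>t\<in>J. \<alpha> t * A \<omega> t) \<partial>N)"

lemma rate_I_le_iff:
  "rate_I N A T \<phi> \<le> a \<longleftrightarrow>
    (\<forall>J \<alpha>. finite J \<and> J \<noteq> {} \<and> J \<subseteq> {0<..T} \<longrightarrow> ereal (cost N A J \<alpha> \<phi>) \<le> a)"
proof
  assume le: "rate_I N A T \<phi> \<le> a"
  show "\<forall>J \<alpha>. finite J \<and> J \<noteq> {} \<and> J \<subseteq> {0<..T} \<longrightarrow> ereal (cost N A J \<alpha> \<phi>) \<le> a"
  proof (intro allI impI)
    fix J and \<alpha> :: "real \<Rightarrow> real" assume J: "finite J \<and> J \<noteq> {} \<and> J \<subseteq> {0<..T}"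
    define m where "m = card J"
    \<comment> \<open>The times in \<open>rate_I\<close> are numbered from 1, the entries of a list
      from 0.\<close>
    define t where "t i = sorted_list_of_set J ! (i - 1)" for i
    have "0 < m" using J by (simp add: m_def card_gt_0_iff)
    then have m: "1 \<le> m" by linarith
    have len: "length (sorted_list_of_set J) = m" by (simp add: m_def)
    have t_in: "t i \<in> J" if "i \<in> {1..m}" for i
    proof -
      have "i - 1 < length (sorted_list_of_set J)" using that len by auto
      then have "t i \<in> set (sorted_list_of_set J)" unfolding t_def by (rule nth_mem)
      then show ?thesis using J by simp
    qed
    have mono: "strict_mono_on {1..m} t"
    proof (rule strict_mono_onI)
      fix i j assume "i \<in> {1..m}" "j \<in> {1..m}" "i < j"
      then show "t i < t j"
        unfolding t_def using strict_sorted_list_of_set[of J] len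
        by (auto simp: sorted_wrt_iff_nth_less)
    qed
    have "t ` {1..m} = J"
    proof (rule card_subset_eq)
      show "card (t ` {1..m}) = card J"
        using card_image[OF strict_mono_on_imp_inj_on[OF mono]] by (simp add: m_def)
    qed (use J t_in in auto)
    then have bij: "bij_betw t {1..m} J"
      using strict_mono_on_imp_inj_on[OF mono] by (simp add: bij_betw_def)
    have sum_eq: "(\<Sum>l=1..m. \<alpha> (t l) * y (t l)) = (\<Sum>l\<in>J. \<alpha> l * y l)" for y
      by (rule sum.reindex_bij_betw[OF bij])
    have mem: "1 \<in> {1..m}" "m \<in> {1..m}" using m by auto
    have "t 1 \<in> {0<..T}" "t m \<in> {0<..T}"
      using t_in[OF mem(1)] t_in[OF mem(2)] J by auto
    then have t: "t \<in> {t. 0 < t 1 \<and> strict_mono_on {1..m} t \<and> t m \<le> T}"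
      using mono by simp
    have "ereal (cost N A J \<alpha> \<phi>) = ereal ((\<Sum>l=1..m. (\<alpha> \<circ> t) l * \<phi> (t l)) -
        ln (\<integral>\<omega>. exp (\<Sum>l=1..m. (\<alpha> \<circ> t) l * A \<omega> (t l)) \<partial>N))"
      by (simp add: cost_def sum_eq)
    also have "\<dots> \<le> rate_I N A T \<phi>"
      unfolding rate_I_def
      by (rule SUP_upper2[of m], use m in simp, rule SUP_upper2[OF t],
          rule SUP_upper2[of "\<alpha> \<circ> t"]) simp_all
    finally show "ereal (cost N A J \<alpha> \<phi>) \<le> a" using le by simp
  qed
next
  assume le: "\<forall>J \<alpha>. finite J \<and> J \<noteq> {} \<and> J \<subseteq> {0<..T} \<longrightarrow> ereal (cost N A J \<alpha> \<phi>) \<le> a"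
  show "rate_I N A T \<phi> \<le> a"
    unfolding rate_I_def
  proof (intro SUP_least)
    fix m :: nat and t \<alpha> :: "nat \<Rightarrow> real"
    assume m: "m \<in> {1..}" and t: "t \<in> {t. 0 < t 1 \<and> strict_mono_on {1..m} t \<and> t m \<le> T}"
    then have mono: "strict_mono_on {1..m} t" by simp
    have inj: "inj_on t {1..m}" using mono by (rule strict_mono_on_imp_inj_on)
    define \<alpha>' where "\<alpha>' = \<alpha> \<circ> the_inv_into {1..m} t"
    have sum_eq: "(\<Sum>l\<in>t ` {1..m}. \<alpha>' l * y l) = (\<Sum>l=1..m. \<alpha> l * y (t l))" for y
      by (simp add: sum.reindex[OF inj] \<alpha>'_def the_inv_into_f_f[OF inj])
    have "t ` {1..m} \<subseteq> {0<..T}"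
    proof
      fix s assume "s \<in> t ` {1..m}"
      then obtain i where i: "i \<in> {1..m}" "s = t i" by blast
      have "t 1 \<le> t i" "t i \<le> t m"
        using strict_mono_on_imp_mono_on[OF mono] i(1) by (auto simp: mono_on_def)
      then show "s \<in> {0<..T}" using t i(2) by auto
    qed
    then have "ereal (cost N A (t ` {1..m}) \<alpha>' \<phi>) \<le> a"
      using le m by auto
    then show "ereal ((\<Sum>l=1..m. \<alpha> l * \<phi> (t l)) - ln (\<integral>\<omega>. exp (\<Sum>l=1..m. \<alpha> l * A \<omega> (t l)) \<partial>N)) \<le> a"
      by (simp add: cost_def sum_eq)
  qed
qed

lemma rate_I_nonneg:
  assumes "prob_space N" "0 < T"
  shows "0 \<le> rate_I N A T \<phi>"
proof -
  interpret prob_space N by fact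
  have "ereal (cost N A {T} (\<lambda>_. 0) \<phi>) \<le> rate_I N A T \<phi>"
    using rate_I_le_iff[of N A T \<phi> "rate_I N A T \<phi>"] assms(2) by simp
  then show ?thesis by (simp add: cost_def prob_space zero_ereal_def)
qed

lemma rate_J_le_iff: "rate_J N A T c x \<le> a \<longleftrightarrow>
    (\<forall>J \<alpha>. finite J \<and> J \<noteq> {} \<and> J \<subseteq> {0<..T} \<longrightarrow> ereal (cost N A J \<alpha> (\<lambda>t. x t + c * t)) \<le> a)"
proof -
  have "cost N A J \<alpha> (\<lambda>t\<in>{0..T}. x t + c * t) = cost N A J \<alpha> (\<lambda>t. x t + c * t)"
    if "J \<subseteq> {0<..T}" for J \<alpha>
  proof -
    have "(\<Sum>t\<in>J. \<alpha> t * (\<lambda>t\<in>{0..T}. x t + c * t) t) = (\<Sum>t\<in>J. \<alpha> t * (x t + c * t))"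
      using that by (intro sum.cong) auto
    then show ?thesis by (simp add: cost_def)
  qed
  then show ?thesis unfolding rate_J_def rate_I_le_iff by auto
qed

lemma restrict_in_D_space:
  assumes "\<And>t. t \<in> {0..<T} \<Longrightarrow> (f \<longlongrightarrow> f t) (at_right t)"
    and "\<And>t. t \<in> {0<..T} \<Longrightarrow> \<exists>l. (f \<longlongrightarrow> l) (at_left t)"
  shows "(\<lambda>t\<in>{0..T}. f t) \<in> D_space T"
proof -
  have "((\<lambda>t\<in>{0..T}. f t) \<longlongrightarrow> (\<lambda>t\<in>{0..T}. f t) t) (at_right t)" if t: "t \<in> {0..<T}" for t
  proof -
    have "eventually (\<lambda>s. s \<in> {t<..<T}) (at_right t)"
      using t by (intro eventually_at_right_real) auto
    then have "eventually (\<lambda>s. f s = (\<lambda>t\<in>{0..T}. f t) s) (at_right t)"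
      by eventually_elim (use t in auto)
    then have "((\<lambda>t\<in>{0..T}. f t) \<longlongrightarrow> f t) (at_right t)"
      by (rule Lim_transform_eventually[OF assms(1)[OF t]])
    then show ?thesis using t by simp
  qed
  moreover have "\<exists>l. ((\<lambda>t\<in>{0..T}. f t) \<longlongrightarrow> l) (at_left t)" if t: "t \<in> {0<..T}" for t
  proof -
    have "eventually (\<lambda>s. s \<in> {0<..<t}) (at_left t)"
      using t by (intro eventually_at_left_real) auto
    then have "eventually (\<lambda>s. f s = (\<lambda>t\<in>{0..T}. f t) s) (at_left t)"
      by eventually_elim (use t in auto)
    then show ?thesis
      using assms(2)[OF t] Lim_transform_eventually by blast
  qed
  ultimately show ?thesis unfolding D_space_def by blast
qed

lemma D_space_right: "x \<in> D_space T \<Longrightarrow> t \<in> {0..<T} \<Longrightarrow> (x \<longlongrightarrow> x t) (at_right t)"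
  unfolding D_space_def by blast

lemma D_space_left: "x \<in> D_space T \<Longrightarrow> t \<in> {0<..T} \<Longrightarrow> \<exists>l. (x \<longlongrightarrow> l) (at_left t)"
  unfolding D_space_def by blast

lemma rate_J_nonneg: "prob_space N \<Longrightarrow> 0 < T \<Longrightarrow> 0 \<le> rate_J N A T c x"
  unfolding rate_J_def by (rule rate_I_nonneg)

lemma cost_tendsto:
  assumes "\<And>t. t \<in> J \<Longrightarrow> (\<lambda>k. \<phi> k t) \<longlonglongrightarrow> \<psi> t"
  shows "(\<lambda>k. cost N A J \<alpha> (\<phi> k)) \<longlonglongrightarrow> cost N A J \<alpha> \<psi>"
  unfolding cost_def using assms by (intro tendsto_intros)

lemma ereal_le_uminusI:
  fixes l z :: ereal
  assumes "\<And>a. ereal a < z \<Longrightarrow> l \<le> - ereal a"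
  shows "l \<le> - z"
proof (rule ccontr)
  assume "\<not> l \<le> - z"
  then have "- l < z" by (cases l; cases z) auto
  then obtain a where a: "- l < ereal a" "ereal a < z" using ereal_dense2 by blast
  from assms[OF a(2)] a(1) show False by (cases l) auto
qed

lemma ereal_uminus_leI:
  fixes l :: ereal
  assumes "\<And>\<delta>. 0 < \<delta> \<Longrightarrow> - ereal (I + \<delta>) \<le> l"
  shows "- l \<le> ereal I"
proof (cases l)
  case (real r)
  have "- r \<le> I + \<delta>" if "0 < \<delta>" for \<delta>
    using assms[OF that] real by simp
  then have "- r \<le> I" by (rule field_le_epsilon)
  then show ?thesis using real by simp
next
  case MInf
  then show ?thesis using assms[of 1] by simp
qed simp

section \<open>Random monotone paths with controlled increments\<close>

text \<open>What the large deviation argument uses of the arrivals: facts about one or two fixed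
  times of a single copy, each of which passes through equality of laws. \<open>incr_mgf\<close> is
  the moment bound of a Poisson process with intensity \<open>L\<close>.\<close>

locale iid_paths = iid_fields N "{0..T}" X for N :: "'b measure" and T :: real and X +
  fixes L c :: real
  assumes T_pos: "0 < T" and L_nonneg: "0 \<le> L"
    and paths: "1 \<le> i \<Longrightarrow> \<omega> \<in> space N \<Longrightarrow> X i \<omega> \<in> D_space T"
    and start: "AE \<omega> in N. X 1 \<omega> 0 = 0"
    and incr: "0 \<le> s \<Longrightarrow> s \<le> t \<Longrightarrow> t \<le> T \<Longrightarrow> AE \<omega> in N. X 1 \<omega> s \<le> X 1 \<omega> t"
    and incr_moments: "0 \<le> s \<Longrightarrow> s \<le> t \<Longrightarrow> t \<le> T \<Longrightarrow> 0 \<le> \<theta> \<Longrightarrow>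
      integrable N (\<lambda>\<omega>. exp (\<theta> * (X 1 \<omega> t - X 1 \<omega> s)))"
    and incr_mgf: "0 \<le> s \<Longrightarrow> s \<le> t \<Longrightarrow> t \<le> T \<Longrightarrow> 0 \<le> \<theta> \<Longrightarrow>
      expectation (\<lambda>\<omega>. exp (\<theta> * (X 1 \<omega> t - X 1 \<omega> s))) \<le> exp ((exp \<theta> - 1) * L * (t - s))"
begin

text \<open>Almost surely \<open>0 \<le> X 1 \<omega> l \<le> X 1 \<omega> T\<close>, so any linear
  form, whatever the signs of its coefficients, is at most the sum of their absolute values times
  the final value.\<close>

lemma sample_vectors:
  assumes J: "finite J" "J \<subseteq> {0..T}"
  shows "iid_vectors N {0..T} X J"
proof unfold_locales
  fix \<alpha> :: "real \<Rightarrow> real"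
  have [measurable]: "(\<lambda>\<omega>. X 1 \<omega> l) \<in> borel_measurable N" if "l \<in> J" for l
    using X_coord_measurable[of 1 l] that J by auto
  define a where "a = (\<Sum>l\<in>J. \<bar>\<alpha> l\<bar>)"
  have a: "0 \<le> a" by (simp add: a_def sum_nonneg)
  show "integrable N (\<lambda>\<omega>. exp (\<Sum>l\<in>J. \<alpha> l * X 1 \<omega> l))"
  proof (rule Bochner_Integration.integrable_bound)
    show "integrable N (\<lambda>\<omega>. exp (a * (X 1 \<omega> T - X 1 \<omega> 0)))"
      using T_pos a by (intro incr_moments) auto
    have "AE \<omega> in N. \<forall>l\<in>J. X 1 \<omega> 0 \<le> X 1 \<omega> l \<and> X 1 \<omega> l \<le> X 1 \<omega> T"
    proof (rule AE_finite_allI[OF J(1)])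
      fix l assume "l \<in> J"
      then have "l \<in> {0..T}" using J(2) by blast
      then show "AE \<omega> in N. X 1 \<omega> 0 \<le> X 1 \<omega> l \<and> X 1 \<omega> l \<le> X 1 \<omega> T"
        using incr[of 0 l] incr[of l T] by simp
    qed
    then show "AE \<omega> in N. norm (exp (\<Sum>l\<in>J. \<alpha> l * X 1 \<omega> l)) \<le>
        norm (exp (a * (X 1 \<omega> T - X 1 \<omega> 0)))"
      using start
    proof eventually_elim
      case (elim \<omega>)
      have "(\<Sum>l\<in>J. \<alpha> l * X 1 \<omega> l) \<le> (\<Sum>l\<in>J. \<bar>\<alpha> l\<bar> * X 1 \<omega> T)"
      proof (rule sum_mono)
        fix l assume l: "l \<in> J"
        have "\<alpha> l * X 1 \<omega> l \<le> \<bar>\<alpha> l\<bar> * X 1 \<omega> l"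
          using elim l by (intro mult_right_mono) auto
        also have "\<dots> \<le> \<bar>\<alpha> l\<bar> * X 1 \<omega> T"
          using elim l by (intro mult_left_mono) auto
        finally show "\<alpha> l * X 1 \<omega> l \<le> \<bar>\<alpha> l\<bar> * X 1 \<omega> T" .
      qed
      then show ?case using elim by (simp add: a_def sum_distrib_right)
    qed
  qed (use J(1) in measurable)
qed (use J in auto)

lemma cost_mgf: "finite J \<Longrightarrow> J \<subseteq> {0..T} \<Longrightarrow>
  cost N (X 1) J \<alpha> \<phi> = (\<Sum>t\<in>J. \<alpha> t * \<phi> t) - ln (iid_vectors.mgf N X J \<alpha>)"
  by (simp add: cost_def iid_vectors.mgf_def[OF sample_vectors])

abbreviation mean_path :: "nat \<Rightarrow> 'b \<Rightarrow> real \<Rightarrow> real" where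
  "mean_path n \<omega> t \<equiv> (1 / real n) * (\<Sum>i=1..n. X i \<omega> t)"

section \<open>Almost sure monotonicity of the sample paths\<close>

definition arrival_path :: "(real \<Rightarrow> real) \<Rightarrow> bool" where
  "arrival_path \<phi> \<longleftrightarrow> \<phi> 0 = 0 \<and> mono_on {0..T} \<phi>"

lemma AE_law:
  assumes "1 \<le> i" "Measurable.pred (Pi\<^sub>M {0..T} (\<lambda>_. borel)) P"
  shows "(AE \<omega> in N. P (X i \<omega>)) \<longleftrightarrow> (AE \<omega> in N. P (X 1 \<omega>))"
proof -
  have P: "{x \<in> space (Pi\<^sub>M {0..T} (\<lambda>_. borel)). P x} \<in> sets (Pi\<^sub>M {0..T} (\<lambda>_. borel))"
    using assms(2) by (simp add: pred_def)
  have "(AE \<omega> in N. P (X i \<omega>)) \<longleftrightarrow> (AE x in distr N (Pi\<^sub>M {0..T} (\<lambda>_. borel)) (X i). P x)"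
    by (rule AE_distr_iff[OF X_measurable[OF assms(1)] P, symmetric])
  also have "\<dots> \<longleftrightarrow> (AE x in distr N (Pi\<^sub>M {0..T} (\<lambda>_. borel)) (X 1). P x)"
    by (simp only: same_law[OF assms(1)])
  also have "\<dots> \<longleftrightarrow> (AE \<omega> in N. P (X 1 \<omega>))"
    by (rule AE_distr_iff[OF X_measurable[OF order.refl] P])
  finally show ?thesis .
qed

lemma mono_on_from_dense:
  assumes x: "x \<in> D_space T"
    and dense: "\<And>s t. s \<in> {0..T} \<Longrightarrow> t \<in> {0..T} \<Longrightarrow> s \<in> \<rat> \<Longrightarrow> t \<in> \<rat> \<union> {T} \<Longrightarrow> s \<le> t \<Longrightarrow> x s \<le> x t"
  shows "mono_on {0..T} x"
proof (rule mono_onI, rule ccontr)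
  fix s t assume st: "s \<in> {0..T}" "t \<in> {0..T}" "s \<le> t" "\<not> x s \<le> x t"
  then have less: "s < t" "s < T" by (cases "s = t"; auto)+
  define m where "m = (x s + x t) / 2"
  have m: "x t < m" "m < x s" using st(4) by (auto simp: m_def)
  have near: "\<exists>q\<in>\<rat> \<union> {T}. u \<le> q \<and> q \<le> T \<and> q < b \<and> P (x q)"
    if u: "u \<in> {0..T}" "u < b" "open (Collect P)" "P (x u)" for u b and P :: "real \<Rightarrow> bool"
  proof (cases "u = T")
    case True
    then show ?thesis using u by (intro bexI[of _ T]) auto
  next
    case False
    then have "(x \<longlongrightarrow> x u) (at_right u)" using x u by (simp add: D_space_def)
    then have "eventually (\<lambda>q. P (x q)) (at_right u)"
      using topological_tendstoD[OF _ u(3)] u(4) by fastforce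
    then obtain d where d: "u < d" "\<And>q. u < q \<Longrightarrow> q < d \<Longrightarrow> P (x q)"
      by (auto simp: eventually_at_right_field)
    have "u < min d (min b T)" using d u False by auto
    then obtain q where "q \<in> \<rat>" "u < q" "q < min d (min b T)"
      using Rats_dense_in_real by blast
    then show ?thesis using d(2)[of q] by (intro bexI[of _ q]) auto
  qed
  obtain p where p: "p \<in> \<rat> \<union> {T}" "s \<le> p" "p \<le> T" "p < t" "m < x p"
    using near[of s t "\<lambda>y. m < y"] st less m by (auto simp: open_Collect_less)
  obtain q where q: "q \<in> \<rat> \<union> {T}" "t \<le> q" "q \<le> T" "x q < m"
    using near[of t "t + 1" "\<lambda>y. y < m"] st m by (auto simp: open_Collect_less)
  have "x p \<le> x q" using p q st by (intro dense) auto
  then show False using p q by simp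
qed

text \<open>Monotonicity concerns uncountably many coordinates, so it is not transferred through the
  law as a whole. Each pair of times is transferred separately, and countably many pairs
  suffice.\<close>

lemma AE_arrival_path:
  assumes i: "1 \<le> i" shows "AE \<omega> in N. arrival_path (X i \<omega>)"
proof -
  have coord: "(\<lambda>x. x t) \<in> borel_measurable (Pi\<^sub>M {0..T} (\<lambda>_. borel :: real measure))" if "t \<in> {0..T}" for t
    using that by (rule measurable_component_singleton)
  have 0: "AE \<omega> in N. X i \<omega> 0 = 0"
    using AE_law[OF i, of "\<lambda>x. x 0 = 0"] start coord[of 0] T_pos by simp
  have "AE \<omega> in N. X i \<omega> s \<le> X i \<omega> t" if "s \<in> {0..T}" "t \<in> {0..T}" "s \<le> t" for s t
  proof -
    have "Measurable.pred (Pi\<^sub>M {0..T} (\<lambda>_. borel)) (\<lambda>x. x s \<le> (x t :: real))"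
      unfolding pred_def by (rule borel_measurable_le[OF coord[OF that(1)] coord[OF that(2)]])
    from AE_law[OF i this] show ?thesis using incr[of s t] that by simp
  qed
  then have "AE \<omega> in N. \<forall>s\<in>{0..T} \<inter> \<rat>. \<forall>t\<in>{0..T} \<inter> (\<rat> \<union> {T}). s \<le> t \<longrightarrow> X i \<omega> s \<le> X i \<omega> t"
    using countable_rat by (intro AE_ball_countable[THEN iffD2] ballI) auto
  with 0 AE_space show ?thesis
  proof eventually_elim
    case (elim \<omega>)
    have "mono_on {0..T} (X i \<omega>)"
      using elim by (intro mono_on_from_dense paths i) auto
    then show ?case using elim by (simp add: arrival_path_def)
  qed
qed

lemma AE_arrival_path_mean: "AE \<omega> in N. arrival_path (mean_path n \<omega>)"
proof -
  have "AE \<omega> in N. \<forall>i\<in>{1..n}. arrival_path (X i \<omega>)"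
    by (intro AE_finite_allI AE_arrival_path) auto
  then show ?thesis
  proof eventually_elim
    case (elim \<omega>)
    then show ?case
      by (auto simp: arrival_path_def mono_on_def intro!: divide_right_mono sum_mono)
  qed
qed

text \<open>Finite cost against all the functionals \<open>\<theta>(\<phi> t - \<phi> s)\<close> forces the regularity of \<open>\<phi>\<close>.\<close>

lemma cost_bounded_regular:
  assumes cost: "\<And>J \<alpha>. finite J \<Longrightarrow> J \<noteq> {} \<Longrightarrow> J \<subseteq> {0<..T} \<Longrightarrow> cost N (X 1) J \<alpha> \<phi> \<le> a"
    and lim: "(\<phi> \<longlongrightarrow> \<phi> 0) (at_right 0)"
  shows "arrival_path \<phi>"
    and "\<And>s t \<theta>. 0 \<le> s \<Longrightarrow> s \<le> t \<Longrightarrow> t \<le> T \<Longrightarrow> 0 \<le> \<theta> \<Longrightarrow>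
      \<theta> * (\<phi> t - \<phi> s) \<le> a + (exp \<theta> - 1) * L * (t - s)"
proof -
  have a: "0 \<le> a"
    using cost[of "{T}" "\<lambda>_. 0"] T_pos by (simp add: cost_def prob_space)
  \<comment> \<open>Costs are evaluated at times in \<open>(0,T]\<close> and do not see
    \<open>\<phi> 0\<close>. It is replaced by the value 0 that \<open>X 1\<close> takes at time 0;
    right-continuity identifies the two afterwards.\<close>
  define \<phi>' where "\<phi>' t = (if t = 0 then 0 else \<phi> t)" for t
  have ln_neg: "ln (expectation (\<lambda>\<omega>. exp (\<theta> * (X 1 \<omega> t - X 1 \<omega> s)))) \<le> 0"
    if "0 \<le> s" "s \<le> t" "t \<le> T" "\<theta> \<le> 0" for s t \<theta>
  proof -
    have "expectation (\<lambda>\<omega>. exp (\<theta> * (X 1 \<omega> t - X 1 \<omega> s))) \<le> 1"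
    proof (rule integral_le_const)
      have le: "AE \<omega> in N. exp (\<theta> * (X 1 \<omega> t - X 1 \<omega> s)) \<le> 1"
        using incr[OF that(1-3)] by eventually_elim (use that(4) in \<open>simp add: mult_nonpos_nonneg\<close>)
      then show "AE \<omega> in N. exp (\<theta> * (X 1 \<omega> t - X 1 \<omega> s)) \<le> 1" .
      have "(\<lambda>\<omega>. X 1 \<omega> t) \<in> borel_measurable N" "(\<lambda>\<omega>. X 1 \<omega> s) \<in> borel_measurable N"
        using that by (auto intro!: X_coord_measurable)
      then show "integrable N (\<lambda>\<omega>. exp (\<theta> * (X 1 \<omega> t - X 1 \<omega> s)))"
        using le by (intro integrable_const_bound[where B = 1]) auto
    qed
    moreover have "0 \<le> expectation (\<lambda>\<omega>. exp (\<theta> * (X 1 \<omega> t - X 1 \<omega> s)))"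
      by (rule integral_nonneg_AE) simp
    moreover have "ln q \<le> 0" if "0 \<le> q" "q \<le> 1" for q :: real
      using that by (cases "q = 0") simp_all
    ultimately show ?thesis by blast
  qed
  have ln_pos: "ln (expectation (\<lambda>\<omega>. exp (\<theta> * (X 1 \<omega> t - X 1 \<omega> s)))) \<le> (exp \<theta> - 1) * L * (t - s)"
    if "0 \<le> s" "s \<le> t" "t \<le> T" "0 \<le> \<theta>" for s t \<theta>
  proof -
    have "0 < expectation (\<lambda>\<omega>. exp (\<theta> * (X 1 \<omega> t - X 1 \<omega> s)))"
      by (rule expectation_greater[OF incr_moments[OF that]]) simp
    then have "ln (expectation (\<lambda>\<omega>. exp (\<theta> * (X 1 \<omega> t - X 1 \<omega> s)))) \<le>
        ln (exp ((exp \<theta> - 1) * L * (t - s)))"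
      using incr_mgf[OF that] by (subst ln_le_cancel_iff) auto
    then show ?thesis by simp
  qed
  \<comment> \<open>Coefficients \<open>\<theta>\<close> at \<open>t\<close> and
    \<open>- \<theta>\<close> at \<open>s\<close> produce the increment. For \<open>s = 0\<close>,
    which may not be sampled, the single time \<open>t\<close> does the same because
    \<open>X 1\<close> starts at 0 almost surely.\<close>
  have key: "\<theta> * (\<phi>' t - \<phi>' s) - ln (expectation (\<lambda>\<omega>. exp (\<theta> * (X 1 \<omega> t - X 1 \<omega> s)))) \<le> a"
    if st: "0 \<le> s" "s < t" "t \<le> T" for s t \<theta>
  proof (cases "s = 0")
    case False
    have *: "(\<Sum>l\<in>{s, t}. (if l = t then \<theta> else - \<theta>) * y l) = \<theta> * (y t - y s)" for y
      using st(2) by (simp add: algebra_simps)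
    show ?thesis
      using cost[of "{s, t}" "\<lambda>l. if l = t then \<theta> else - \<theta>"] st False
      unfolding cost_def * by (simp add: \<phi>'_def)
  next
    case True
    have "expectation (\<lambda>\<omega>. exp (\<theta> * (X 1 \<omega> t - X 1 \<omega> 0))) = expectation (\<lambda>\<omega>. exp (\<theta> * X 1 \<omega> t))"
    proof (rule integral_cong_AE)
      show "AE \<omega> in N. exp (\<theta> * (X 1 \<omega> t - X 1 \<omega> 0)) = exp (\<theta> * X 1 \<omega> t)"
        using start by eventually_elim simp
      have "(\<lambda>\<omega>. X 1 \<omega> t) \<in> borel_measurable N" "(\<lambda>\<omega>. X 1 \<omega> 0) \<in> borel_measurable N"
        using st by (auto intro!: X_coord_measurable)
      then show "(\<lambda>\<omega>. exp (\<theta> * (X 1 \<omega> t - X 1 \<omega> 0))) \<in> borel_measurable N"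
        "(\<lambda>\<omega>. exp (\<theta> * X 1 \<omega> t)) \<in> borel_measurable N" by auto
    qed
    then show ?thesis
      using cost[of "{t}" "\<lambda>_. \<theta>"] st True by (simp add: cost_def \<phi>'_def)
  qed
  have bound: "\<theta> * (\<phi>' t - \<phi>' s) \<le> a + (exp \<theta> - 1) * L * (t - s)"
    if "0 \<le> s" "s \<le> t" "t \<le> T" "0 \<le> \<theta>" for s t \<theta>
    using key[of s t \<theta>] ln_pos[of s t \<theta>] that a by (cases "s = t") auto
  have mono: "\<phi>' s \<le> \<phi>' t" if "0 \<le> s" "s \<le> t" "t \<le> T" for s t
  proof (rule ccontr)
    assume *: "\<not> \<phi>' s \<le> \<phi>' t"
    then have "s < t" using that by (cases "s = t") auto
    \<comment> \<open>A decrease of \<open>\<phi>'\<close> could be charged with a negative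
      \<open>\<theta>\<close> making the linear term \<open>a + 1\<close>, while the logarithm for a
      nondecreasing increment is at most 0; this exceeds the cost bound.\<close>
    define \<theta> where "\<theta> = - (a + 1) / (\<phi>' s - \<phi>' t)"
    have "\<theta> * (\<phi>' t - \<phi>' s) = a + 1" using * by (simp add: \<theta>_def field_simps)
    moreover have "\<theta> \<le> 0" using * a by (simp add: \<theta>_def divide_nonpos_pos)
    ultimately show False
      using key[OF that(1) \<open>s < t\<close> that(3), of \<theta>] ln_neg[OF that, of \<theta>] by linarith
  qed
  have "\<phi> 0 = 0"
  proof -
    have lim': "(\<phi>' \<longlongrightarrow> \<phi> 0) (at_right 0)"
      using lim by (rule Lim_transform_eventually) (simp add: \<phi>'_def eventually_at_right_less[THEN eventually_mono])
    have ev: "eventually (\<lambda>t. t \<in> {0<..<T}) (at_right 0)"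
      using T_pos by (rule eventually_at_right_real)
    have "0 \<le> \<phi> 0"
      using lim' by (rule tendsto_lowerbound)
        (use ev in \<open>auto elim!: eventually_mono simp: \<phi>'_def dest!: mono[of 0, OF order.refl less_imp_le less_imp_le]\<close>)
    moreover have "\<phi> 0 \<le> 0"
    proof (rule ccontr)
      assume "\<not> \<phi> 0 \<le> 0"
      \<comment> \<open>Again the linear term is made \<open>a + 1\<close>, now in the limit
        \<open>t\<close> to 0, where the allowance \<open>(exp \<theta> - 1) * L * t\<close>
        disappears.\<close>
      define \<theta> where "\<theta> = (a + 1) / \<phi> 0"
      have \<theta>: "0 \<le> \<theta>" "\<theta> * \<phi> 0 = a + 1" using \<open>\<not> \<phi> 0 \<le> 0\<close> a by (auto simp: \<theta>_def)
      have "((\<lambda>t. a + (exp \<theta> - 1) * L * (t - 0) - \<theta> * \<phi>' t) \<longlongrightarrow>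
          a + (exp \<theta> - 1) * L * (0 - 0) - \<theta> * \<phi> 0) (at_right 0)"
        by (intro tendsto_intros lim')
      moreover have "eventually (\<lambda>t. 0 \<le> a + (exp \<theta> - 1) * L * (t - 0) - \<theta> * \<phi>' t) (at_right 0)"
        using ev
      proof eventually_elim
        case (elim t)
        then show ?case using bound[of 0 t \<theta>] \<theta>(1) by (simp add: \<phi>'_def)
      qed
      ultimately have "0 \<le> a + (exp \<theta> - 1) * L * (0 - 0) - \<theta> * \<phi> 0"
        by (intro tendsto_lowerbound) auto
      then show False using \<theta>(2) by simp
    qed
    ultimately show ?thesis by simp
  qed
  then have eq: "\<phi>' = \<phi>" by (auto simp: \<phi>'_def)
  show "arrival_path \<phi>"
    using mono \<open>\<phi> 0 = 0\<close> by (auto simp: arrival_path_def mono_on_def eq)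
  show "\<theta> * (\<phi> t - \<phi> s) \<le> a + (exp \<theta> - 1) * L * (t - s)"
    if "0 \<le> s" "s \<le> t" "t \<le> T" "0 \<le> \<theta>" for s t \<theta>
    using bound[OF that] by (simp add: eq)
qed

text \<open>The modulus of continuity is controlled by choosing first \<open>\<theta>\<close> large and then the mesh small.\<close>

lemma superexponential_scale:
  assumes "0 < e"
  obtains \<theta> d where "0 < \<theta>" "0 < d" "a + (exp \<theta> - 1) * L * d \<le> \<theta> * e"
proof -
  define \<theta> where "\<theta> = (\<bar>a\<bar> + 1) / e"
  \<comment> \<open>\<open>\<theta> * e\<close> exceeds \<open>\<bar>a\<bar>\<close> by exactly 1,
    which is left for the term containing \<open>d\<close>. The added 1 in the denominator keeps it
    positive when \<open>L = 0\<close>.\<close>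
  define d where "d = 1 / ((exp \<theta> - 1) * L + 1)"
  have \<theta>: "0 < \<theta>" "\<theta> * e = \<bar>a\<bar> + 1" using assms by (auto simp: \<theta>_def)
  have "0 \<le> (exp \<theta> - 1) * L" using \<theta> L_nonneg by simp
  then have "0 < d" "(exp \<theta> - 1) * L * d \<le> 1" by (auto simp: d_def)
  then show ?thesis using \<theta> by (intro that[of \<theta> d]) auto
qed

text \<open>\<open>d\<close> is chosen before \<open>\<phi>\<close>, so a whole level set shares one
  modulus of continuity.\<close>

lemma cost_bounded_modulus:
  assumes "0 < e"
  obtains d where "0 < d" "\<And>\<phi> s t.
    (\<And>J \<alpha>. finite J \<Longrightarrow> J \<noteq> {} \<Longrightarrow> J \<subseteq> {0<..T} \<Longrightarrow> cost N (X 1) J \<alpha> \<phi> \<le> a) \<Longrightarrow>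
    (\<phi> \<longlongrightarrow> \<phi> 0) (at_right 0) \<Longrightarrow> s \<in> {0..T} \<Longrightarrow> t \<in> {0..T} \<Longrightarrow> s \<le> t \<Longrightarrow> t \<le> s + d \<Longrightarrow>
    \<phi> t - \<phi> s \<le> e"
proof -
  obtain \<theta> d where \<theta>: "0 < \<theta>" and d: "0 < d" and le: "a + (exp \<theta> - 1) * L * d \<le> \<theta> * e"
    using superexponential_scale[OF assms] .
  show ?thesis
  proof (rule that[OF d])
    fix \<phi> s t
    assume *: "\<And>J \<alpha>. finite J \<Longrightarrow> J \<noteq> {} \<Longrightarrow> J \<subseteq> {0<..T} \<Longrightarrow> cost N (X 1) J \<alpha> \<phi> \<le> a"
      "(\<phi> \<longlongrightarrow> \<phi> 0) (at_right 0)"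
    and st: "s \<in> {0..T}" "t \<in> {0..T}" "s \<le> t" "t \<le> s + d"
    have "\<theta> * (\<phi> t - \<phi> s) \<le> a + (exp \<theta> - 1) * L * (t - s)"
      using cost_bounded_regular(2)[OF *] st \<theta> by simp
    also have "\<dots> \<le> a + (exp \<theta> - 1) * L * d"
      using \<theta> L_nonneg st(4) by (intro add_left_mono mult_left_mono) auto
    also note le
    finally show "\<phi> t - \<phi> s \<le> e" using \<theta> by simp
  qed
qed

text \<open>Finitely many overlapping windows receive a Chernoff bound each, and monotonicity
  carries the bound to all pairs of times inside a window. The exceptional set \<open>E\<close> is
  the union of these finitely many events rather than the failure of the modulus condition itself,
  so its measurability is immediate.\<close>

lemma modulus_probability:
  assumes "0 < e"
  obtains d C where "0 < d" "\<And>n. 1 \<le> n \<Longrightarrow> \<exists>E\<in>events. prob E \<le> C * exp (- (real n * a)) \<and>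
    (\<forall>\<omega>\<in>space N - E. arrival_path (mean_path n \<omega>) \<longrightarrow> (\<forall>s\<in>{0..T}. \<forall>t\<in>{0..T}.
      s \<le> t \<and> t \<le> s + d \<longrightarrow> mean_path n \<omega> t - mean_path n \<omega> s \<le> e))"
proof -
  obtain \<theta> d where \<theta>: "0 < \<theta>" and d: "0 < d" and le: "a + (exp \<theta> - 1) * L * d \<le> \<theta> * e"
    using superexponential_scale[OF assms] .
  obtain p :: nat where p: "2 * T / d < real p" using reals_Archimedean2 by blast
  have "0 < real p" using p T_pos d by (meson divide_pos_pos less_trans mult_pos_pos zero_less_numeral)
  define h where "h = T / real p"
  have h: "0 < h" "2 * h \<le> d" using p T_pos d \<open>0 < real p\<close> by (auto simp: h_def field_simps)
  define u where "u j = real j * h" for j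
  \<comment> \<open>A window spans two cells: if \<open>s\<close> lies in cell \<open>j\<close>,
    then every \<open>t \<le> s + h\<close> is reached before time \<open>(j + 2) * h\<close>. Hence
    \<open>2 * h \<le> d\<close> is needed for the Chernoff bound, while \<open>h\<close> is the
    modulus obtained.\<close>
  define v where "v j = min T ((real j + 2) * h)" for j
  have uv: "0 \<le> u j" "u j \<le> v j" "v j \<le> T" "v j - u j \<le> d" if "j \<le> p" for j
  proof -
    have "real j * h \<le> real p * h" using that h by (intro mult_right_mono) auto
    then have "u j \<le> T" using \<open>0 < real p\<close> by (simp add: u_def h_def)
    then show "u j \<le> v j" using h by (simp add: u_def v_def algebra_simps)
    have "v j - u j \<le> 2 * h" by (simp add: u_def v_def algebra_simps min_def)
    then show "v j - u j \<le> d" using h by simp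
  qed (use h in \<open>simp_all add: u_def v_def\<close>)
  define g where "g j x = \<theta> * (x (v j) - x (u j))" for j and x :: "real \<Rightarrow> real"
  have small: "prob {\<omega> \<in> space N. real n * (\<theta> * e) \<le> (\<Sum>i=1..n. g j (X i \<omega>))} \<le> exp (- (real n * a))"
    if j: "j \<le> p" for j n
  proof -
    have "(\<lambda>x. x (u j)) \<in> borel_measurable (Pi\<^sub>M {0..T} (\<lambda>_. borel :: real measure))"
      "(\<lambda>x. x (v j)) \<in> borel_measurable (Pi\<^sub>M {0..T} (\<lambda>_. borel :: real measure))"
      using uv[OF j] by (auto intro!: measurable_component_singleton)
    then have "g j \<in> borel_measurable (Pi\<^sub>M {0..T} (\<lambda>_. borel))"
      unfolding g_def by measurable
    moreover have "integrable N (\<lambda>\<omega>. exp (g j (X 1 \<omega>)))"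
      unfolding g_def using uv[OF j] \<theta> by (intro incr_moments) auto
    ultimately have "prob {\<omega> \<in> space N. real n * (\<theta> * e) \<le> (\<Sum>i=1..n. g j (X i \<omega>))} \<le>
        exp (- (real n * (\<theta> * e))) * expectation (\<lambda>\<omega>. exp (g j (X 1 \<omega>))) ^ n"
      by (rule chernoff)
    also have "\<dots> \<le> exp (- (real n * (\<theta> * e))) * exp ((exp \<theta> - 1) * L * d) ^ n"
    proof (intro mult_left_mono power_mono)
      have "expectation (\<lambda>\<omega>. exp (g j (X 1 \<omega>))) \<le> exp ((exp \<theta> - 1) * L * (v j - u j))"
        unfolding g_def using uv[OF j] \<theta> by (intro incr_mgf) auto
      also have "\<dots> \<le> exp ((exp \<theta> - 1) * L * d)"
        using uv[OF j] \<theta> L_nonneg by (intro exp_le_cancel_iff[THEN iffD2] mult_left_mono) auto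
      finally show "expectation (\<lambda>\<omega>. exp (g j (X 1 \<omega>))) \<le> exp ((exp \<theta> - 1) * L * d)" .
    qed (auto intro!: integral_nonneg_AE)
    also have "\<dots> = exp (- (real n * (\<theta> * e - (exp \<theta> - 1) * L * d)))"
      by (simp add: mult_exp_exp algebra_simps flip: exp_of_nat_mult)
    also have "\<dots> \<le> exp (- (real n * a))"
    proof -
      have "real n * a \<le> real n * (\<theta> * e - (exp \<theta> - 1) * L * d)"
        using le by (intro mult_left_mono) auto
      then show ?thesis by simp
    qed
    finally show ?thesis .
  qed
  show ?thesis
  proof (rule that[OF h(1)])
    fix n :: nat assume n: "1 \<le> n"
    define F where "F j = {\<omega> \<in> space N. real n * (\<theta> * e) \<le> (\<Sum>i=1..n. g j (X i \<omega>))}" for j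
    have F: "F j \<in> events" if "j \<le> p" for j
    proof -
      have "(\<lambda>\<omega>. X i \<omega> (u j)) \<in> borel_measurable N" "(\<lambda>\<omega>. X i \<omega> (v j)) \<in> borel_measurable N"
        if "i \<in> {1..n}" for i
        using uv[OF \<open>j \<le> p\<close>] that by (auto intro!: X_coord_measurable)
      then have "(\<lambda>\<omega>. \<Sum>i=1..n. g j (X i \<omega>)) \<in> borel_measurable N"
        unfolding g_def by (intro borel_measurable_sum borel_measurable_times borel_measurable_diff) auto
      then show ?thesis unfolding F_def by measurable
    qed
    show "\<exists>E\<in>events. prob E \<le> real (Suc p) * exp (- (real n * a)) \<and>
      (\<forall>\<omega>\<in>space N - E. arrival_path (mean_path n \<omega>) \<longrightarrow> (\<forall>s\<in>{0..T}. \<forall>t\<in>{0..T}.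
      s \<le> t \<and> t \<le> s + h \<longrightarrow> mean_path n \<omega> t - mean_path n \<omega> s \<le> e))"
    proof (intro bexI[of _ "\<Union>j\<in>{..p}. F j"] conjI ballI impI)
      have "prob (\<Union>j\<in>{..p}. F j) \<le> (\<Sum>j\<in>{..p}. prob (F j))"
        using F by (intro finite_measure_subadditive_finite) auto
      also have "\<dots> \<le> (\<Sum>j\<in>{..p}. exp (- (real n * a)))"
        using small by (intro sum_mono) (auto simp: F_def)
      finally show "prob (\<Union>j\<in>{..p}. F j) \<le> real (Suc p) * exp (- (real n * a))" by simp
    next
      fix \<omega> s t assume \<omega>: "\<omega> \<in> space N - (\<Union>j\<in>{..p}. F j)" "arrival_path (mean_path n \<omega>)"
        and st: "s \<in> {0..T}" "t \<in> {0..T}" "s \<le> t \<and> t \<le> s + h"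
      define j where "j = nat \<lfloor>s / h\<rfloor>"
      have "0 \<le> s / h" "s / h \<le> real p" using st h T_pos \<open>0 < real p\<close> by (auto simp: h_def field_simps)
      then have j: "j \<le> p" "real j \<le> s / h" "s / h < real j + 1"
        unfolding j_def by linarith+
      then have "u j \<le> s" "t \<le> v j"
        using st h by (auto simp: u_def v_def field_simps)
      then have "mean_path n \<omega> t - mean_path n \<omega> s \<le> mean_path n \<omega> (v j) - mean_path n \<omega> (u j)"
      proof (intro diff_mono)
        have mono: "mono_on {0..T} (mean_path n \<omega>)" using \<omega>(2) by (simp add: arrival_path_def)
        show "mean_path n \<omega> t \<le> mean_path n \<omega> (v j)" "mean_path n \<omega> (u j) \<le> mean_path n \<omega> s"
          using \<open>u j \<le> s\<close> \<open>t \<le> v j\<close> uv[OF j(1)] st by (intro mono_onD[OF mono]; simp)+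
      qed
      moreover have "mean_path n \<omega> (v j) - mean_path n \<omega> (u j) < e"
      proof -
        have "(\<Sum>i=1..n. g j (X i \<omega>)) < real n * (\<theta> * e)"
          using \<omega>(1) j(1) by (auto simp: F_def not_le)
        moreover have "(\<Sum>i=1..n. g j (X i \<omega>)) =
            real n * (\<theta> * (mean_path n \<omega> (v j) - mean_path n \<omega> (u j)))"
          using n by (simp add: g_def sum_subtractf field_simps flip: sum_distrib_left)
        ultimately show ?thesis using n \<theta> by simp
      qed
      ultimately show "mean_path n \<omega> t - mean_path n \<omega> s \<le> e" by simp
    qed (use F in auto)
  qed
qed

section \<open>Compactness in the Skorokhod topology\<close>

lemma J1_metric: "Metric_space (D_space T) (J1_dist T)"
  using T_pos by (intro Metric_space_J1) simp

text \<open>One-sided, because for the monotone paths to which it is applied an increment is its own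
  absolute value.\<close>

definition modulus_le :: "real \<Rightarrow> real \<Rightarrow> (real \<Rightarrow> real) \<Rightarrow> bool" where
  "modulus_le d e \<phi> \<longleftrightarrow> (\<forall>s\<in>{0..T}. \<forall>t\<in>{0..T}. s \<le> t \<and> t \<le> s + d \<longrightarrow> \<phi> t - \<phi> s \<le> e)"

lemma arrival_path_bound:
  assumes \<phi>: "arrival_path \<phi>" "modulus_le d e \<phi>" and d: "0 < d" and e: "0 < e"
  shows "\<phi> T \<le> real (nat \<lceil>T / d\<rceil>) * e"
proof -
  have step: "\<phi> (min T (real n * d)) \<le> real n * e" for n
  proof (induction n)
    case 0
    then show ?case using \<phi>(1) T_pos by (simp add: arrival_path_def)
  next
    case (Suc n)
    have "0 \<le> real n * d" using d by simp
    then have "\<phi> (min T (real (Suc n) * d)) - \<phi> (min T (real n * d)) \<le> e"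
      using \<phi>(2) d T_pos unfolding modulus_le_def
      by (elim ballE[of _ _ "min T (real n * d)"] ballE[of _ _ "min T (real (Suc n) * d)"])
        (auto simp: min_def algebra_simps)
    then show ?case using Suc by (simp add: algebra_simps)
  qed
  have "T / d \<le> real (nat \<lceil>T / d\<rceil>)" by linarith
  then have "T \<le> real (nat \<lceil>T / d\<rceil>) * d" using d by (simp add: field_simps)
  then show ?thesis using step[of "nat \<lceil>T / d\<rceil>"] by (simp add: min_def split: if_splits)
qed

text \<open>Adding back the drift makes the paths monotone, so the start and end values bound them
  and a one-sided modulus suffices. The extracted subsequence converges uniformly, hence in J1 with
  the identity as time change.\<close>

lemma J1_convergent_subsequence:
  assumes y: "\<And>k. y k \<in> D_space T" "\<And>k. arrival_path (\<lambda>t. y k t + c * t)"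
    and bound: "\<And>k. y k T + c * T \<le> B"
    and equi: "\<And>e. 0 < e \<Longrightarrow> \<exists>d>0. \<exists>K. \<forall>k\<ge>K. modulus_le d e (\<lambda>t. y k t + c * t)"
  obtains r x where "strict_mono (r :: nat \<Rightarrow> nat)" "x \<in> D_space T" "continuous_on {0..T} x"
    "\<And>t. t \<in> {0..T} \<Longrightarrow> (\<lambda>k. y (r k) t) \<longlonglongrightarrow> x t"
    "limitin (J1_topology T) (\<lambda>k. y (r k)) x sequentially"
proof -
  interpret J: Metric_space "D_space T" "J1_dist T" by (rule J1_metric)
  define \<phi> where "\<phi> k t = y k t + c * t" for k t
  have mono: "\<phi> k s \<le> \<phi> k t" if "s \<in> {0..T}" "t \<in> {0..T}" "s \<le> t" for k s t
    using y(2)[of k] that by (auto simp: arrival_path_def mono_on_def \<phi>_def)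
  have zero: "\<phi> k 0 = 0" for k using y(2)[of k] by (simp add: arrival_path_def \<phi>_def)
  have "\<bar>\<phi> k t\<bar> \<le> B" if "t \<in> {0..T}" for k t
    using mono[of 0 t k] mono[of t T k] that T_pos zero[of k] bound[of k] by (auto simp: \<phi>_def)
  moreover have "\<exists>d>0. \<exists>K. \<forall>k\<ge>K. \<forall>s\<in>{0..T}. \<forall>t\<in>{0..T}. \<bar>s - t\<bar> < d \<longrightarrow> \<bar>\<phi> k s - \<phi> k t\<bar> \<le> e"
    if e: "0 < e" for e
  proof -
    obtain d K where d: "0 < d" and K: "\<And>k. K \<le> k \<Longrightarrow> modulus_le d e (\<phi> k)"
      using equi[OF e] unfolding \<phi>_def by blast
    have "\<bar>\<phi> k s - \<phi> k t\<bar> \<le> e" if k: "K \<le> k" and st: "s \<in> {0..T}" "t \<in> {0..T}" "\<bar>s - t\<bar> < d" for k s t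
    proof (cases "s \<le> t")
      case True
      then have "\<phi> k t - \<phi> k s \<le> e" using K[OF k] st unfolding modulus_le_def by fastforce
      then show ?thesis using mono[OF st(1,2) True, of k] by linarith
    next
      case False
      then have "\<phi> k s - \<phi> k t \<le> e" using K[OF k] st unfolding modulus_le_def by fastforce
      then show ?thesis using mono[OF st(2,1), of k] False by linarith
    qed
    then show ?thesis using d by blast
  qed
  ultimately obtain r g where r: "strict_mono (r :: nat \<Rightarrow> nat)" and g: "continuous_on {0..T} g"
    and lim: "uniform_limit {0..T} (\<lambda>k. \<phi> (r k)) g sequentially"
    using asymptotic_Arzela_Ascoli[OF T_pos, of \<phi> B] by blast
  define x where "x = (\<lambda>t\<in>{0..T}. g t - c * t)"
  have x_cont: "continuous_on {0..T} x"
  proof (rule continuous_on_eq)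
    show "continuous_on {0..T} (\<lambda>t. g t - c * t)" by (intro continuous_intros g)
  qed (simp add: x_def)
  then have x: "x \<in> D_space T" by (rule continuous_in_D_space) (simp add: x_def)
  have pw: "(\<lambda>k. y (r k) t) \<longlonglongrightarrow> x t" if t: "t \<in> {0..T}" for t
  proof -
    have "(\<lambda>k. \<phi> (r k) t - c * t) \<longlonglongrightarrow> g t - c * t"
      by (intro tendsto_intros tendsto_uniform_limitI[OF lim t])
    then show ?thesis using t by (simp add: \<phi>_def x_def)
  qed
  have "limitin (J1_topology T) (\<lambda>k. y (r k)) x sequentially"
    unfolding J1_topology_def J.limitin_metric
  proof (intro conjI allI impI x)
    fix e :: real assume e: "0 < e"
    then have "eventually (\<lambda>k. \<forall>t\<in>{0..T}. dist (\<phi> (r k) t) (g t) < e / 2) sequentially"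
      by (intro uniform_limitD[OF lim]) simp
    then show "eventually (\<lambda>k. y (r k) \<in> D_space T \<and> J1_dist T (y (r k)) x < e) sequentially"
    proof eventually_elim
      case (elim k)
      have "\<bar>y (r k) t - x t\<bar> \<le> e / 2" if "t \<in> {0..T}" for t
      proof -
        have "\<bar>\<phi> (r k) t - g t\<bar> < e / 2" using elim that by (simp add: dist_real_def)
        moreover have "y (r k) t - x t = \<phi> (r k) t - g t" using that by (simp add: \<phi>_def x_def)
        ultimately show ?thesis by linarith
      qed
      then have "J1_dist T (y (r k)) x \<le> e / 2"
        using e by (intro J1_dist_le_uniform y x) auto
      then show ?case using e y(1) by simp
    qed
  qed
  with r x x_cont pw show ?thesis by (rule that)
qed

lemma rate_J_le_cost:
  "rate_J N (X 1) T c x \<le> ereal a \<longleftrightarrow>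
    (\<forall>J \<alpha>. finite J \<and> J \<noteq> {} \<and> J \<subseteq> {0<..T} \<longrightarrow> cost N (X 1) J \<alpha> (\<lambda>t. x t + c * t) \<le> a)"
  by (simp add: rate_J_le_iff)

lemma path_right_limit_0:
  assumes "x \<in> D_space T"
  shows "((\<lambda>t. x t + c * t) \<longlongrightarrow> x 0 + c * 0) (at_right 0)"
  using T_pos by (intro tendsto_intros D_space_right[OF assms]) simp

text \<open>A level set has a common modulus and a common bound, so its sequences have J1 convergent
  subsequences. The limit stays in it because every cost is continuous for pointwise convergence at
  finitely many times.\<close>

lemma good_rate_J: "good_rate (J1_topology T) (rate_J N (X 1) T c)"
  unfolding good_rate_def
proof
  fix M :: real
  interpret J: Metric_space "D_space T" "J1_dist T" by (rule J1_metric)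
  define S where "S = {x \<in> D_space T. rate_J N (X 1) T c x \<le> ereal M}"
  have "\<exists>l r. l \<in> S \<and> strict_mono r \<and> limitin J.mtopology (y \<circ> r) l sequentially"
    if y: "range y \<subseteq> S" for y :: "nat \<Rightarrow> real \<Rightarrow> real"
  proof -
    have yD: "y k \<in> D_space T" for k using y by (auto simp: S_def)
    have cost: "cost N (X 1) J \<alpha> (\<lambda>t. y k t + c * t) \<le> M"
      if "finite J" "J \<noteq> {}" "J \<subseteq> {0<..T}" for k J \<alpha>
      using y that rate_J_le_cost[of "y k" M] by (auto simp: S_def)
    note lim0 = path_right_limit_0[OF yD]
    have arr: "arrival_path (\<lambda>t. y k t + c * t)" for k
      by (rule cost_bounded_regular(1)[OF cost lim0])
    have mod: "\<exists>d>0. \<forall>k. modulus_le d e (\<lambda>t. y k t + c * t)" if e: "0 < e" for e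
    proof -
      obtain d where d: "0 < d" and *: "\<And>\<phi> s t.
        (\<And>J \<alpha>. finite J \<Longrightarrow> J \<noteq> {} \<Longrightarrow> J \<subseteq> {0<..T} \<Longrightarrow> cost N (X 1) J \<alpha> \<phi> \<le> M) \<Longrightarrow>
        (\<phi> \<longlongrightarrow> \<phi> 0) (at_right 0) \<Longrightarrow> s \<in> {0..T} \<Longrightarrow> t \<in> {0..T} \<Longrightarrow> s \<le> t \<Longrightarrow> t \<le> s + d \<Longrightarrow>
        \<phi> t - \<phi> s \<le> e"
        using cost_bounded_modulus[OF e] by blast
      have "modulus_le d e (\<lambda>t. y k t + c * t)" for k
        unfolding modulus_le_def using *[OF cost lim0] by blast
      with d show ?thesis by blast
    qed
    obtain d1 where d1: "0 < d1" "\<And>k. modulus_le d1 1 (\<lambda>t. y k t + c * t)"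
      using mod[of 1] by auto
    have bound: "y k T + c * T \<le> real (nat \<lceil>T / d1\<rceil>) * 1" for k
      by (rule arrival_path_bound[OF arr d1(2) d1(1)]) simp
    have equi: "\<exists>d>0. \<exists>K. \<forall>k\<ge>K. modulus_le d e (\<lambda>t. y k t + c * t)" if "0 < e" for e
      using mod[OF that] by blast
    obtain r x where r: "strict_mono (r :: nat \<Rightarrow> nat)" and x: "x \<in> D_space T"
      and pw: "\<And>t. t \<in> {0..T} \<Longrightarrow> (\<lambda>k. y (r k) t) \<longlonglongrightarrow> x t"
      and lim: "limitin (J1_topology T) (\<lambda>k. y (r k)) x sequentially"
      using J1_convergent_subsequence[OF yD arr bound equi] by blast
    have "cost N (X 1) J \<alpha> (\<lambda>t. x t + c * t) \<le> M"
      if J: "finite J" "J \<noteq> {}" "J \<subseteq> {0<..T}" for J \<alpha>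
    proof (rule tendsto_upperbound)
      show "(\<lambda>k. cost N (X 1) J \<alpha> (\<lambda>t. y (r k) t + c * t)) \<longlonglongrightarrow>
          cost N (X 1) J \<alpha> (\<lambda>t. x t + c * t)"
        using J(3) by (intro cost_tendsto tendsto_intros pw) auto
    qed (use cost J in auto)
    then have "x \<in> S" using x rate_J_le_cost[of x M] by (auto simp: S_def)
    with r lim show ?thesis by (auto simp: J1_topology_def o_def)
  qed
  then have "compactin J.mtopology S"
    unfolding J.compactin_sequentially by (auto simp: S_def)
  then show "compactin (J1_topology T) {x \<in> topspace (J1_topology T). rate_J N (X 1) T c x \<le> ereal M}"
    using T_pos by (simp add: S_def J1_topology_def topspace_J1_topology)
qed

section \<open>Net-input paths as random elements\<close>

lemma net_input_eq: "t \<in> {0..T} \<Longrightarrow> net_input T c X n \<omega> t + c * t = mean_path n \<omega> t"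
  by (simp add: net_input_def)

lemma net_input_in_D_space:
  assumes "\<omega> \<in> space N"
  shows "net_input T c X n \<omega> \<in> D_space T"
  unfolding net_input_def
proof (rule restrict_in_D_space)
  fix t assume "t \<in> {0..<T}"
  then show "((\<lambda>t. mean_path n \<omega> t - c * t) \<longlongrightarrow> mean_path n \<omega> t - c * t) (at_right t)"
    using assms by (intro tendsto_intros D_space_right[OF paths]) auto
next
  fix t assume t: "t \<in> {0<..T}"
  then have "\<forall>i\<in>{1..n}. \<exists>l. (X i \<omega> \<longlongrightarrow> l) (at_left t)"
    using assms by (intro ballI D_space_left[OF paths]) auto
  then obtain l where "\<And>i. i \<in> {1..n} \<Longrightarrow> (X i \<omega> \<longlongrightarrow> l i) (at_left t)" by metis
  then have "((\<lambda>t. mean_path n \<omega> t - c * t) \<longlongrightarrow> (1 / real n) * (\<Sum>i=1..n. l i) - c * t) (at_left t)"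
    by (intro tendsto_intros)
  then show "\<exists>l. ((\<lambda>t. mean_path n \<omega> t - c * t) \<longlongrightarrow> l) (at_left t)" by blast
qed

lemma net_input_measurable: "net_input T c X n \<in> N \<rightarrow>\<^sub>M borel_sigma (J1_topology T)"
proof (rule measurable_borel_sigma_J1[OF T_pos net_input_in_D_space])
  fix t assume t: "t \<in> {0..T}"
  have "(\<lambda>\<omega>. X i \<omega> t) \<in> borel_measurable N" if "i \<in> {1..n}" for i
    using that t by (intro X_coord_measurable) auto
  then show "(\<lambda>\<omega>. net_input T c X n \<omega> t) \<in> borel_measurable N"
    using t by (simp add: net_input_def)
qed

lemma arrival_path_cong:
  assumes "\<And>t. t \<in> {0..T} \<Longrightarrow> \<phi> t = \<psi> t"
  shows "arrival_path \<phi> \<longleftrightarrow> arrival_path \<psi>"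
proof -
  have "mono_on {0..T} \<phi> \<longleftrightarrow> mono_on {0..T} \<psi>"
    unfolding mono_on_def using assms by metis
  then show ?thesis
    using assms[of 0] T_pos by (simp add: arrival_path_def)
qed

lemma AE_net_input: "AE \<omega> in N. arrival_path (\<lambda>t. net_input T c X n \<omega> t + c * t)"
  using AE_arrival_path_mean[of n]
  by eventually_elim (simp only: arrival_path_cong[OF net_input_eq])

lemma sets_net_input_open:
  assumes "openin (J1_topology T) G"
  shows "{\<omega> \<in> space N. net_input T c X n \<omega> \<in> G} \<in> events"
proof -
  have "G \<in> sets (borel_sigma (J1_topology T))"
    unfolding borel_sigma_def using assms openin_subset by (subst sets_measure_of) auto
  from measurable_sets[OF net_input_measurable this]
  show ?thesis by (simp add: vimage_def Int_def conj_commute)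
qed

section \<open>Upper bound for closed sets\<close>

text \<open>The logarithm subtracted in \<open>cost\<close> cancels the moment generating function
  in the Chernoff bound exactly, which leaves no prefactor.\<close>

lemma halfspace_probability:
  assumes J: "finite J" "J \<subseteq> {0<..T}" and n: "1 \<le> n"
  shows "{\<omega> \<in> space N. a < cost N (X 1) J \<alpha> (mean_path n \<omega>)} \<in> events"
    and "prob {\<omega> \<in> space N. a < cost N (X 1) J \<alpha> (mean_path n \<omega>)} \<le> exp (- (real n * a))"
proof -
  have J': "J \<subseteq> {0..T}" using J(2) by auto
  interpret V: iid_vectors N "{0..T}" X J by (rule sample_vectors[OF J(1) J'])
  have "(\<lambda>\<omega>. X i \<omega> t) \<in> borel_measurable N" if "i \<in> {1..n}" "t \<in> J" for i t
    using that J' by (intro X_coord_measurable) auto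
  then have "(\<lambda>\<omega>. cost N (X 1) J \<alpha> (mean_path n \<omega>)) \<in> borel_measurable N"
    unfolding cost_def by (intro borel_measurable_diff borel_measurable_const borel_measurable_sum
        borel_measurable_times)
  then show ev: "{\<omega> \<in> space N. a < cost N (X 1) J \<alpha> (mean_path n \<omega>)} \<in> events"
    by measurable
  define g where "g x = (\<Sum>t\<in>J. \<alpha> t * x t)" for x :: "real \<Rightarrow> real"
  define b where "b = a + ln (V.mgf \<alpha>)"
  have sum_g: "(\<Sum>i=1..n. g (X i \<omega>)) = real n * (\<Sum>t\<in>J. \<alpha> t * mean_path n \<omega> t)" for \<omega>
  proof -
    have "(\<Sum>i=1..n. g (X i \<omega>)) = (\<Sum>t\<in>J. \<alpha> t * (\<Sum>i=1..n. X i \<omega> t))"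
      unfolding g_def by (subst sum.swap) (simp only: sum_distrib_left)
    also have "\<dots> = (\<Sum>t\<in>J. real n * (\<alpha> t * mean_path n \<omega> t))"
      using n by (intro sum.cong) auto
    finally show ?thesis by (simp only: sum_distrib_left)
  qed
  have "{\<omega> \<in> space N. a < cost N (X 1) J \<alpha> (mean_path n \<omega>)} \<subseteq>
      {\<omega> \<in> space N. real n * b \<le> (\<Sum>i=1..n. g (X i \<omega>))}"
  proof safe
    fix \<omega> assume "a < cost N (X 1) J \<alpha> (mean_path n \<omega>)"
    then have "b \<le> (\<Sum>t\<in>J. \<alpha> t * mean_path n \<omega> t)"
      using cost_mgf[OF J(1) J', of \<alpha> "mean_path n \<omega>"] by (simp add: b_def)
    then show "real n * b \<le> (\<Sum>i=1..n. g (X i \<omega>))"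
      unfolding sum_g by (intro mult_left_mono) auto
  qed
  moreover have g_meas: "g \<in> borel_measurable (Pi\<^sub>M {0..T} (\<lambda>_. borel))"
    unfolding g_def by (rule V.linear_measurable)
  moreover have "{\<omega> \<in> space N. real n * b \<le> (\<Sum>i=1..n. g (X i \<omega>))} \<in> events"
  proof -
    have "(\<lambda>\<omega>. g (X i \<omega>)) \<in> borel_measurable N" if "i \<in> {1..n}" for i
      using measurable_compose[OF X_measurable g_meas, of i] that by simp
    then have "(\<lambda>\<omega>. \<Sum>i=1..n. g (X i \<omega>)) \<in> borel_measurable N"
      by (intro borel_measurable_sum)
    then show ?thesis by measurable
  qed
  ultimately have "prob {\<omega> \<in> space N. a < cost N (X 1) J \<alpha> (mean_path n \<omega>)} \<le>
      prob {\<omega> \<in> space N. real n * b \<le> (\<Sum>i=1..n. g (X i \<omega>))}"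
    by (intro finite_measure_mono)
  also have "\<dots> \<le> exp (- (real n * b)) * V.mgf \<alpha> ^ n"
    using chernoff[OF g_meas] V.exp_moments[of \<alpha>] by (simp add: g_def V.mgf_def)
  also have "\<dots> = exp (- (real n * a))"
  proof -
    have "V.mgf \<alpha> ^ n = exp (real n * ln (V.mgf \<alpha>))"
      using V.mgf_pos[of \<alpha>] by (simp add: exp_of_nat_mult)
    then show ?thesis by (simp add: b_def mult_exp_exp algebra_simps)
  qed
  finally show "prob {\<omega> \<in> space N. a < cost N (X 1) J \<alpha> (mean_path n \<omega>)} \<le> exp (- (real n * a))" .
qed

text \<open>The sets \<open>{x. a < cost J \<alpha> (x + c)}\<close> cover the compact part of \<open>C\<close>; a compactness argument
  shows that finitely many of them cover what is left of \<open>C\<close> after finitely many modulus conditions.\<close>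

lemma closed_set_cover:
  assumes C: "closedin (J1_topology T) C" and a: "ereal a < (INF x\<in>C. rate_J N (X 1) T c x)"
    and d: "\<And>j. 0 < d j"
  shows "\<exists>k F. finite F \<and> (\<forall>p\<in>F. finite (fst p) \<and> fst p \<subseteq> {0<..T}) \<and>
    (\<forall>x\<in>C. arrival_path (\<lambda>t. x t + c * t) \<longrightarrow>
      (\<forall>j\<le>k. modulus_le (d j) (1 / real (Suc j)) (\<lambda>t. x t + c * t)) \<longrightarrow>
      (\<exists>(J, \<alpha>)\<in>F. a < cost N (X 1) J \<alpha> (\<lambda>t. x t + c * t)))"
proof -
  interpret J: Metric_space "D_space T" "J1_dist T" by (rule J1_metric)
  have C_sub: "C \<subseteq> D_space T"
    using closedin_subset[OF C] T_pos by (simp add: topspace_J1_topology)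
  define ok where "ok k x \<longleftrightarrow> x \<in> C \<and> arrival_path (\<lambda>t. x t + c * t) \<and>
      (\<forall>j\<le>k. modulus_le (d j) (1 / real (Suc j)) (\<lambda>t. x t + c * t))" for k :: nat and x
  define K where "K = {x. \<forall>k. ok k x}"
  \<comment> \<open>The \<open>k\<close>-th path meets only the first \<open>k + 1\<close> modulus
    conditions, yet the limit meets all of them. This one fact serves three times: for the
    compactness of \<open>K\<close>, for the continuity of its members, and for the final
    contradiction.\<close>
  have seq: "\<exists>r x. strict_mono (r :: nat \<Rightarrow> nat) \<and> x \<in> K \<and> continuous_on {0..T} x \<and>
      limitin J.mtopology (\<lambda>k. y (r k)) x sequentially"
    if y: "\<And>k. ok k (y k)" for y
  proof -
    have yC: "y k \<in> C" and arr: "arrival_path (\<lambda>t. y k t + c * t)" for k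
      using y[of k] by (auto simp: ok_def)
    have mod: "modulus_le (d j) (1 / real (Suc j)) (\<lambda>t. y k t + c * t)" if "j \<le> k" for j k
      using y[of k] that by (auto simp: ok_def)
    have yD: "y k \<in> D_space T" for k using yC C_sub by blast
    have mod0: "modulus_le (d 0) 1 (\<lambda>t. y k t + c * t)" for k
      using mod[of 0 k] by simp
    have bound: "y k T + c * T \<le> real (nat \<lceil>T / d 0\<rceil>) * 1" for k
      by (rule arrival_path_bound[OF arr mod0 d]) simp
    have equi: "\<exists>d>0. \<exists>K. \<forall>k\<ge>K. modulus_le d e (\<lambda>t. y k t + c * t)" if e: "0 < e" for e
    proof -
      obtain j where j: "1 / real (Suc j) < e" using e by (meson nat_approx_posE)
      have "modulus_le (d j) e (\<lambda>t. y k t + c * t)" if "j \<le> k" for k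
        using mod[OF that] j unfolding modulus_le_def by (meson less_imp_le order_trans)
      then show ?thesis using d by blast
    qed
    obtain r x where r: "strict_mono (r :: nat \<Rightarrow> nat)" and x: "x \<in> D_space T" "continuous_on {0..T} x"
      and pw: "\<And>t. t \<in> {0..T} \<Longrightarrow> (\<lambda>k. y (r k) t) \<longlonglongrightarrow> x t"
      and lim: "limitin (J1_topology T) (\<lambda>k. y (r k)) x sequentially"
      using J1_convergent_subsequence[OF yD arr bound equi] by blast
    have "x \<in> C"
      using limitin_closedin[OF lim C] yC by simp
    have pw': "(\<lambda>k. y (r k) t + c * t) \<longlonglongrightarrow> x t + c * t" if "t \<in> {0..T}" for t
      by (intro tendsto_intros pw that)
    have "arrival_path (\<lambda>t. x t + c * t)"
      unfolding arrival_path_def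
    proof
      have "(\<lambda>k. y (r k) 0 + c * 0) \<longlonglongrightarrow> x 0 + c * 0" using T_pos by (intro pw') simp
      moreover have "y k 0 + c * 0 = 0" for k using arr[of k] by (simp add: arrival_path_def)
      ultimately show "x 0 + c * 0 = 0" by (simp only: LIMSEQ_const_iff)
      show "mono_on {0..T} (\<lambda>t. x t + c * t)"
      proof (rule mono_onI)
        fix s t assume st: "s \<in> {0..T}" "t \<in> {0..T}" "s \<le> t"
        have "y k s + c * s \<le> y k t + c * t" for k
          using arr[of k] st unfolding arrival_path_def by (blast dest: mono_onD)
        then show "x s + c * s \<le> x t + c * t"
          by (intro LIMSEQ_le[OF pw'[OF st(1)] pw'[OF st(2)]]) blast
      qed
    qed
    moreover have "modulus_le (d j) (1 / real (Suc j)) (\<lambda>t. x t + c * t)" for j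
      unfolding modulus_le_def
    proof (intro ballI impI)
      fix s t assume st: "s \<in> {0..T}" "t \<in> {0..T}" "s \<le> t \<and> t \<le> s + d j"
      have "(\<lambda>k. (y (r k) t + c * t) - (y (r k) s + c * s)) \<longlonglongrightarrow> (x t + c * t) - (x s + c * s)"
        by (rule tendsto_diff[OF pw'[OF st(2)] pw'[OF st(1)]])
      moreover have "eventually (\<lambda>k. (y (r k) t + c * t) - (y (r k) s + c * s) \<le> 1 / real (Suc j)) sequentially"
        using eventually_ge_at_top[of j]
      proof eventually_elim
        case (elim k)
        then have "j \<le> r k" using seq_suble[OF r, of k] by simp
        from mod[OF this] st show ?case unfolding modulus_le_def by blast
      qed
      ultimately show "(x t + c * t) - (x s + c * s) \<le> 1 / real (Suc j)"
        by (rule tendsto_upperbound) simp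
    qed
    ultimately have "x \<in> K" using \<open>x \<in> C\<close> by (auto simp: K_def ok_def)
    with r x(2) lim show ?thesis unfolding J1_topology_def by blast
  qed
  have K_sub: "K \<subseteq> D_space T" using C_sub by (auto simp: K_def ok_def)
  have compact: "compactin J.mtopology K"
    unfolding J.compactin_sequentially
  proof (intro conjI allI impI K_sub)
    fix y :: "nat \<Rightarrow> real \<Rightarrow> real" assume "range y \<subseteq> K"
    then have "ok k (y k)" for k by (auto simp: K_def)
    from seq[OF this] show "\<exists>l r. l \<in> K \<and> strict_mono r \<and> limitin J.mtopology (y \<circ> r) l sequentially"
      by (auto simp: o_def)
  qed
  \<comment> \<open>Applied to a constant sequence, the extraction returns a continuous limit, which
    by uniqueness is the path itself.\<close>
  have cont: "continuous_on {0..T} x" if x: "x \<in> K" for x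
  proof -
    have "ok k x" for k using x by (simp add: K_def)
    from seq[of "\<lambda>_. x", OF this] obtain r x' where x': "x' \<in> K" "continuous_on {0..T} x'"
      "limitin J.mtopology (\<lambda>k. x) x' sequentially" by blast
    moreover have "limitin J.mtopology (\<lambda>k. x) x sequentially"
      unfolding J.limitin_metric using x K_sub by auto
    ultimately have "x = x'"
      using J.limitin_metric_unique[OF _ x'(3) trivial_limit_sequentially] by blast
    then show ?thesis using x'(2) by simp
  qed
  have "\<exists>J \<alpha> r. finite J \<and> J \<subseteq> {0<..T} \<and> 0 < r \<and>
      (\<forall>y\<in>J.mball x r. a < cost N (X 1) J \<alpha> (\<lambda>t. y t + c * t))" if x: "x \<in> K" for x
  proof -
    have "x \<in> C" using x by (auto simp: K_def ok_def)
    then have "\<not> rate_J N (X 1) T c x \<le> ereal a"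
      using a by (meson INF_lower less_le_trans not_le)
    then obtain J \<alpha> where J: "finite J" "J \<subseteq> {0<..T}" and *: "a < cost N (X 1) J \<alpha> (\<lambda>t. x t + c * t)"
      unfolding rate_J_le_cost by (auto simp: not_le)
    define gap where "gap = cost N (X 1) J \<alpha> (\<lambda>t. x t + c * t) - a"
    define s where "s = (\<Sum>t\<in>J. \<bar>\<alpha> t\<bar>)"
    have s: "0 \<le> s" by (simp add: s_def sum_nonneg)
    \<comment> \<open>With this tolerance at the times in \<open>J\<close> the cost changes by at
      most \<open>s * e\<close>, which is less than its excess over \<open>a\<close>. The resulting
      ball of paths contains discontinuous ones too.\<close>
    define e where "e = gap / (s + 1)"
    have e: "0 < e" "s * e < gap"
    proof -
      show "0 < e" using * s by (simp add: e_def gap_def)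
      then show "s * e < gap" using s by (simp add: e_def field_simps)
    qed
    have "x \<in> extensional {0..T}" using x K_sub by (auto simp: D_space_def)
    then obtain r where r: "0 < r"
      and near: "\<And>y t. y \<in> D_space T \<Longrightarrow> J1_dist T x y < r \<Longrightarrow> t \<in> {0..T} \<Longrightarrow> \<bar>y t - x t\<bar> < e"
      using J1_near_continuous[OF less_imp_le[OF T_pos] cont[OF x] _ e(1)] by blast
    have "a < cost N (X 1) J \<alpha> (\<lambda>t. y t + c * t)" if y: "y \<in> J.mball x r" for y
    proof -
      have "(\<Sum>t\<in>J. \<alpha> t * (x t + c * t)) - (\<Sum>t\<in>J. \<alpha> t * (y t + c * t)) = (\<Sum>t\<in>J. \<alpha> t * (x t - y t))"
        by (simp add: sum_subtractf[symmetric] algebra_simps)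
      also have "\<dots> \<le> (\<Sum>t\<in>J. \<bar>\<alpha> t\<bar> * e)"
      proof (rule sum_mono)
        fix t assume t: "t \<in> J"
        then have "t \<in> {0..T}" using J(2) by auto
        then have "\<bar>y t - x t\<bar> < e" using y by (intro near) auto
        have "\<alpha> t * (x t - y t) \<le> \<bar>\<alpha> t\<bar> * \<bar>x t - y t\<bar>" by (metis abs_ge_self abs_mult)
        also have "\<dots> \<le> \<bar>\<alpha> t\<bar> * e"
          using \<open>\<bar>y t - x t\<bar> < e\<close> by (intro mult_left_mono) auto
        finally show "\<alpha> t * (x t - y t) \<le> \<bar>\<alpha> t\<bar> * e" .
      qed
      also have "\<dots> = s * e" by (simp add: s_def sum_distrib_right)
      finally show ?thesis using e(2) by (simp add: cost_def gap_def)
    qed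
    with J r show ?thesis by blast
  qed
  then obtain JJ A R where JAR: "\<And>x. x \<in> K \<Longrightarrow> finite (JJ x) \<and> JJ x \<subseteq> {0<..T} \<and> 0 < R x \<and>
      (\<forall>y\<in>J.mball x (R x). a < cost N (X 1) (JJ x) (A x) (\<lambda>t. y t + c * t))"
    by metis
  have "\<And>U. U \<in> (\<lambda>x. J.mball x (R x)) ` K \<Longrightarrow> openin J.mtopology U" by auto
  moreover have "K \<subseteq> \<Union>((\<lambda>x. J.mball x (R x)) ` K)"
    using JAR K_sub by (auto simp: J.centre_in_mball_iff)
  ultimately obtain \<U> where \<U>: "finite \<U>" "\<U> \<subseteq> (\<lambda>x. J.mball x (R x)) ` K" "K \<subseteq> \<Union>\<U>"
    using compactinD[OF compact] by meson
  obtain K' where K': "K' \<subseteq> K" "finite K'" "\<U> = (\<lambda>x. J.mball x (R x)) ` K'"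
    using finite_subset_image[OF \<U>(1,2)] by blast
  define F where "F = (\<lambda>x. (JJ x, A x)) ` K'"
  have "\<exists>k. \<forall>x. ok k x \<longrightarrow> (\<exists>(J, \<alpha>)\<in>F. a < cost N (X 1) J \<alpha> (\<lambda>t. x t + c * t))"
  \<comment> \<open>If no finite number of conditions were enough, uncovered paths meeting ever more
    of them would accumulate at a point of \<open>K\<close>, and so would enter one of the finitely
    many balls.\<close>
  proof (rule ccontr)
    assume "\<nexists>k. \<forall>x. ok k x \<longrightarrow> (\<exists>(J, \<alpha>)\<in>F. a < cost N (X 1) J \<alpha> (\<lambda>t. x t + c * t))"
    then have "\<forall>k. \<exists>x. ok k x \<and> \<not> (\<exists>(J, \<alpha>)\<in>F. a < cost N (X 1) J \<alpha> (\<lambda>t. x t + c * t))"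
      by simp
    from choice[OF this] obtain y where y: "\<And>k. ok k (y k)"
      and no: "\<And>k. \<not> (\<exists>(J, \<alpha>)\<in>F. a < cost N (X 1) J \<alpha> (\<lambda>t. y k t + c * t))"
      by blast
    obtain r x where x: "x \<in> K" and lim: "limitin J.mtopology (\<lambda>k. y (r k)) x sequentially"
      using seq[OF y] by blast
    obtain z where z: "z \<in> K'" "x \<in> J.mball z (R z)"
      using x \<U>(3) K'(3) by auto
    have "eventually (\<lambda>k. y (r k) \<in> J.mball z (R z)) sequentially"
      using lim z(2) unfolding limitin_def by auto
    then obtain k where "y (r k) \<in> J.mball z (R z)"
      by (metis eventually_sequentially order.refl)
    then have "a < cost N (X 1) (JJ z) (A z) (\<lambda>t. y (r k) t + c * t)"
      using JAR[of z] z(1) K'(1) by blast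
    moreover have "(JJ z, A z) \<in> F" using z(1) by (auto simp: F_def)
    ultimately show False using no by blast
  qed
  then obtain k where k: "\<And>x. ok k x \<Longrightarrow> \<exists>(J, \<alpha>)\<in>F. a < cost N (X 1) J \<alpha> (\<lambda>t. x t + c * t)"
    by blast
  show ?thesis
  proof (intro exI[of _ k] exI[of _ F] conjI)
    show "finite F" using K'(2) by (simp add: F_def)
    show "\<forall>p\<in>F. finite (fst p) \<and> fst p \<subseteq> {0<..T}"
      using JAR K'(1) by (auto simp: F_def)
    show "\<forall>x\<in>C. arrival_path (\<lambda>t. x t + c * t) \<longrightarrow>
      (\<forall>j\<le>k. modulus_le (d j) (1 / real (Suc j)) (\<lambda>t. x t + c * t)) \<longrightarrow>
      (\<exists>(J, \<alpha>)\<in>F. a < cost N (X 1) J \<alpha> (\<lambda>t. x t + c * t))"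
      using k unfolding ok_def by blast
  qed
qed

text \<open>The windows \<open>d j\<close> are fixed for every \<open>j\<close> in advance, because
  the number \<open>k\<close> of conditions is only known after the covering. A union bound over
  \<open>k + 1\<close> modulus failures and the finitely many half-spaces then has a prefactor
  independent of \<open>n\<close>.\<close>

lemma closed_set_probability:
  assumes C: "closedin (J1_topology T) C" and a: "ereal a < (INF x\<in>C. rate_J N (X 1) T c x)"
  shows "\<exists>B. \<forall>n\<ge>1. prob {\<omega> \<in> space N. net_input T c X n \<omega> \<in> C} \<le> B * exp (- (real n * a))"
proof -
  have "\<exists>d B. 0 < d \<and> (\<forall>n\<ge>1. \<exists>E\<in>events. prob E \<le> B * exp (- (real n * a)) \<and>
    (\<forall>\<omega>\<in>space N - E. arrival_path (mean_path n \<omega>) \<longrightarrow> modulus_le d (1 / real (Suc j)) (mean_path n \<omega>)))"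
    for j :: nat
  proof -
    have "0 < 1 / real (Suc j)" by simp
    from modulus_probability[OF this, of a] show ?thesis
      unfolding modulus_le_def by metis
  qed
  then obtain d B where d: "\<And>j. 0 < d j" and B: "\<And>j n. 1 \<le> n \<Longrightarrow>
    \<exists>E\<in>events. prob E \<le> B j * exp (- (real n * a)) \<and>
    (\<forall>\<omega>\<in>space N - E. arrival_path (mean_path n \<omega>) \<longrightarrow> modulus_le (d j) (1 / real (Suc j)) (mean_path n \<omega>))"
    by metis
  obtain k F where F: "finite F" "\<forall>p\<in>F. finite (fst p) \<and> fst p \<subseteq> {0<..T}"
    and cover: "\<forall>x\<in>C. arrival_path (\<lambda>t. x t + c * t) \<longrightarrow>
      (\<forall>j\<le>k. modulus_le (d j) (1 / real (Suc j)) (\<lambda>t. x t + c * t)) \<longrightarrow>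
      (\<exists>(J, \<alpha>)\<in>F. a < cost N (X 1) J \<alpha> (\<lambda>t. x t + c * t))"
    using closed_set_cover[OF C a, of d, OF d] by (elim exE conjE)
  show ?thesis
  proof (intro exI[of _ "(\<Sum>j\<le>k. B j) + real (card F)"] allI impI)
    fix n :: nat assume n: "1 \<le> n"
    obtain E where E: "\<And>j. E j \<in> events" "\<And>j. prob (E j) \<le> B j * exp (- (real n * a))"
      "\<And>j \<omega>. \<omega> \<in> space N - E j \<Longrightarrow> arrival_path (mean_path n \<omega>) \<Longrightarrow>
        modulus_le (d j) (1 / real (Suc j)) (mean_path n \<omega>)"
    proof -
      have "\<forall>j. \<exists>E. E \<in> events \<and> prob E \<le> B j * exp (- (real n * a)) \<and>
          (\<forall>\<omega>\<in>space N - E. arrival_path (mean_path n \<omega>) \<longrightarrow>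
            modulus_le (d j) (1 / real (Suc j)) (mean_path n \<omega>))"
        using B[OF n] by blast
      from choice[OF this] that show ?thesis by blast
    qed
    define H where "H = (\<lambda>(J, \<alpha>). {\<omega> \<in> space N. a < cost N (X 1) J \<alpha> (mean_path n \<omega>)})"
    have H: "H p \<in> events" "prob (H p) \<le> exp (- (real n * a))" if "p \<in> F" for p
    proof -
      obtain J \<alpha> where p: "p = (J, \<alpha>)" by (cases p)
      have J: "finite J" "J \<subseteq> {0<..T}" using bspec[OF F(2) that] p by auto
      show "H p \<in> events" "prob (H p) \<le> exp (- (real n * a))"
        unfolding H_def p prod.case using halfspace_probability[OF J n] by blast+
    qed
    let ?U = "(\<Union>j\<in>{..k}. E j) \<union> (\<Union>p\<in>F. H p)"
    have U: "?U \<in> events" using E(1) H(1) F(1) by (intro sets.Un sets.finite_UN) auto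
    have "prob {\<omega> \<in> space N. net_input T c X n \<omega> \<in> C} \<le> prob ?U"
    proof (rule finite_measure_mono_AE[OF _ U])
      show "AE \<omega> in N. \<omega> \<in> {\<omega> \<in> space N. net_input T c X n \<omega> \<in> C} \<longrightarrow> \<omega> \<in> ?U"
        using AE_net_input[of n] AE_arrival_path_mean[of n]
      proof eventually_elim
        case (elim \<omega>)
        show ?case
        proof (intro impI, rule ccontr)
          assume \<omega>: "\<omega> \<in> {\<omega> \<in> space N. net_input T c X n \<omega> \<in> C}" and notU: "\<omega> \<notin> ?U"
          let ?x = "net_input T c X n \<omega>"
          have mod: "modulus_le (d j) (1 / real (Suc j)) (\<lambda>t. ?x t + c * t)" if "j \<le> k" for j
          proof -
            have "modulus_le (d j) (1 / real (Suc j)) (mean_path n \<omega>)"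
              using notU \<omega> that elim by (intro E(3)) auto
            then show ?thesis by (simp only: modulus_le_def net_input_eq cong: ball_cong)
          qed
          obtain J \<alpha> where J: "(J, \<alpha>) \<in> F" "a < cost N (X 1) J \<alpha> (\<lambda>t. ?x t + c * t)"
            using cover[rule_format, of ?x, OF _ elim(1) mod] \<omega> by auto
          have "(\<Sum>t\<in>J. \<alpha> t * (?x t + c * t)) = (\<Sum>t\<in>J. \<alpha> t * mean_path n \<omega> t)"
          proof (intro sum.cong refl)
            fix t assume "t \<in> J"
            then have "t \<in> {0..T}" using bspec[OF F(2) J(1)] by auto
            then show "\<alpha> t * (?x t + c * t) = \<alpha> t * mean_path n \<omega> t" by (simp only: net_input_eq)
          qed
          then have "\<omega> \<in> H (J, \<alpha>)" using J(2) \<omega> by (simp add: H_def cost_def)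
          then show False using notU J(1) by blast
        qed
      qed
    qed
    also have "\<dots> \<le> prob (\<Union>j\<in>{..k}. E j) + prob (\<Union>p\<in>F. H p)"
      using E(1) H(1) F(1) by (intro measure_Un_le sets.finite_UN) auto
    also have "\<dots> \<le> (\<Sum>j\<le>k. prob (E j)) + (\<Sum>p\<in>F. prob (H p))"
      using E(1) H(1) F(1) by (intro add_mono finite_measure_subadditive_finite) auto
    also have "\<dots> \<le> (\<Sum>j\<le>k. B j * exp (- (real n * a))) + (\<Sum>p\<in>F. exp (- (real n * a)))"
      using E(2) H(2) by (intro add_mono sum_mono) auto
    also have "\<dots> = ((\<Sum>j\<le>k. B j) + real (card F)) * exp (- (real n * a))"
      by (simp add: sum_distrib_right distrib_right)
    finally show "prob {\<omega> \<in> space N. net_input T c X n \<omega> \<in> C} \<le>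
        ((\<Sum>j\<le>k. B j) + real (card F)) * exp (- (real n * a))" .
  qed
qed

lemma net_input_upper:
  assumes "closedin (J1_topology T) C"
  shows "limsup (\<lambda>n. ereal (1 / real n) * log_prob (prob {\<omega> \<in> space N. net_input T c X n \<omega> \<in> C}))
    \<le> - (INF x\<in>C. rate_J N (X 1) T c x)"
proof -
  let ?l = "limsup (\<lambda>n. ereal (1 / real n) * log_prob (prob {\<omega> \<in> space N. net_input T c X n \<omega> \<in> C}))"
  have "?l \<le> - ereal a" if less: "ereal a < (INF x\<in>C. rate_J N (X 1) T c x)" for a
  proof -
    obtain B where "\<And>n. 1 \<le> n \<Longrightarrow>
        prob {\<omega> \<in> space N. net_input T c X n \<omega> \<in> C} \<le> B * exp (- (real n * a))"
      using closed_set_probability[OF assms less] by blast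
    then show ?thesis by (rule limsup_log_prob_le[OF _ measure_nonneg])
  qed
  then show ?thesis by (rule ereal_le_uminusI)
qed

section \<open>Lower bound for open sets\<close>

text \<open>Closeness on a grid fine for \<open>\<phi>\<close> already gives uniform closeness:
  between neighbouring grid points the mean path is squeezed by monotonicity, so only the modulus of
  the deterministic \<open>\<phi>\<close> enters. Grid error and oscillation of at most
  \<open>r / 4\<close> each keep the path inside the ball.\<close>

lemma net_input_lower_point:
  assumes G: "openin (J1_topology T) G" and x: "x \<in> G"
    and I: "rate_J N (X 1) T c x \<le> ereal I" and \<delta>: "0 < \<delta>"
  shows "eventually (\<lambda>n. exp (- (real n * (I + \<delta>))) / 2
    \<le> prob {\<omega> \<in> space N. net_input T c X n \<omega> \<in> G}) sequentially"
proof -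
  interpret J: Metric_space "D_space T" "J1_dist T" by (rule J1_metric)
  obtain r where r: "0 < r" "J.mball x r \<subseteq> G"
    using G x unfolding J1_topology_def J.openin_mtopology by blast
  have xD: "x \<in> D_space T"
    using openin_subset[OF G] x T_pos by (auto simp: topspace_J1_topology)
  define \<phi> where "\<phi> = (\<lambda>t. x t + c * t)"
  have cost: "cost N (X 1) J \<alpha> \<phi> \<le> I" if "finite J" "J \<noteq> {}" "J \<subseteq> {0<..T}" for J \<alpha>
    using I that unfolding rate_J_le_cost \<phi>_def by blast
  have lim0: "(\<phi> \<longlongrightarrow> \<phi> 0) (at_right 0)"
    using path_right_limit_0[OF xD] by (simp add: \<phi>_def)
  have "arrival_path \<phi>" by (rule cost_bounded_regular(1)[OF cost lim0])
  then have \<phi>0: "\<phi> 0 = 0" and mono_\<phi>: "mono_on {0..T} \<phi>" by (auto simp: arrival_path_def)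
  obtain d where d: "0 < d" and mod: "\<And>s t. s \<in> {0..T} \<Longrightarrow> t \<in> {0..T} \<Longrightarrow> s \<le> t \<Longrightarrow> t \<le> s + d \<Longrightarrow>
      \<phi> t - \<phi> s \<le> r / 4"
    using cost_bounded_modulus[of "r / 4" I] r(1) cost lim0
    by (metis divide_pos_pos zero_less_numeral)
  obtain p :: nat where p: "T / d < real p" using reals_Archimedean2 by blast
  have p0: "0 < real p" using p T_pos d by (meson divide_pos_pos less_trans)
  define h where "h = T / real p"
  have h: "0 < h" "h \<le> d" "real p * h = T" using p T_pos d p0 by (auto simp: h_def field_simps)
  \<comment> \<open>Time 0 is left out because costs sample only \<open>(0,T]\<close>; there the
    mean path and \<open>\<phi>\<close> both vanish.\<close>
  define J where "J = (\<lambda>j. real j * h) ` {1..p}"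
  have grid_in: "real j * h \<in> {0..T}" if "j \<le> p" for j
  proof -
    have "real j * h \<le> real p * h" using that h by (intro mult_right_mono) auto
    then show ?thesis using h by simp
  qed
  have J: "finite J" "J \<noteq> {}" "J \<subseteq> {0<..T}"
    using grid_in h p0 by (auto simp: J_def)
  then have J': "J \<subseteq> {0..T}" by auto
  interpret V: iid_vectors N "{0..T}" X J by (rule sample_vectors[OF J(1) J'])
  have "eventually (\<lambda>n. exp (- real n * (I + \<delta>)) / 2
    \<le> prob {\<omega> \<in> space N. \<forall>l\<in>J. \<bar>(\<Sum>i=1..n. X i \<omega> l) / real n - \<phi> l\<bar> < r / 4}) sequentially"
    using cost[OF J] r(1) \<delta> by (intro V.cramer_lower_bound) (auto simp: cost_mgf[OF J(1) J'])
  then show ?thesis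
  proof eventually_elim
    case (elim n)
    have "prob {\<omega> \<in> space N. \<forall>l\<in>J. \<bar>(\<Sum>i=1..n. X i \<omega> l) / real n - \<phi> l\<bar> < r / 4} \<le>
        prob {\<omega> \<in> space N. net_input T c X n \<omega> \<in> G}"
    proof (rule finite_measure_mono_AE[OF _ sets_net_input_open[OF G]])
      show "AE \<omega> in N. \<omega> \<in> {\<omega> \<in> space N. \<forall>l\<in>J. \<bar>(\<Sum>i=1..n. X i \<omega> l) / real n - \<phi> l\<bar> < r / 4} \<longrightarrow>
          \<omega> \<in> {\<omega> \<in> space N. net_input T c X n \<omega> \<in> G}"
        using AE_arrival_path_mean[of n]
      proof eventually_elim
        case (elim \<omega>)
        show ?case
        proof safe
          assume \<omega>: "\<omega> \<in> space N" and near: "\<forall>l\<in>J. \<bar>(\<Sum>i=1..n. X i \<omega> l) / real n - \<phi> l\<bar> < r / 4"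
          let ?S = "mean_path n \<omega>"
          have S0: "?S 0 = 0" and mono_S: "mono_on {0..T} ?S"
            using elim by (auto simp: arrival_path_def)
          have grid: "\<bar>?S (real j * h) - \<phi> (real j * h)\<bar> \<le> r / 4" if "j \<le> p" for j
          proof (cases "j = 0")
            case True
            then show ?thesis using r(1) by (simp only: of_nat_0 mult_zero_left S0 \<phi>0)
          next
            case False
            then have "real j * h \<in> J" using that by (auto simp: J_def)
            then show ?thesis using near by (force simp: less_imp_le)
          qed
          have "\<bar>?S t - \<phi> t\<bar> \<le> r / 2" if t: "t \<in> {0..T}" for t
          proof (cases "t = T")
            case True
            then show ?thesis using grid[of p] h(3) r(1) by simp
          next
            case False
            define j where "j = nat \<lfloor>t / h\<rfloor>"
            have "0 \<le> t / h" "t / h < real p" using t False h p0 by (auto simp: h_def field_simps)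
            then have j: "Suc j \<le> p" "real j \<le> t / h" "t / h < real (Suc j)"
              unfolding j_def by linarith+
            define u where "u = real j * h"
            define v where "v = real (Suc j) * h"
            have uv: "u \<le> t" "t \<le> v" "v \<le> u + d"
              using j h by (auto simp: u_def v_def field_simps)
            have in_: "u \<in> {0..T}" "v \<in> {0..T}"
              using grid_in[of j] grid_in[of "Suc j"] j(1) by (auto simp: u_def v_def)
            have "\<bar>?S u - \<phi> u\<bar> \<le> r / 4" "\<bar>?S v - \<phi> v\<bar> \<le> r / 4"
              unfolding u_def v_def using j(1) by (intro grid; simp)+
            moreover have "?S u \<le> ?S t" "?S t \<le> ?S v"
              by (rule mono_onD[OF mono_S in_(1) t uv(1)], rule mono_onD[OF mono_S t in_(2) uv(2)])
            moreover have "\<phi> v - \<phi> t \<le> r / 4" "\<phi> t - \<phi> u \<le> r / 4"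
              using uv in_ t by (intro mod; simp)+
            ultimately show ?thesis by linarith
          qed
          then have "J1_dist T x (net_input T c X n \<omega>) \<le> r / 2"
            using r(1) by (intro J1_dist_le_uniform xD net_input_in_D_space \<omega>)
              (auto simp: \<phi>_def net_input_def abs_minus_commute algebra_simps)
          then show "net_input T c X n \<omega> \<in> G"
            using r xD net_input_in_D_space[OF \<omega>, of n] by (intro subsetD[OF r(2)]) auto
        qed
      qed
    qed
    with elim show ?case by simp
  qed
qed

lemma net_input_lower:
  assumes G: "openin (J1_topology T) G"
  shows "- (INF x\<in>G. rate_J N (X 1) T c x)
    \<le> liminf (\<lambda>n. ereal (1 / real n) * log_prob (prob {\<omega> \<in> space N. net_input T c X n \<omega> \<in> G}))"
proof -
  let ?l = "liminf (\<lambda>n. ereal (1 / real n) * log_prob (prob {\<omega> \<in> space N. net_input T c X n \<omega> \<in> G}))"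
  have "- ?l \<le> rate_J N (X 1) T c x" if x: "x \<in> G" for x
  proof (cases "rate_J N (X 1) T c x")
    case (real I)
    have "- ereal (I + \<delta>) \<le> ?l" if "0 < \<delta>" for \<delta>
      using liminf_log_prob_ge[OF net_input_lower_point[OF G x _ that, of I]] real by simp
    then show ?thesis unfolding real by (rule ereal_uminus_leI)
  next
    case MInf
    then show ?thesis using rate_J_nonneg[OF prob_space_axioms T_pos, of "X 1" c x] by simp
  qed simp
  then have "- ?l \<le> (INF x\<in>G. rate_J N (X 1) T c x)" by (rule INF_greatest)
  then show ?thesis by (subst ereal_uminus_le_reorder)
qed

theorem net_input_LDP: "LDP_speed_n N (J1_topology T) (net_input T c X) (rate_J N (X 1) T c)"
  unfolding LDP_speed_n_def
  using net_input_measurable net_input_upper net_input_lower rate_J_nonneg[OF prob_space_axioms T_pos]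
  by blast

end

section \<open>The arrival process\<close>

lemma sum_indicator_eq_card:
  assumes "finite I"
  shows "(\<Sum>k\<in>I. indicator S (a k) :: real) = real (card {k \<in> I. a k \<in> S})"
  using assms by (simp add: indicator_def sum.If_cases Int_def)

text \<open>Also correct for infinitely many arrivals: the divergent sum and the cardinality of an
  infinite set both default to 0.\<close>

lemma arrival_count_eq_card:
  "arrival_count \<Delta> \<xi> \<omega> t = real (card {k. of_int k * \<Delta> + \<xi> k \<omega> \<in> {0<..t}})"
proof -
  let ?K = "{k. of_int k * \<Delta> + \<xi> k \<omega> \<in> {0<..t}}"
  have "arrival_count \<Delta> \<xi> \<omega> t = (\<Sum>\<^sub>\<infinity>k\<in>?K. 1)"
    unfolding arrival_count_def by (rule infsum_cong_neutral) auto
  then show ?thesis by simp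
qed

lemma card_exhaustion:
  fixes K :: "int set"
  assumes "finite K"
  shows "eventually (\<lambda>n. {k \<in> {- int n..int n}. k \<in> K} = K) sequentially"
proof -
  define m where "m = nat (Max (insert 0 (abs ` K)))"
  have "\<bar>k\<bar> \<le> int m" if "k \<in> K" for k
    using that assms by (auto simp: m_def intro!: Max_ge)
  then have "{k \<in> {- int n..int n}. k \<in> K} = K" if "m \<le> n" for n
    using that by fastforce
  then show ?thesis unfolding eventually_sequentially by blast
qed

text \<open>The supremum over symmetric windows is the true cardinality in
  \<open>[0,\<infinity>]\<close>, and \<open>enn2real\<close> sends infinity to 0 just as
  \<open>card\<close> does. The count thereby becomes a measurable function of countably many finite
  counts.\<close>

lemma enn2real_SUP_card:
  fixes K :: "int set"
  shows "enn2real (SUP n. ennreal (real (card {k \<in> {- int n..int n}. k \<in> K}))) = real (card K)"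
    and "(SUP n. ennreal (real (card {k \<in> {- int n..int n}. k \<in> K}))) < \<infinity> \<Longrightarrow> finite K"
proof -
  let ?c = "\<lambda>n. card {k \<in> {- int n..int n}. k \<in> K}"
  have fin: "(SUP n. ennreal (real (?c n))) = ennreal (real (card K))" if K: "finite K"
  proof (rule antisym)
    show "(SUP n. ennreal (real (?c n))) \<le> ennreal (real (card K))"
      using K by (intro SUP_least ennreal_leI) (auto intro!: card_mono)
    obtain n where "{k \<in> {- int n..int n}. k \<in> K} = K"
      using card_exhaustion[OF K] by (auto simp: eventually_sequentially)
    then have "ennreal (real (card K)) = ennreal (real (?c n))" by simp
    also have "\<dots> \<le> (SUP n. ennreal (real (?c n)))" by (rule SUP_upper) simp
    finally show "ennreal (real (card K)) \<le> (SUP n. ennreal (real (?c n)))" .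
  qed
  have inf: "(SUP n. ennreal (real (?c n))) = \<infinity>" if K: "infinite K"
  proof (rule ccontr)
    assume "(SUP n. ennreal (real (?c n))) \<noteq> \<infinity>"
    then have "(SUP n. ennreal (real (?c n))) < top"
      by (simp only: infinity_ennreal_def less_top not_False_eq_True)
    then obtain m :: nat where m: "(SUP n. ennreal (real (?c n))) < of_nat m"
      using ennreal_Ex_less_of_nat by blast
    obtain F where F: "F \<subseteq> K" "finite F" "card F = m"
      using infinite_arbitrarily_large[OF K] by blast
    obtain n where n: "{k \<in> {- int n..int n}. k \<in> F} = F"
      using card_exhaustion[OF F(2)] by (auto simp: eventually_sequentially)
    have "F \<subseteq> {k \<in> {- int n..int n}. k \<in> K}" using n F(1) by blast
    moreover have "finite {k \<in> {- int n..int n}. k \<in> K}"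
      by (rule finite_subset[of _ "{- int n..int n}"]) auto
    ultimately have "m \<le> ?c n" unfolding F(3)[symmetric] by (intro card_mono)
    then have "of_nat m \<le> ennreal (real (?c n))"
      by (simp add: ennreal_of_nat_eq_real_of_nat ennreal_leI)
    also have "\<dots> \<le> (SUP n. ennreal (real (?c n)))" by (rule SUP_upper) simp
    finally show False using m by simp
  qed
  show "enn2real (SUP n. ennreal (real (?c n))) = real (card K)"
  proof (cases "finite K")
    case True
    show ?thesis unfolding fin[OF True] by simp
  next
    case False
    show ?thesis unfolding inf[OF False] using False by simp
  qed
  show "finite K" if "(SUP n. ennreal (real (?c n))) < \<infinity>"
  proof (rule ccontr)
    assume "infinite K"
    show False using that unfolding inf[OF \<open>infinite K\<close>] by simp
  qed
qed

section \<open>Finiteness and exponential moments of the number of arrivals\<close>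

locale scheduled_arrivals = prob_space M for M :: "'a measure" +
  fixes \<Delta> T L :: real and \<xi> :: "int \<Rightarrow> 'a \<Rightarrow> real" and f :: "real \<Rightarrow> real"
  assumes T_pos: "0 < T" and L_nonneg: "0 \<le> L"
    and indep: "indep_vars (\<lambda>_. borel) \<xi> UNIV"
    and f_nonneg: "0 \<le> f x"
    and density: "distributed M lborel (\<xi> k) (\<lambda>x. ennreal (f x))"
    and intensity: "\<And>I u. finite I \<Longrightarrow> u \<in> {0..T} \<Longrightarrow> (\<Sum>k\<in>I. ennreal (f (u - of_int k * \<Delta>))) \<le> ennreal L"
begin

definition arrival :: "int \<Rightarrow> 'a \<Rightarrow> real" where
  "arrival k \<omega> = of_int k * \<Delta> + \<xi> k \<omega>"

definition window :: "nat \<Rightarrow> int set" where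
  "window n = {- int n..int n}"

definition window_count :: "nat \<Rightarrow> real \<Rightarrow> real \<Rightarrow> 'a \<Rightarrow> nat" where
  "window_count n s t \<omega> = card {k \<in> window n. arrival k \<omega> \<in> {s<..t}}"

lemma \<xi>_measurable [measurable]: "\<xi> k \<in> borel_measurable M"
  using indep by (simp add: indep_vars_def)

lemma arrival_measurable [measurable]: "arrival k \<in> borel_measurable M"
  unfolding arrival_def by measurable

lemma window_count_eq: "real (window_count n s t \<omega>) = (\<Sum>k\<in>window n. indicator {s<..t} (arrival k \<omega>))"
  unfolding window_count_def by (subst sum_indicator_eq_card) (auto simp: window_def)

lemma window_count_measurable [measurable]: "(\<lambda>\<omega>. real (window_count n s t \<omega>)) \<in> borel_measurable M"
  unfolding window_count_eq by measurable

lemma arrival_count_SUP: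
  "arrival_count \<Delta> \<xi> \<omega> t = enn2real (SUP n. ennreal (real (window_count n 0 t \<omega>)))"
  unfolding arrival_count_eq_card window_count_def window_def arrival_def
  using enn2real_SUP_card(1)[of "{k. of_int k * \<Delta> + \<xi> k \<omega> \<in> {0<..t}}"] by simp

lemma arrival_count_measurable [measurable]: "(\<lambda>\<omega>. arrival_count \<Delta> \<xi> \<omega> t) \<in> borel_measurable M"
  unfolding arrival_count_SUP by measurable

text \<open>Shifting each integral by \<open>k * \<Delta>\<close> brings all arrivals to the same
  time variable \<open>u\<close>, where the densities add up to at most \<open>L\<close>.\<close>

lemma prob_arrival_sum:
  assumes I: "finite I" and st: "0 \<le> s" "s \<le> t" "t \<le> T"
  shows "(\<Sum>k\<in>I. prob {\<omega> \<in> space M. arrival k \<omega> \<in> {s<..t}}) \<le> L * (t - s)"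
proof -
  have f_meas [measurable]: "(\<lambda>x. ennreal (f x)) \<in> borel_measurable borel"
    using density[of 0] by (simp add: distributed_def)
  have emeasure: "emeasure M {\<omega> \<in> space M. arrival k \<omega> \<in> {s<..t}} =
      (\<integral>\<^sup>+u. ennreal (f (u - of_int k * \<Delta>)) * indicator {s<..t} u \<partial>lborel)" for k
  proof -
    have "emeasure M {\<omega> \<in> space M. arrival k \<omega> \<in> {s<..t}} =
        (\<integral>\<^sup>+\<omega>. indicator {\<omega> \<in> space M. arrival k \<omega> \<in> {s<..t}} \<omega> \<partial>M)"
      by (intro nn_integral_indicator[symmetric]) measurable
    also have "\<dots> = (\<integral>\<^sup>+\<omega>. indicator {s<..t} (of_int k * \<Delta> + \<xi> k \<omega>) \<partial>M)"
      by (intro nn_integral_cong) (auto simp: indicator_def arrival_def)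
    also have "\<dots> = (\<integral>\<^sup>+x. ennreal (f x) * indicator {s<..t} (of_int k * \<Delta> + x) \<partial>lborel)"
      by (rule distributed_nn_integral[OF density, symmetric]) measurable
    also have "\<dots> = (\<integral>\<^sup>+u. ennreal (f (u - of_int k * \<Delta>)) * indicator {s<..t} u \<partial>lborel)"
      by (subst nn_integral_real_affine[where c = 1 and t = "of_int k * \<Delta>"]) simp_all
    finally show ?thesis .
  qed
  have "ennreal (\<Sum>k\<in>I. prob {\<omega> \<in> space M. arrival k \<omega> \<in> {s<..t}}) =
      (\<Sum>k\<in>I. emeasure M {\<omega> \<in> space M. arrival k \<omega> \<in> {s<..t}})"
    by (simp add: emeasure_eq_measure sum_ennreal)
  also have "\<dots> = (\<integral>\<^sup>+u. (\<Sum>k\<in>I. ennreal (f (u - of_int k * \<Delta>)) * indicator {s<..t} u) \<partial>lborel)"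
    unfolding emeasure by (intro nn_integral_sum[symmetric]) measurable
  also have "\<dots> \<le> (\<integral>\<^sup>+u. ennreal L * indicator {s<..t} u \<partial>lborel)"
  proof (rule nn_integral_mono)
    fix u :: real
    show "(\<Sum>k\<in>I. ennreal (f (u - of_int k * \<Delta>)) * indicator {s<..t} u) \<le> ennreal L * indicator {s<..t} u"
      using intensity[OF I, of u] st by (auto simp: indicator_def)
  qed
  also have "\<dots> = ennreal (L * (t - s))"
    using st L_nonneg by (simp add: nn_integral_cmult_indicator ennreal_mult)
  finally show ?thesis
    using st L_nonneg by (subst (asm) ennreal_le_iff) auto
qed

text \<open>By monotone convergence the expected number of arrivals, as a value in
  \<open>[0,\<infinity>]\<close>, is at most \<open>L * T\<close>.\<close>

lemma AE_finite_arrivals: "AE \<omega> in M. finite {k. arrival k \<omega> \<in> {0<..T}}"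
proof -
  let ?N = "\<lambda>\<omega>. SUP n. ennreal (real (window_count n 0 T \<omega>))"
  have "(\<integral>\<^sup>+\<omega>. ?N \<omega> \<partial>M) = (SUP n. \<integral>\<^sup>+\<omega>. ennreal (real (window_count n 0 T \<omega>)) \<partial>M)"
  proof (rule nn_integral_monotone_convergence_SUP)
    show "incseq (\<lambda>n \<omega>. ennreal (real (window_count n 0 T \<omega>)))"
      unfolding incseq_def le_fun_def window_count_def
    proof (intro allI impI ennreal_leI of_nat_mono card_mono)
      show "finite {k \<in> window n. arrival k \<omega> \<in> {0<..T}}" for n \<omega>
        by (rule finite_subset[of _ "window n"]) (auto simp: window_def)
    qed (auto simp: window_def)
  qed measurable
  also have "\<dots> \<le> ennreal (L * T)"
  proof (rule SUP_least)
    fix n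
    have "(\<integral>\<^sup>+\<omega>. ennreal (real (window_count n 0 T \<omega>)) \<partial>M) =
        (\<integral>\<^sup>+\<omega>. (\<Sum>k\<in>window n. indicator {\<omega> \<in> space M. arrival k \<omega> \<in> {0<..T}} \<omega>) \<partial>M)"
    proof (intro nn_integral_cong)
      fix \<omega> assume "\<omega> \<in> space M"
      then have "(\<Sum>k\<in>window n. indicator {\<omega> \<in> space M. arrival k \<omega> \<in> {0<..T}} \<omega>) =
          (\<Sum>k\<in>window n. ennreal (indicator {0<..T} (arrival k \<omega>)))"
        by (intro sum.cong) (auto simp: indicator_def)
      also have "\<dots> = ennreal (\<Sum>k\<in>window n. indicator {0<..T} (arrival k \<omega>))"
        by (rule sum_ennreal) simp
      finally show "ennreal (real (window_count n 0 T \<omega>)) =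
          (\<Sum>k\<in>window n. indicator {\<omega> \<in> space M. arrival k \<omega> \<in> {0<..T}} \<omega>)"
        by (simp only: window_count_eq)
    qed
    also have "\<dots> = (\<Sum>k\<in>window n. emeasure M {\<omega> \<in> space M. arrival k \<omega> \<in> {0<..T}})"
      by (subst nn_integral_sum) (auto intro!: sum.cong nn_integral_indicator)
    also have "\<dots> = ennreal (\<Sum>k\<in>window n. prob {\<omega> \<in> space M. arrival k \<omega> \<in> {0<..T}})"
      by (simp add: emeasure_eq_measure sum_ennreal)
    also have "\<dots> \<le> ennreal (L * T)"
      using prob_arrival_sum[of "window n" 0 T] T_pos by (intro ennreal_leI) (simp add: window_def)
    finally show "(\<integral>\<^sup>+\<omega>. ennreal (real (window_count n 0 T \<omega>)) \<partial>M) \<le> ennreal (L * T)" .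
  qed
  finally have "(\<integral>\<^sup>+\<omega>. ?N \<omega> \<partial>M) \<noteq> \<infinity>" by (auto simp: top_unique)
  then have "AE \<omega> in M. ?N \<omega> \<noteq> \<infinity>"
    by (intro nn_integral_PInf_AE) measurable
  then show ?thesis
  proof eventually_elim
    case (elim \<omega>)
    then show ?case
      unfolding window_count_def window_def infinity_ennreal_def less_top
      by (intro enn2real_SUP_card(2)) (simp only: mem_Collect_eq infinity_ennreal_def)
  qed
qed

text \<open>Once the set of arrivals is finite, the window counts do not merely converge but become
  exact; the default value 0 of the count is then out of the way.\<close>

lemma AE_increment:
  assumes st: "0 \<le> s" "s \<le> t" "t \<le> T"
  shows "AE \<omega> in M. eventually (\<lambda>n. real (window_count n s t \<omega>) =
    arrival_count \<Delta> \<xi> \<omega> t - arrival_count \<Delta> \<xi> \<omega> s) sequentially"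
  using AE_finite_arrivals
proof eventually_elim
  case (elim \<omega>)
  let ?K = "\<lambda>a b. {k. arrival k \<omega> \<in> {a<..b}}"
  have fin: "finite (?K a b)" if "0 \<le> a" "b \<le> T" for a b
    by (rule finite_subset[OF _ elim]) (use that in auto)
  have "?K 0 t = ?K 0 s \<union> ?K s t" "?K 0 s \<inter> ?K s t = {}" using st by auto
  then have "card (?K 0 t) = card (?K 0 s) + card (?K s t)"
    using fin st by (simp add: card_Un_disjoint)
  then have eq: "arrival_count \<Delta> \<xi> \<omega> t - arrival_count \<Delta> \<xi> \<omega> s = real (card (?K s t))"
    by (simp add: arrival_count_eq_card arrival_def)
  have "eventually (\<lambda>n. {k \<in> {- int n..int n}. k \<in> ?K s t} = ?K s t) sequentially"
    using fin st by (intro card_exhaustion) auto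
  then show ?case
  proof eventually_elim
    case (elim n)
    then show ?case by (simp add: eq window_count_def window_def)
  qed
qed

lemma AE_increment_nonneg:
  assumes "0 \<le> s" "s \<le> t" "t \<le> T"
  shows "AE \<omega> in M. arrival_count \<Delta> \<xi> \<omega> s \<le> arrival_count \<Delta> \<xi> \<omega> t"
  using AE_increment[OF assms]
proof eventually_elim
  case (elim \<omega>)
  then obtain n where "real (window_count n s t \<omega>) = arrival_count \<Delta> \<xi> \<omega> t - arrival_count \<Delta> \<xi> \<omega> s"
    by (auto simp: eventually_sequentially)
  then show ?case by (metis diff_ge_0_iff_ge of_nat_0_le_iff)
qed

lemma increment_mgf:
  assumes st: "0 \<le> s" "s \<le> t" "t \<le> T" and \<theta>: "0 \<le> \<theta>"
  shows "(\<integral>\<^sup>+\<omega>. ennreal (exp (\<theta> * (arrival_count \<Delta> \<xi> \<omega> t - arrival_count \<Delta> \<xi> \<omega> s))) \<partial>M)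
    \<le> ennreal (exp ((exp \<theta> - 1) * L * (t - s)))"
proof -
  have window: "(\<integral>\<^sup>+\<omega>. ennreal (exp (\<theta> * real (window_count n s t \<omega>))) \<partial>M)
      \<le> ennreal (exp ((exp \<theta> - 1) * L * (t - s)))" for n
  proof -
    define p where "p k = prob {\<omega> \<in> space M. arrival k \<omega> \<in> {s<..t}}" for k
    define Z where "Z k \<omega> = exp (\<theta> * indicator {s<..t} (arrival k \<omega>))" for k \<omega>
    have fin: "finite (window n)" by (simp add: window_def)
    have Z_eq: "Z k \<omega> = 1 + (exp \<theta> - 1) * indicator {\<omega> \<in> space M. arrival k \<omega> \<in> {s<..t}} \<omega>"
      if "\<omega> \<in> space M" for k \<omega>
      using that by (auto simp: Z_def indicator_def)
    have ind: "indep_vars (\<lambda>_. borel) Z (window n)"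
    proof -
      have "indep_vars (\<lambda>_. borel) (\<lambda>k \<omega>. exp (\<theta> * indicator {s<..t} (of_int k * \<Delta> + \<xi> k \<omega>))) (window n)"
        by (rule indep_vars_compose2[OF indep_vars_subset[OF indep]]) measurable
      then show ?thesis by (simp add: Z_def[abs_def] arrival_def)
    qed
    have E: "{\<omega> \<in> space M. arrival k \<omega> \<in> {s<..t}} \<in> events" for k by measurable
    have int: "integrable M (Z k)" and exp_Z: "expectation (Z k) = 1 + (exp \<theta> - 1) * p k" for k
    proof -
      have "integrable M (\<lambda>\<omega>. 1 + (exp \<theta> - 1) * indicator {\<omega> \<in> space M. arrival k \<omega> \<in> {s<..t}} \<omega>)"
        using E[of k] by (intro Bochner_Integration.integrable_add integrable_mult_right
            integrable_real_indicator) (auto simp: emeasure_eq_measure)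
      then show "integrable M (Z k)"
        using Z_eq by (subst Bochner_Integration.integrable_cong[OF refl]) auto
      have "expectation (Z k) = expectation (\<lambda>\<omega>. 1 + (exp \<theta> - 1) * indicator {\<omega> \<in> space M. arrival k \<omega> \<in> {s<..t}} \<omega>)"
        using Z_eq by (intro Bochner_Integration.integral_cong) auto
      also have "\<dots> = 1 + (exp \<theta> - 1) * p k"
        using E[of k] by (subst Bochner_Integration.integral_add)
          (auto simp: p_def prob_space emeasure_eq_measure intro!: integrable_mult_right integrable_real_indicator)
      finally show "expectation (Z k) = 1 + (exp \<theta> - 1) * p k" .
    qed
    have "(\<integral>\<^sup>+\<omega>. ennreal (exp (\<theta> * real (window_count n s t \<omega>))) \<partial>M) =
        (\<integral>\<^sup>+\<omega>. ennreal (\<Prod>k\<in>window n. Z k \<omega>) \<partial>M)"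
      by (simp add: window_count_eq sum_distrib_left exp_sum[OF fin] Z_def)
    also have "\<dots> = ennreal (expectation (\<lambda>\<omega>. \<Prod>k\<in>window n. Z k \<omega>))"
      using indep_vars_integrable[OF fin ind int]
      by (intro nn_integral_eq_integral) (auto simp: Z_def intro!: prod_nonneg)
    also have "expectation (\<lambda>\<omega>. \<Prod>k\<in>window n. Z k \<omega>) = (\<Prod>k\<in>window n. 1 + (exp \<theta> - 1) * p k)"
      by (simp add: indep_vars_lebesgue_integral[OF fin ind int] exp_Z)
    \<comment> \<open>Each Bernoulli factor is bounded by the matching Poisson factor, so that the
      product depends only on the total mean.\<close>
    also have "\<dots> \<le> (\<Prod>k\<in>window n. exp ((exp \<theta> - 1) * p k))"
      using \<theta> by (intro prod_mono conjI exp_ge_add_one_self add_nonneg_nonneg mult_nonneg_nonneg)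
        (auto simp: p_def)
    also have "\<dots> = exp ((exp \<theta> - 1) * (\<Sum>k\<in>window n. p k))"
      by (simp add: exp_sum[OF fin] sum_distrib_left)
    also have "\<dots> \<le> exp ((exp \<theta> - 1) * (L * (t - s)))"
      using prob_arrival_sum[OF fin st] \<theta>
      by (intro exp_le_cancel_iff[THEN iffD2] mult_left_mono) (auto simp: p_def)
    finally show ?thesis by (simp add: mult.assoc ennreal_leI)
  qed
  \<comment> \<open>Fatou's lemma passes from windows to all indices, the bound being uniform in the
    window; no dominating function has to be found.\<close>
  have "(\<integral>\<^sup>+\<omega>. ennreal (exp (\<theta> * (arrival_count \<Delta> \<xi> \<omega> t - arrival_count \<Delta> \<xi> \<omega> s))) \<partial>M) =
      (\<integral>\<^sup>+\<omega>. liminf (\<lambda>n. ennreal (exp (\<theta> * real (window_count n s t \<omega>)))) \<partial>M)"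
  proof (rule nn_integral_cong_AE)
    show "AE \<omega> in M. ennreal (exp (\<theta> * (arrival_count \<Delta> \<xi> \<omega> t - arrival_count \<Delta> \<xi> \<omega> s))) =
        liminf (\<lambda>n. ennreal (exp (\<theta> * real (window_count n s t \<omega>))))"
      using AE_increment[OF st]
    proof eventually_elim
      case (elim \<omega>)
      then have "(\<lambda>n. ennreal (exp (\<theta> * real (window_count n s t \<omega>)))) \<longlonglongrightarrow>
          ennreal (exp (\<theta> * (arrival_count \<Delta> \<xi> \<omega> t - arrival_count \<Delta> \<xi> \<omega> s)))"
        by (intro tendsto_eventually) (auto elim!: eventually_mono)
      then show ?case by (intro lim_imp_Liminf[symmetric]) auto
    qed
  qed
  also have "\<dots> \<le> liminf (\<lambda>n. \<integral>\<^sup>+\<omega>. ennreal (exp (\<theta> * real (window_count n s t \<omega>))) \<partial>M)"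
    by (rule nn_integral_liminf) measurable
  also have "\<dots> \<le> ennreal (exp ((exp \<theta> - 1) * L * (t - s)))"
    using window by (intro Liminf_le) (auto intro: always_eventually)
  finally show ?thesis .
qed

end

section \<open>Transfer from the arrival process to its independent copies\<close>

text \<open>The process on \<open>M\<close> enters through its law alone: each property in question
  is an event or an integral depending on at most finitely many coordinates, hence measurable for
  the product \<open>\<sigma>\<close>-algebra. Cadlag paths come from the copies themselves.\<close>

lemma iid_copies_paths:
  fixes \<xi> :: "int \<Rightarrow> 'a \<Rightarrow> real"
  assumes A: "scheduled_arrivals M \<Delta> T L \<xi> f" and N: "prob_space N"
    and copies: "iid_copies N T X M (arrival_count \<Delta> \<xi>)"
  shows "iid_paths N T X L" and "rate_J M (arrival_count \<Delta> \<xi>) T c = rate_J N (X 1) T c"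
proof -
  interpret A: scheduled_arrivals M \<Delta> T L \<xi> f by (rule A)
  interpret N: prob_space N by (rule N)
  let ?P = "Pi\<^sub>M {0..T} (\<lambda>_. borel :: real measure)"
  let ?A = "\<lambda>\<omega>. \<lambda>t\<in>{0..T}. arrival_count \<Delta> \<xi> \<omega> t"
  have ind: "N.indep_vars (\<lambda>_. ?P) X {1..}"
    and law: "\<And>i. 1 \<le> i \<Longrightarrow> distr N ?P (X i) = distr M ?P ?A"
    and paths: "\<And>i \<omega>. 1 \<le> i \<Longrightarrow> \<omega> \<in> space N \<Longrightarrow> X i \<omega> \<in> D_space T"
    using copies by (auto simp: iid_copies_def)
  have X1: "X 1 \<in> N \<rightarrow>\<^sub>M ?P" using ind by (simp add: N.indep_vars_def)
  have A_meas: "?A \<in> M \<rightarrow>\<^sub>M ?P" by (intro measurable_restrict) measurable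
  have coord: "(\<lambda>x. x t) \<in> borel_measurable ?P" if "t \<in> {0..T}" for t
    using that by (rule measurable_component_singleton)
  have AE_transfer: "AE \<omega> in N. Q (X 1 \<omega>)"
    if "{x \<in> space ?P. Q x} \<in> sets ?P" "AE \<omega> in M. Q (?A \<omega>)" for Q
  proof -
    have "AE x in distr M ?P ?A. Q x" by (rule AE_distr_iff[OF A_meas that(1), THEN iffD2, OF that(2)])
    then have "AE x in distr N ?P (X 1). Q x" by (simp only: law[OF order.refl])
    then show ?thesis by (rule AE_distr_iff[OF X1 that(1), THEN iffD1])
  qed
  have nn_transfer: "(\<integral>\<^sup>+\<omega>. g (X 1 \<omega>) \<partial>N) = (\<integral>\<^sup>+\<omega>. g (?A \<omega>) \<partial>M)" if "g \<in> borel_measurable ?P" for g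
  proof -
    have "(\<integral>\<^sup>+\<omega>. g (X 1 \<omega>) \<partial>N) = (\<integral>\<^sup>+x. g x \<partial>distr N ?P (X 1))"
      using X1 that by (intro nn_integral_distr[symmetric]) simp_all
    also have "\<dots> = (\<integral>\<^sup>+x. g x \<partial>distr M ?P ?A)" by (simp only: law[OF order.refl])
    also have "\<dots> = (\<integral>\<^sup>+\<omega>. g (?A \<omega>) \<partial>M)"
      using A_meas that by (intro nn_integral_distr) simp_all
    finally show ?thesis .
  qed
  have int_transfer: "(\<integral>\<omega>. g (X 1 \<omega>) \<partial>N) = (\<integral>\<omega>. g (?A \<omega>) \<partial>M)" if "g \<in> borel_measurable ?P"
    for g :: "(real \<Rightarrow> real) \<Rightarrow> real"
  proof -
    have "(\<integral>\<omega>. g (X 1 \<omega>) \<partial>N) = (\<integral>x. g x \<partial>distr N ?P (X 1))"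
      by (rule integral_distr[OF X1 that, symmetric])
    also have "\<dots> = (\<integral>x. g x \<partial>distr M ?P ?A)" by (simp only: law[OF order.refl])
    also have "\<dots> = (\<integral>\<omega>. g (?A \<omega>) \<partial>M)" by (rule integral_distr[OF A_meas that])
    finally show ?thesis .
  qed
  have mgf: "(\<integral>\<^sup>+\<omega>. ennreal (exp (\<theta> * (X 1 \<omega> t - X 1 \<omega> s))) \<partial>N) \<le> ennreal (exp ((exp \<theta> - 1) * L * (t - s)))"
    if "0 \<le> s" "s \<le> t" "t \<le> T" "0 \<le> \<theta>" for s t \<theta>
  proof -
    have "(\<lambda>x. ennreal (exp (\<theta> * (x t - x s)))) \<in> borel_measurable ?P"
      using coord[of t] coord[of s] that by simp
    from nn_transfer[OF this] show ?thesis using A.increment_mgf[OF that] that by simp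
  qed
  have X1_coord: "(\<lambda>\<omega>. X 1 \<omega> t) \<in> borel_measurable N" if "t \<in> {0..T}" for t
    using measurable_compose[OF X1 coord[OF that]] .
  show "iid_paths N T X L"
  proof
    show "N.indep_vars (\<lambda>_. ?P) X {1..}" by (rule ind)
    show "distr N ?P (X i) = distr N ?P (X 1)" if "1 \<le> i" for i using law[OF that] law[of 1] by simp
    show "0 < T" "0 \<le> L" by (rule A.T_pos A.L_nonneg)+
    show "X i \<omega> \<in> D_space T" if "1 \<le> i" "\<omega> \<in> space N" for i \<omega> using that by (rule paths)
    show "AE \<omega> in N. X 1 \<omega> 0 = 0"
    proof (rule AE_transfer)
      show "{x \<in> space ?P. x 0 = 0} \<in> sets ?P"
        using borel_measurable_eq[OF coord[of 0] borel_measurable_const[of 0]] A.T_pos by simp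
      show "AE \<omega> in M. ?A \<omega> 0 = 0"
      proof -
        have "{k. of_int k * \<Delta> + \<xi> k \<omega> \<in> {0<..0}} = {}" for \<omega> by auto
        then have "arrival_count \<Delta> \<xi> \<omega> 0 = 0" for \<omega>
          by (simp only: arrival_count_eq_card card.empty of_nat_0)
        then show ?thesis using A.T_pos by simp
      qed
    qed
    show "AE \<omega> in N. X 1 \<omega> s \<le> X 1 \<omega> t" if "0 \<le> s" "s \<le> t" "t \<le> T" for s t
    proof (rule AE_transfer)
      show "{x \<in> space ?P. x s \<le> x t} \<in> sets ?P"
        using that by (intro borel_measurable_le coord) auto
      show "AE \<omega> in M. ?A \<omega> s \<le> ?A \<omega> t"
        using A.AE_increment_nonneg[OF that] that by simp
    qed
    show int: "integrable N (\<lambda>\<omega>. exp (\<theta> * (X 1 \<omega> t - X 1 \<omega> s)))"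
      if "0 \<le> s" "s \<le> t" "t \<le> T" "0 \<le> \<theta>" for s t \<theta>
    proof (rule integrableI_nonneg)
      show "(\<lambda>\<omega>. exp (\<theta> * (X 1 \<omega> t - X 1 \<omega> s))) \<in> borel_measurable N"
        using X1_coord[of t] X1_coord[of s] that by simp
      show "(\<integral>\<^sup>+\<omega>. ennreal (exp (\<theta> * (X 1 \<omega> t - X 1 \<omega> s))) \<partial>N) < \<infinity>"
        using mgf[OF that] by (rule le_less_trans) simp
    qed simp
    show "N.expectation (\<lambda>\<omega>. exp (\<theta> * (X 1 \<omega> t - X 1 \<omega> s))) \<le> exp ((exp \<theta> - 1) * L * (t - s))"
      if "0 \<le> s" "s \<le> t" "t \<le> T" "0 \<le> \<theta>" for s t \<theta>
      using mgf[OF that] nn_integral_eq_integral[OF int[OF that]] by simp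
  qed
  have cost_eq: "cost M (arrival_count \<Delta> \<xi>) J \<alpha> \<phi> = cost N (X 1) J \<alpha> \<phi>" if J: "J \<subseteq> {0<..T}" for J \<alpha> \<phi>
  proof -
    have "(\<lambda>x. exp (\<Sum>t\<in>J. \<alpha> t * x t)) \<in> borel_measurable ?P"
      using J coord by (intro borel_measurable_exp[THEN measurable_compose[rotated]] borel_measurable_sum
          borel_measurable_times borel_measurable_const) auto
    from int_transfer[OF this]
    have "(\<integral>\<omega>. exp (\<Sum>t\<in>J. \<alpha> t * X 1 \<omega> t) \<partial>N) = (\<integral>\<omega>. exp (\<Sum>t\<in>J. \<alpha> t * ?A \<omega> t) \<partial>M)" .
    also have "(\<lambda>\<omega>. \<Sum>t\<in>J. \<alpha> t * ?A \<omega> t) = (\<lambda>\<omega>. \<Sum>t\<in>J. \<alpha> t * arrival_count \<Delta> \<xi> \<omega> t)"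
      using J by (intro ext sum.cong) auto
    finally show ?thesis by (simp add: cost_def)
  qed
  have "rate_J M (arrival_count \<Delta> \<xi>) T c x \<le> a \<longleftrightarrow> rate_J N (X 1) T c x \<le> a" for x a
    unfolding rate_J_le_iff by (auto simp: cost_eq)
  then show "rate_J M (arrival_count \<Delta> \<xi>) T c = rate_J N (X 1) T c"
    by (intro ext antisym) auto
qed

section \<open>Reflection and contraction\<close>

lemma reflection_le:
  assumes x: "x \<in> D_space T" and "0 \<le> s" "s \<le> t" "t \<le> T"
  shows "x t - x s \<le> reflection T x t"
proof -
  obtain K where K: "\<And>t. t \<in> {0..T} \<Longrightarrow> \<bar>x t\<bar> \<le> K" using D_space_bounded[OF x] by blast
  have "x t - x s \<le> 2 * K" if "s \<in> {0..t}" for s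
  proof -
    have "\<bar>x t\<bar> \<le> K" "\<bar>x s\<bar> \<le> K" using that assms by (auto intro!: K)
    then show ?thesis by linarith
  qed
  then have "bdd_above ((\<lambda>s. x t - x s) ` {0..t})" by (intro bdd_aboveI2)
  then have "x t - x s \<le> (SUP s\<in>{0..t}. x t - x s)" using assms by (intro cSUP_upper) auto
  then show ?thesis using assms by (simp add: reflection_def)
qed

lemma reflection_least:
  assumes "0 \<le> t" "t \<le> T" "\<And>s. 0 \<le> s \<Longrightarrow> s \<le> t \<Longrightarrow> x t - x s \<le> b"
  shows "reflection T x t \<le> b"
proof -
  have "(SUP s\<in>{0..t}. x t - x s) \<le> b" using assms by (intro cSUP_least) auto
  then show ?thesis using assms by (simp add: reflection_def)
qed

text \<open>The supremum moves at most twice: once through the end value at \<open>v\<close> and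
  once through a new competitor \<open>s\<close> between \<open>u\<close> and
  \<open>v\<close>.\<close>

lemma reflection_oscillation:
  assumes x: "x \<in> D_space T" and uv: "0 \<le> u" "u \<le> v" "v \<le> T"
    and osc: "\<And>w. u \<le> w \<Longrightarrow> w \<le> v \<Longrightarrow> \<bar>x w - x u\<bar> \<le> e"
  shows "\<bar>reflection T x v - reflection T x u\<bar> \<le> 2 * e"
proof -
  have v: "\<bar>x v - x u\<bar> \<le> e" using uv by (intro osc) auto
  have "0 \<le> reflection T x u" using reflection_le[OF x, of u u] uv by simp
  then have "reflection T x v \<le> reflection T x u + 2 * e"
  proof (intro reflection_least)
    fix s assume s: "0 \<le> s" "s \<le> v"
    show "x v - x s \<le> reflection T x u + 2 * e"
    proof (cases "s \<le> u")
      case True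
      then show ?thesis using reflection_le[OF x, of s u] v s uv by linarith
    next
      case False
      then show ?thesis using osc[of s] v s \<open>0 \<le> reflection T x u\<close> by linarith
    qed
  qed (use uv in auto)
  moreover have "reflection T x u \<le> reflection T x v + 2 * e"
  proof (intro reflection_least)
    fix s assume "0 \<le> s" "s \<le> u"
    then show "x u - x s \<le> reflection T x v + 2 * e"
      using reflection_le[OF x, of s v] v uv by linarith
  qed (use uv in auto)
  ultimately show ?thesis by linarith
qed

lemma reflection_in_D_space:
  assumes x: "x \<in> D_space T"
  shows "reflection T x \<in> D_space T"
proof -
  have right: "(reflection T x \<longlongrightarrow> reflection T x t) (at_right t)" if t: "t \<in> {0..<T}" for t
  proof (rule tendstoI)
    fix e :: real assume e: "0 < e"
    have "eventually (\<lambda>s. dist (x s) (x t) < e / 3) (at_right t)"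
      using e t x by (intro tendstoD) (auto simp: D_space_def)
    then obtain u where u: "u > t" "\<And>s. t < s \<Longrightarrow> s < u \<Longrightarrow> \<bar>x s - x t\<bar> < e / 3"
      by (auto simp: eventually_at_right_field dist_real_def)
    have "eventually (\<lambda>s. s \<in> {t<..<min u T}) (at_right t)"
      using u(1) t by (intro eventually_at_right_real) auto
    then show "eventually (\<lambda>s. dist (reflection T x s) (reflection T x t) < e) (at_right t)"
    proof eventually_elim
      case (elim s)
      have "\<bar>x w - x t\<bar> \<le> e / 3" if "t \<le> w" "w \<le> s" for w
        using u(2)[of w] that elim e by (cases "w = t") auto
      then have "\<bar>reflection T x s - reflection T x t\<bar> \<le> 2 * (e / 3)"
        using t elim by (intro reflection_oscillation[OF x]) auto
      then show ?case using e by (simp add: dist_real_def)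
    qed
  qed
  have left: "\<exists>l. (reflection T x \<longlongrightarrow> l) (at_left t)" if t: "t \<in> {0<..T}" for t
  proof -
    obtain K where K: "\<And>t. t \<in> {0..T} \<Longrightarrow> \<bar>x t\<bar> \<le> K" using D_space_bounded[OF x] by blast
    \<comment> \<open>Reflection is \<open>x\<close> plus the running supremum of
      \<open>- x\<close>, a bounded monotone function, so left limits exist although the supremum
      runs over a moving interval. \<open>max 0 u\<close> extends it monotonically to negative
      \<open>u\<close>.\<close>
    define m where "m u = (SUP s\<in>{0..max 0 u}. - x s)" for u
    have bdd: "bdd_above ((\<lambda>s. - x s) ` {0..max 0 u})" if "u \<le> T" for u
    proof (rule bdd_aboveI2)
      fix s assume "s \<in> {0..max 0 u}"
      then have "\<bar>x s\<bar> \<le> K" using that t by (intro K) auto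
      then show "- x s \<le> K" by linarith
    qed
    have "(m \<longlongrightarrow> Sup (m ` ({..<t} \<inter> UNIV))) (at t within ({..<t} \<inter> UNIV))"
    proof (rule Lim_left_bound)
      fix a b :: real assume ab: "b < t" "a \<le> b"
      show "m a \<le> m b"
        unfolding m_def using ab t by (intro cSUP_subset_mono bdd) auto
    next
      fix b assume b: "b < t"
      show "m b \<le> K"
        unfolding m_def
      proof (rule cSUP_least)
        fix s assume "s \<in> {0..max 0 b}"
        then have "\<bar>x s\<bar> \<le> K" using b t by (intro K) auto
        then show "- x s \<le> K" by linarith
      qed auto
    qed
    then have m: "(m \<longlongrightarrow> Sup (m ` {..<t})) (at_left t)" by simp
    obtain l where l: "(x \<longlongrightarrow> l) (at_left t)" using D_space_left[OF x t] by blast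
    have "eventually (\<lambda>s. s \<in> {0<..<t}) (at_left t)"
      using t by (intro eventually_at_left_real) auto
    then have "eventually (\<lambda>s. x s + m s = reflection T x s) (at_left t)"
    proof eventually_elim
      case (elim u)
      then have u: "0 \<le> u" "u \<le> T" "max 0 u = u" using t by auto
      have "- x s \<le> reflection T x u - x u" if "0 \<le> s" "s \<le> u" for s
        using reflection_le[OF x that u(2)] by linarith
      then have "m u \<le> reflection T x u - x u"
        unfolding m_def u(3) using u by (intro cSUP_least) auto
      moreover have "reflection T x u \<le> x u + m u"
      proof (rule reflection_least[OF u(1,2)])
        fix s assume "0 \<le> s" "s \<le> u"
        then have "- x s \<le> m u"
          unfolding m_def using u bdd[of u] by (intro cSUP_upper) auto
        then show "x u - x s \<le> x u + m u" by linarith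
      qed
      ultimately show ?case by linarith
    qed
    then show ?thesis
      using Lim_transform_eventually[OF tendsto_add[OF l m]] by blast
  qed
  have "reflection T x \<in> extensional {0..T}" by (simp add: reflection_def)
  with left right show ?thesis unfolding D_space_def by blast
qed

text \<open>An increasing bijection of \<open>[0,T]\<close> maps \<open>[0,t]\<close> onto
  \<open>[0,l t]\<close>, so the same time change works for both suprema. The difference
  \<open>x t - x s\<close> contains two values, hence the factor 2.\<close>

lemma J1_close_reflection:
  assumes T: "0 \<le> T" and x: "x \<in> D_space T" and y: "y \<in> D_space T" and close: "J1_close T e x y"
  shows "J1_close T (2 * e) (reflection T x) (reflection T y)"
proof -
  obtain l where l: "l \<in> time_changes T"
    and le: "\<And>t. t \<in> {0..T} \<Longrightarrow> \<bar>l t - t\<bar> \<le> e \<and> \<bar>x t - y (l t)\<bar> \<le> e"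
    using close unfolding J1_close_def by blast
  have "0 \<le> e" using le[of 0] T by auto
  have sm: "strict_mono_on {0..T} l" using l by (simp add: time_changes_def)
  have "\<bar>reflection T x t - reflection T y (l t)\<bar> \<le> 2 * e" if t: "t \<in> {0..T}" for t
  proof -
    have lt: "l t \<in> {0..T}" by (rule time_change_in[OF l t])
    have "reflection T x t \<le> reflection T y (l t) + 2 * e"
    proof (rule reflection_least)
      fix s assume s: "0 \<le> s" "s \<le> t"
      then have s_in: "s \<in> {0..T}" using t by auto
      have "l s \<le> l t"
        using strict_mono_on_imp_mono_on[OF sm] s_in t s(2) by (auto simp: mono_on_def)
      then have "y (l t) - y (l s) \<le> reflection T y (l t)"
        using time_change_in[OF l s_in] lt by (intro reflection_le[OF y]) auto
      then show "x t - x s \<le> reflection T y (l t) + 2 * e"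
        using le[OF t] le[OF s_in] by linarith
    qed (use t in auto)
    moreover have "reflection T y (l t) \<le> reflection T x t + 2 * e"
    proof (rule reflection_least)
      fix s' assume s': "0 \<le> s'" "s' \<le> l t"
      then have "s' \<in> l ` {0..T}" using time_change_image[OF l T] lt by auto
      then obtain s where s: "s \<in> {0..T}" "s' = l s" by blast
      have "s \<le> t"
        using strict_mono_onD[OF sm t s(1)] s' s(2) by (meson not_le)
      then have "x t - x s \<le> reflection T x t"
        using s t by (intro reflection_le[OF x]) auto
      then show "y (l t) - y s' \<le> reflection T x t + 2 * e"
        unfolding s(2) using le[OF t] le[OF s(1)] by linarith
    qed (use lt in auto)
    ultimately show ?thesis by linarith
  qed
  moreover have "\<bar>l t - t\<bar> \<le> 2 * e" if "t \<in> {0..T}" for t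
    using le[OF that] \<open>0 \<le> e\<close> by linarith
  ultimately show ?thesis unfolding J1_close_def using l by blast
qed

lemma continuous_map_reflection:
  assumes T: "0 \<le> T"
  shows "continuous_map (J1_topology T) (J1_topology T) (reflection T)"
proof -
  interpret J: Metric_space "D_space T" "J1_dist T" by (rule Metric_space_J1[OF T])
  have top: "topspace (J1_topology T) = D_space T" by (rule topspace_J1_topology[OF T])
  have "openin (J1_topology T) {x \<in> D_space T. reflection T x \<in> U}" if U: "openin (J1_topology T) U" for U
    unfolding J1_topology_def J.openin_mtopology
  proof (intro conjI allI impI)
    fix x assume x: "x \<in> {x \<in> D_space T. reflection T x \<in> U}"
    then obtain r where r: "0 < r" "J.mball (reflection T x) r \<subseteq> U"
      using U unfolding J1_topology_def J.openin_mtopology by blast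
    have "J.mball x (r / 2) \<subseteq> {x \<in> D_space T. reflection T x \<in> U}"
    proof
      fix y assume y: "y \<in> J.mball x (r / 2)"
      then have xy: "x \<in> D_space T" "y \<in> D_space T" "J1_dist T x y < r / 2" by auto
      obtain e where e: "0 < e" "e < r / 2" "J1_close T e x y"
        using J1_dist_lessD[OF xy] .
      have "J1_dist T (reflection T x) (reflection T y) \<le> 2 * e"
        using e(1) J1_close_reflection[OF T xy(1,2) e(3)] reflection_in_D_space[OF xy(1)]
          reflection_in_D_space[OF xy(2)] by (intro J1_dist_le) auto
      then have "reflection T y \<in> J.mball (reflection T x) r"
        using e(2) reflection_in_D_space[OF xy(1)] reflection_in_D_space[OF xy(2)] by simp
      then show "y \<in> {x \<in> D_space T. reflection T x \<in> U}" using r(2) xy(2) by blast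
    qed
    then show "\<exists>r>0. J.mball x r \<subseteq> {x \<in> D_space T. reflection T x \<in> U}"
      using r(1) by (intro exI[of _ "r / 2"]) simp
  qed auto
  then show ?thesis
    using reflection_in_D_space by (auto simp: continuous_map_def top)
qed

section \<open>Contraction principle and the workload\<close>

text \<open>An infimum over fibres followed by one over a set is a single infimum over the preimage,
  which is closed or open with the set. Goodness of the image rate function is not part of the
  conclusion.\<close>

lemma LDP_contraction:
  assumes LDP: "LDP_speed_n N E Y I" and \<psi>: "continuous_map E E' \<psi>"
    and Y: "\<And>n \<omega>. \<omega> \<in> space N \<Longrightarrow> Y n \<omega> \<in> topspace E"
  shows "LDP_speed_n N E' (\<lambda>n \<omega>. \<psi> (Y n \<omega>)) (\<lambda>q. INF x\<in>{x \<in> topspace E. q = \<psi> x}. I x)"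
    (is "LDP_speed_n N E' ?Z ?K")
  unfolding LDP_speed_n_def
proof (intro conjI allI impI ballI)
  have maps: "\<psi> x \<in> topspace E'" if "x \<in> topspace E" for x
    using \<psi> that by (auto simp: continuous_map_def)
  \<comment> \<open>Preimages are intersected with the carrier of \<open>E\<close>; the events agree
    because \<open>Y\<close> takes its values there.\<close>
  have event: "{\<omega> \<in> space N. ?Z n \<omega> \<in> S} = {\<omega> \<in> space N. Y n \<omega> \<in> {x \<in> topspace E. \<psi> x \<in> S}}" for n S
    using Y by auto
  show "?Z n \<in> N \<rightarrow>\<^sub>M borel_sigma E'" if n: "1 \<le> n" for n
    unfolding borel_sigma_def
  proof (intro measurable_measure_of)
    show "{U. openin E' U} \<subseteq> Pow (topspace E')" using openin_subset by blast
    show "?Z n \<in> space N \<rightarrow> topspace E'" using maps Y by auto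
    fix U assume "U \<in> {U. openin E' U}"
    then have "openin E {x \<in> topspace E. \<psi> x \<in> U}"
      using \<psi> by (auto simp: continuous_map_def)
    then have "{x \<in> topspace E. \<psi> x \<in> U} \<in> sets (borel_sigma E)"
      unfolding borel_sigma_def using openin_subset by (subst sets_measure_of) auto
    moreover have "Y n \<in> N \<rightarrow>\<^sub>M borel_sigma E" using LDP n by (simp add: LDP_speed_n_def)
    ultimately have "Y n -` {x \<in> topspace E. \<psi> x \<in> U} \<inter> space N \<in> sets N"
      by (rule measurable_sets[rotated])
    moreover have "Y n -` {x \<in> topspace E. \<psi> x \<in> U} \<inter> space N = ?Z n -` U \<inter> space N"
      using Y by auto
    ultimately show "?Z n -` U \<inter> space N \<in> sets N" by simp
  qed
  show "0 \<le> ?K q" if "q \<in> topspace E'" for q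
    using LDP by (intro INF_greatest) (auto simp: LDP_speed_n_def)
  show "limsup (\<lambda>n. ereal (1 / real n) * log_prob (measure N {\<omega> \<in> space N. ?Z n \<omega> \<in> C}))
      \<le> - (INF q\<in>C. ?K q)" if C: "closedin E' C" for C
  proof -
    let ?C = "{x \<in> topspace E. \<psi> x \<in> C}"
    have "closedin E ?C" using \<psi> C by (rule closedin_continuous_map_preimage)
    then have "limsup (\<lambda>n. ereal (1 / real n) * log_prob (measure N {\<omega> \<in> space N. Y n \<omega> \<in> ?C}))
      \<le> - (INF x\<in>?C. I x)"
      using LDP unfolding LDP_speed_n_def by blast
    also have "(INF q\<in>C. ?K q) \<le> (INF x\<in>?C. I x)"
    proof (rule INF_greatest)
      fix x assume "x \<in> ?C"
      then show "(INF q\<in>C. ?K q) \<le> I x" by (intro INF_lower2[of "\<psi> x"] INF_lower) auto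
    qed
    then have "- (INF x\<in>?C. I x) \<le> - (INF q\<in>C. ?K q)" by simp
    finally show ?thesis unfolding event .
  qed
  show "- (INF q\<in>G. ?K q) \<le>
      liminf (\<lambda>n. ereal (1 / real n) * log_prob (measure N {\<omega> \<in> space N. ?Z n \<omega> \<in> G}))"
    if G: "openin E' G" for G
  proof -
    let ?G = "{x \<in> topspace E. \<psi> x \<in> G}"
    have "(INF x\<in>?G. I x) \<le> (INF q\<in>G. ?K q)"
      by (intro INF_greatest INF_superset_mono) (auto intro!: INF_lower)
    then have "- (INF q\<in>G. ?K q) \<le> - (INF x\<in>?G. I x)" by simp
    also have "openin E ?G" using \<psi> G by (auto simp: continuous_map_def)
    then have "- (INF x\<in>?G. I x) \<le>
        liminf (\<lambda>n. ereal (1 / real n) * log_prob (measure N {\<omega> \<in> space N. Y n \<omega> \<in> ?G}))"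
      using LDP unfolding LDP_speed_n_def by blast
    finally show ?thesis unfolding event .
  qed
qed

lemma workload_eq: "workload T c X n \<omega> = reflection T (net_input T c X n \<omega>)"
  by (simp add: workload_def reflection_def)

theorem mainTheorem2:
  fixes \<Delta> T c :: real
    and M :: "'a measure" and \<xi> :: "int \<Rightarrow> 'a \<Rightarrow> real"
    and F f :: "real \<Rightarrow> real"
    and N :: "'b measure" and X :: "nat \<Rightarrow> 'b \<Rightarrow> real \<Rightarrow> real"
  assumes "\<Delta> > 0" and "T > 0" and "c > 0"
    and "prob_space M"
    and "prob_space.indep_vars M (\<lambda>_. borel) \<xi> UNIV"
    and "\<And>k x. F x = measure M {\<omega> \<in> space M. \<xi> k \<omega> \<le> x}"
    and "\<And>x. f x \<ge> 0"
    and "\<And>k. distributed M lborel (\<xi> k) (\<lambda>x. ennreal (f x))"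
    and "(SUP u\<in>{0..T}. \<Sum>\<^sub>\<infinity>k\<in>UNIV. ennreal (f (u - of_int k * \<Delta>))) < \<infinity>"
    and "prob_space N"
    and "iid_copies N T X M (arrival_count \<Delta> \<xi>)"
  shows "LDP_speed_n N (J1_topology T) (net_input T c X) (rate_J M (arrival_count \<Delta> \<xi>) T c) \<and>
    good_rate (J1_topology T) (rate_J M (arrival_count \<Delta> \<xi>) T c) \<and>
    LDP_speed_n N (J1_topology T) (workload T c X) (rate_K M (arrival_count \<Delta> \<xi>) T c)"
proof -
  let ?S = "SUP u\<in>{0..T}. \<Sum>\<^sub>\<infinity>k\<in>UNIV. ennreal (f (u - of_int k * \<Delta>))"
  \<comment> \<open>The finite supremum itself serves as the intensity bound \<open>L\<close>;
    finiteness guarantees that its conversion to a real number loses nothing.\<close>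
  have L: "ennreal (enn2real ?S) = ?S"
    using assms(9) by (intro ennreal_enn2real) (simp only: infinity_ennreal_def)
  have "(\<Sum>k\<in>I. ennreal (f (u - of_int k * \<Delta>))) \<le> ennreal (enn2real ?S)"
    if I: "finite I" and u: "u \<in> {0..T}" for I u
  proof -
    \<comment> \<open>For nonnegative extended terms the infinite sum is the supremum of its finite
      partial sums.\<close>
    have "(\<Sum>k\<in>I. ennreal (f (u - of_int k * \<Delta>))) \<le> (\<Sum>\<^sub>\<infinity>k\<in>UNIV. ennreal (f (u - of_int k * \<Delta>)))"
      using I by (subst nonneg_infsum_complete) (auto intro!: SUP_upper)
    also have "\<dots> \<le> ?S" by (rule SUP_upper[OF u])
    finally show ?thesis unfolding L .
  qed
  then have "scheduled_arrivals M \<Delta> T (enn2real ?S) \<xi> f"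
    using assms by (intro scheduled_arrivals.intro scheduled_arrivals_axioms.intro enn2real_nonneg)
  note paths = iid_copies_paths[OF this assms(10,11)]
  interpret P: iid_paths N T X "enn2real ?S" c by (rule paths(1))
  note LDP = P.net_input_LDP[folded paths(2)[of c]]
  have "LDP_speed_n N (J1_topology T) (\<lambda>n \<omega>. reflection T (net_input T c X n \<omega>))
      (\<lambda>q. INF x\<in>{x \<in> topspace (J1_topology T). q = reflection T x}.
        rate_J M (arrival_count \<Delta> \<xi>) T c x)"
    using P.net_input_in_D_space \<open>T > 0\<close>
    by (intro LDP_contraction[OF LDP continuous_map_reflection]) (auto simp: topspace_J1_topology)
  moreover have "(\<lambda>n \<omega>. reflection T (net_input T c X n \<omega>)) = workload T c X"
    by (intro ext) (simp only: workload_eq)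
  moreover have "(\<lambda>q. INF x\<in>{x \<in> topspace (J1_topology T). q = reflection T x}.
      rate_J M (arrival_count \<Delta> \<xi>) T c x) = rate_K M (arrival_count \<Delta> \<xi>) T c"
    using \<open>T > 0\<close> by (intro ext) (simp add: rate_K_def topspace_J1_topology)
  ultimately show ?thesis
    using LDP P.good_rate_J[folded paths(2)[of c]] by simp
qed

end
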